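(* Let $d\ge2$, $d/2<p<\infty$, and $M>d-1$. There exist $C_{d,M,p}>0$ and $0<\alpha<1$, depending only on $M,d,p$, such that for every $V_1,V_2\in L^p_{\mathrm{rad}}(\mathbb B^d;\mathbb R)$ satisfying $$\max_{j=1,2}\|V_j\|_{L^p(\mathbb B^d)}<\frac{|\mathbb S^{d-1}|^{\frac1p}}{4}\,\frac{p-d/2}{p-1}\,M,\qquad \int_{\mathbb B^d}|V_1^{\mathrm B}(x)-V_2^{\mathrm B}(x)||x|^{M-(d-2)}dx<|\mathbb S^{d-1}|,$$ one has $$\|V_1-V_2\|_{L^1(\mathbb B^d)}\le C_{d,M,p}\left(\int_{\mathbb B^d}|V_1^{\mathrm B}(x)-V_2^{\mathrm B}(x)||x|^{M-(d-2)}dx\right)^\alpha,$$ where $V_j^{\mathrm B}$ is the Born approximation of $V_j$.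
   Context: $\mathbb B^d=\{x\in\mathbb R^d:|x|<1\}$, $\mathbb S^{d-1}=\partial\mathbb B^d$, $|\mathbb S^{d-1}|$ is its surface measure, $\mathbb N_0=\{0,1,2,\dots\}$; $L^p_{\mathrm{rad}}(\mathbb B^d;\mathbb R)$ denotes the real-valued radial functions in $L^p(\mathbb B^d)$; for $p>d/2$ it is contained in $\mathcal V_d$ below. The space $\mathcal V_d$: real-valued radial $V\in L^1_{\mathrm{loc}}(\mathbb B^d\setminus\{0\})$, $V=q(|\cdot|)$, with $$\|V\|_{\mathcal V_d}:=\sup_{j\in\mathbb N_0}\int_{2^{-(j+1)}<|x|<2^{-j}}|V(x)||x|^{2-d}dx<\infty .$$ Constants: $\beta_V:=\frac{2}{|\mathbb S^{d-1}|}\max\big(\sqrt{6|\mathbb S^{d-1}|\,\|V\|_{\mathcal V_d}},3e\|V\|_{\mathcal V_d}\big)$, $k_V:=\beta_V-\frac{d-2}{2}$. For an integer $k\ge0$, $k>k_V$, there is a unique solution $b_k$ on $(0,1]$ of $$-\frac1{r^{d-1}}\frac{d}{dr}\Big(r^{d-1}\frac{d b_k}{dr}\Big)+\Big(\frac{k(k+d-2)}{r^2}+q(r)\Big)b_k=0,\qquad b_k(1)=1,$$ such that $b_k(|x|)Y_k(x/|x|)\in L^2(\mathbb B^d,|x|^{-2}dx)$ for all spherical harmonics $Y_k$ of degree $k$; set $\lambda_k[V]:=\partial_rb_k(1)$ (when the Dirichlet-to-Neumann map of $-\Delta+V$ on $\mathbb B^d$ is well defined, this is its eigenvalue on spherical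 harmonics of degree $k$). Born approximation: $V^{\mathrm B}$ is the unique radial function that belongs to $L^1(\mathbb B^d,|x|^{2s}dx)$ for some $s>0$ and satisfies $$\frac1{|\mathbb S^{d-1}|}\int_{\mathbb B^d}V^{\mathrm B}(x)|x|^{2k}dx=\lambda_k[V]-k\qquad\text{for all sufficiently large integers }k$$ (it exists for every $V\in\mathcal V_d$). *)

theory Defs
  imports "HOL-Analysis.Analysis"
begin

text \<open>
  The ambient space is an arbitrary Euclidean space \<open>'a\<close>, so that \<open>d = DIM('a)\<close>, and the unit
  ball carries Lebesgue measure \<open>lebesgue_on (ball 0 1)\<close>. Functions on the ball are total functions
  on \<open>'a\<close>; all notions below only depend on their class modulo null sets of the ball.
\<close>

text \<open>Surface measure on the unit sphere: by polar coordinates, the cone over \<open>A\<close>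
  has volume \<open>\<integral>\<^sub>0\<^sup>1 r\<^sup>d\<^sup>-\<^sup>1 \<sigma>(A) dr = \<sigma>(A) / d\<close>.\<close>

definition sphere_measure :: "'a::euclidean_space set \<Rightarrow> real" where
  "sphere_measure A =
     real DIM('a) * measure lebesgue {t *\<^sub>R x | t x. 0 < t \<and> t < 1 \<and> x \<in> A \<inter> sphere 0 1}"

definition radial_profile :: "('a::euclidean_space \<Rightarrow> real) \<Rightarrow> (real \<Rightarrow> real) \<Rightarrow> bool" where
  "radial_profile V q \<longleftrightarrow> (AE x in lebesgue_on (ball 0 1). V x = q (norm x))"

definition radial :: "('a::euclidean_space \<Rightarrow> real) \<Rightarrow> bool" where
  "radial V \<longleftrightarrow> (\<exists>q. radial_profile V q)"

definition Lp_rad :: "real \<Rightarrow> ('a::euclidean_space \<Rightarrow> real) set" where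
  "Lp_rad p = {V. V \<in> borel_measurable (lebesgue_on (ball 0 1)) \<and>
                  integrable (lebesgue_on (ball 0 1)) (\<lambda>x. \<bar>V x\<bar> powr p) \<and> radial V}"

definition Lp_norm :: "real \<Rightarrow> ('a::euclidean_space \<Rightarrow> real) \<Rightarrow> real" where
  "Lp_norm p V = (LINT x|lebesgue_on (ball 0 1). \<bar>V x\<bar> powr p) powr (1 / p)"

definition laplacian :: "('a::euclidean_space \<Rightarrow> real) \<Rightarrow> 'a \<Rightarrow> real" where
  "laplacian P x = (\<Sum>i\<in>Basis. (deriv ^^ 2) (\<lambda>t. P (x + t *\<^sub>R i)) 0)"

definition spherical_harmonic :: "nat \<Rightarrow> ('a::euclidean_space \<Rightarrow> real) \<Rightarrow> bool" where
  "spherical_harmonic k Y \<longleftrightarrow>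
     (\<exists>P. real_polynomial_function P \<and>
          (\<forall>t x. P (t *\<^sub>R x) = t ^ k * P x) \<and>
          (\<forall>x. laplacian P x = 0) \<and>
          (\<forall>x\<in>sphere 0 1. Y x = P x))"

text \<open>
  Solutions on \<open>(0,1]\<close> of \<open>- r\<^sup>1\<^sup>-\<^sup>d (r\<^sup>d\<^sup>-\<^sup>1 b')' + (k(k+d-2)/r\<^sup>2 + q) b = 0\<close>. As \<open>q\<close> is only locally
  integrable, this is meant in the Caratheodory sense: \<open>r\<^sup>d\<^sup>-\<^sup>1 b'\<close> is locally absolutely continuous and
  the equation holds almost everywhere, which is expressed in integrated form with \<open>w = b'\<close>.
\<close>

definition radial_solution :: "nat \<Rightarrow> (real \<Rightarrow> real) \<Rightarrow> nat \<Rightarrow> (real \<Rightarrow> real) \<Rightarrow> bool" where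
  "radial_solution d q k b \<longleftrightarrow>
     (\<exists>w. (\<forall>r\<in>{0<..1}. (b has_real_derivative w r) (at r within {0<..1})) \<and>
          (\<forall>s r. 0 < s \<and> s \<le> r \<and> r \<le> 1 \<longrightarrow>
             (let f = (\<lambda>t. t ^ (d - 1) *
                         ((real k * (real k + real d - 2) / t\<^sup>2 + q t) * b t))
              in f absolutely_integrable_on {s..r} \<and>
                 r ^ (d - 1) * w r - s ^ (d - 1) * w s = integral {s..r} f)))"

definition regular_solution :: "('a::euclidean_space \<Rightarrow> real) \<Rightarrow> nat \<Rightarrow> (real \<Rightarrow> real) \<Rightarrow> bool" where
  "regular_solution V k b \<longleftrightarrow>
     (\<exists>q. radial_profile V q \<and> radial_solution DIM('a) q k b) \<and> b 1 = 1 \<and>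
     (\<forall>Y :: 'a \<Rightarrow> real. spherical_harmonic k Y \<longrightarrow>
        integrable (lebesgue_on (ball 0 1))
          (\<lambda>x. (b (norm x) * Y (x /\<^sub>R norm x))\<^sup>2 * norm x powr (-2)))"

text \<open>
  The regular solution is only determined on \<open>(0,1]\<close>, hence the description of its one-sided
  derivative at 1 rather than of the solution itself. The value is meaningful whenever the regular
  solution exists and is unique on \<open>(0,1]\<close>, which holds for all large enough \<open>k\<close>
  (above a threshold depending on \<open>V\<close>).
\<close>

definition dn_eigenvalue :: "('a::euclidean_space \<Rightarrow> real) \<Rightarrow> nat \<Rightarrow> real" where
  "dn_eigenvalue V k =
     (THE l. \<exists>b. regular_solution V k b \<and> (b has_real_derivative l) (at 1 within {0<..1}))"

text \<open>The Born approximation is unique up to null sets; the predicate holds for each of its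
  representatives.\<close>

definition born_approximation ::
    "('a::euclidean_space \<Rightarrow> real) \<Rightarrow> ('a \<Rightarrow> real) \<Rightarrow> bool" where
  "born_approximation V B \<longleftrightarrow>
     radial B \<and>
     (\<exists>s>0. integrable (lebesgue_on (ball 0 1)) (\<lambda>x. B x * norm x powr (2 * s))) \<and>
     (\<forall>\<^sub>F k in sequentially.
        1 / sphere_measure (sphere 0 1 :: 'a set) *
          (LINT x|lebesgue_on (ball 0 1). B x * norm x ^ (2 * k))
        = dn_eigenvalue V k - real k)"

end

theory Submission
  imports Defs
begin

text \<open>
  In the variable \<open>t = - ln r\<close>, with \<open>\<nu> = (d - 2) / 2\<close>, \<open>\<mu> = k + \<nu>\<close> and
  \<open>Q(t) = e\<^sup>-\<^sup>2\<^sup>t q(e\<^sup>-\<^sup>t)\<close>, the regular solution is \<open>b\<^sub>k(e\<^sup>-\<^sup>t) = e\<^sup>-\<^sup>k\<^sup>t m(t)\<close>, where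
  \<open>m(t) = 1 + \<integral>\<^sub>0\<^sup>\<infinity> N(t,z) e\<^sup>-\<^sup>2\<^sup>\<mu>\<^sup>z dz\<close> with a kernel \<open>N\<close> independent of \<open>k\<close> and
  \<open>\<bar>N(t,z)\<bar> \<le> 2 R e\<^sup>2\<^sup>R\<^sup>z\<close> for \<open>R \<ge> \<parallel>Q\<parallel>\<^sub>1\<close>; moreover \<open>\<lambda>\<^sub>k - k = \<integral> Q m e\<^sup>-\<^sup>2\<^sup>\<mu>\<^sup>s ds\<close>. A symmetry of the
  Green function gives \<open>\<lambda>\<^sub>k[V\<^sub>1] - \<lambda>\<^sub>k[V\<^sub>2] = \<integral> (Q\<^sub>1 - Q\<^sub>2) m\<^sub>1 m\<^sub>2 e\<^sup>-\<^sup>2\<^sup>\<mu>\<^sup>s ds\<close>, and \<open>m\<^sub>1 m\<^sub>2\<close> is again one plus a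
  Laplace transform, with kernel \<open>H\<close>. Since the Born approximations represent the same numbers as Laplace
  transforms of \<open>A\<^sub>j(t) = e\<^sup>-\<^sup>2\<^sup>t V\<^sub>j\<^sup>B(e\<^sup>-\<^sup>t)\<close>, uniqueness of moments yields the Volterra equation
  \<open>A\<^sub>1 - A\<^sub>2 = D + \<integral> D(t) H(t, \<sqdot> - t) dt\<close> for \<open>D = Q\<^sub>1 - Q\<^sub>2\<close>. The exponential bound on \<open>H\<close> makes the
  integral term absorbable in \<open>L\<^sup>1(e\<^sup>-\<^sup>w\<^sup>t dt)\<close> for large \<open>w\<close>. Finally the \<open>L\<^sup>p\<close> bound with \<open>p > d / 2\<close>
  controls \<open>D\<close> in \<open>L\<^sup>1(e\<^sup>c\<^sup>t dt)\<close> for some \<open>c > 0\<close>, and interpolation gives the Hoelder estimate in \<open>L\<^sup>1(dt)\<close>.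
\<close>

text \<open>The obstacle is that \<open>Q\<close> may be large. The fixed point equation for N is
  therefore solved in a norm weighted by e^(2 R z): convolution with a window integrates this weight
  over (0,z) and gains 1/(2R), which beats the factor R from integration against \<open>Q\<close>
  and leaves a contraction by 1/2. One kernel then serves all frequencies, and m is defined as soon
  as \<mu> > R. The same rate decides the end of the proof. H grows at most like e^(3 R z), so its
  Volterra operator has norm at most 4R / (w - 3R) in L^1(e^(-w t) dt), which is 1/2 for w = 11R;
  the weight M of the Born data is therefore raised to max M (11 R). Only this weak norm of D is
  recovered, and the exponent c / (w + c) is the price of returning to the unweighted norm.
  Eigenvalues are prescribed for large k only; the moment argument is applied after multiplication
  by e^(-2 \<mu> s) with a large first \<mu>, and this positive factor can be removed again. On the
  ball, a radial profile is an arbitrary function, so it must be replaced by a Borel one before any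
  integral is transformed.\<close>

abbreviation decay :: "real \<Rightarrow> real \<Rightarrow> real" where
  "decay \<mu> s \<equiv> exp (- (2 * \<mu> * s))"

abbreviation ball_measure :: "'a::euclidean_space measure" where
  "ball_measure \<equiv> lebesgue_on (ball 0 1)"

abbreviation borel2 :: "(real \<Rightarrow> real \<Rightarrow> real) \<Rightarrow> bool" where
  "borel2 G \<equiv> case_prod G \<in> borel_measurable (borel \<Otimes>\<^sub>M borel)"

abbreviation weighted_L2 :: "real \<Rightarrow> (real \<Rightarrow> real) \<Rightarrow> bool" where
  "weighted_L2 \<nu> \<beta> \<equiv> integrable lborel (\<lambda>t. indicator {0..} t * ((\<beta> t)\<^sup>2 * exp (- (2 * \<nu> * t))))"

abbreviation log_rhs :: "real \<Rightarrow> real \<Rightarrow> (real \<Rightarrow> real) \<Rightarrow> (real \<Rightarrow> real) \<Rightarrow> real \<Rightarrow> real" where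
  "log_rhs \<nu> K Q \<beta> s \<equiv> exp (- (2 * \<nu> * s)) * ((K + Q s) * \<beta> s)"

lemma integrable_dominated:
  fixes f g :: "'a \<Rightarrow> real"
  assumes "integrable M g" "\<And>x. norm (f x) \<le> norm (g x)" "f \<in> borel_measurable M"
  shows "integrable M f" using assms by (intro Bochner_Integration.integrable_bound[of M g f]) auto

lemmas integrable_bound_lint = Bochner_Integration.integrable_bound
lemmas lint_cong = Bochner_Integration.integral_cong

section \<open>Integration lemmas\<close>

lemma Fubini_kernel:
  fixes D :: "real \<Rightarrow> real" and K :: "real \<Rightarrow> real \<Rightarrow> real"
  assumes D: "integrable lborel D" and K [measurable]: "borel2 K"
    and int: "\<And>t. integrable lborel (K t)" and bnd: "\<And>t. (LBINT z. \<bar>K t z\<bar>) \<le> C"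
  shows "(LBINT z. (LBINT t. D t * K t z)) = (LBINT t. D t * (LBINT z. K t z))"
    and "integrable lborel (\<lambda>t. D t * (LBINT z. K t z))"
    and "integrable lborel (\<lambda>z. LBINT t. D t * K t z)"
    and "AE z in lborel. integrable lborel (\<lambda>t. D t * K t z)"
proof -
  have [measurable]: "D \<in> borel_measurable borel" using D by auto
  have pair: "integrable (lborel \<Otimes>\<^sub>M lborel) (\<lambda>(t, z). D t * K t z)"
  proof (rule lborel_pair.Fubini_integrable)
    show "integrable lborel (\<lambda>t. LBINT z. norm (case (t, z) of (t, z) \<Rightarrow> D t * K t z))"
    proof (rule integrable_dominated[OF integrable_mult_left[OF integrable_abs[OF D], of C]])
      show "norm (LBINT z. norm (case (t, z) of (t, z) \<Rightarrow> D t * K t z)) \<le> norm (\<bar>D t\<bar> * C)" for t using bnd[of t]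
        by (auto simp: abs_mult intro!: mult_left_mono intro: order_trans[OF _ abs_ge_self])
    qed measurable
  qed (use int in auto)
  show "(LBINT z. (LBINT t. D t * K t z)) = (LBINT t. D t * (LBINT z. K t z))"
    using lborel_pair.Fubini_integral[OF pair] by simp
  show "integrable lborel (\<lambda>t. D t * (LBINT z. K t z))" using lborel_pair.integrable_fst[OF pair] by simp
  show "integrable lborel (\<lambda>z. LBINT t. D t * K t z)" using lborel_pair.integrable_snd[OF pair] by simp
  show "AE z in lborel. integrable lborel (\<lambda>t. D t * K t z)" using lborel_pair.AE_integrable_snd[OF pair] by simp
qed

lemma Fubini_dominated:
  fixes D f :: "real \<Rightarrow> real" and G :: "real \<Rightarrow> real \<Rightarrow> real"
  assumes D: "integrable lborel D" and f: "integrable lborel f"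
    and G [measurable]: "borel2 G" and le: "\<And>t z. \<bar>G t z\<bar> \<le> f z"
  shows "(LBINT z. (LBINT t. D t * G t z)) = (LBINT t. D t * (LBINT z. G t z))"
    and "integrable lborel (\<lambda>t. D t * (LBINT z. G t z))"
proof -
  have int: "integrable lborel (G t)" for t by (rule integrable_dominated[OF f]) (auto intro: order_trans[OF le abs_ge_self])
  have bnd: "(LBINT z. \<bar>G t z\<bar>) \<le> (LBINT z. f z)" for t using int le f by (intro integral_mono integrable_abs) auto
  show "(LBINT z. (LBINT t. D t * G t z)) = (LBINT t. D t * (LBINT z. G t z))"
    "integrable lborel (\<lambda>t. D t * (LBINT z. G t z))" by (rule Fubini_kernel[OF D G int bnd])+
qed

text \<open>Translation invariance in \<open>s\<close> reduces the sheared kernel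
  \<open>G t (s - t)\<close> to \<open>Fubini_kernel\<close>. With exponential weights in both
  \<open>D\<close> and \<open>G\<close> this is the convolution theorem for Laplace transforms; with
  nonnegative kernels it is the L^1 bound of a Volterra operator. The third conclusion matters
  because the Bochner integral of a non-integrable function is 0, which would spoil comparison
  estimates.\<close>

lemma Fubini_shift:
  fixes D f :: "real \<Rightarrow> real" and G :: "real \<Rightarrow> real \<Rightarrow> real"
  assumes D: "integrable lborel D" and f: "integrable lborel f"
    and G [measurable]: "borel2 G" and le: "\<And>t z. \<bar>G t z\<bar> \<le> f z"
  shows "(LBINT s. (LBINT t. D t * G t (s - t))) = (LBINT t. D t * (LBINT z. G t z))"
    and "integrable lborel (\<lambda>s. LBINT t. D t * G t (s - t))"
    and "AE s in lborel. integrable lborel (\<lambda>t. D t * G t (s - t))"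
proof -
  have int: "integrable lborel (G t)" for t by (rule integrable_dominated[OF f]) (auto intro: order_trans[OF le abs_ge_self])
  have ints: "integrable lborel (\<lambda>s. G t (s - t))" for t using lborel_integrable_real_affine[OF int[of t], of 1 "-t"] by simp
  have shift: "(LBINT s. h (s - t)) = (LBINT s. h s)" for h :: "real \<Rightarrow> real" and t
    using lborel_integral_real_affine[of 1 h "-t"] by simp
  have bnd: "(LBINT s. \<bar>G t (s - t)\<bar>) \<le> (LBINT z. f z)" for t
    by (subst shift[of "\<lambda>z. \<bar>G t z\<bar>"], intro integral_mono integrable_abs) (use int le f in auto)
  have m: "borel2 (\<lambda>t s. G t (s - t))" by measurable
  note F = Fubini_kernel[OF D m ints bnd]
  show "(LBINT s. (LBINT t. D t * G t (s - t))) = (LBINT t. D t * (LBINT z. G t z))" using F(1) by (simp add: shift)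
  show "integrable lborel (\<lambda>s. LBINT t. D t * G t (s - t))"
    "AE s in lborel. integrable lborel (\<lambda>t. D t * G t (s - t))" by (rule F(3) F(4))+
qed

lemma has_bochner_integral_exp_tail:
  fixes a c :: real
  assumes "0 < c"
  shows "has_bochner_integral lborel (\<lambda>z. if a < z then exp (- (c * z)) else 0) (exp (- (c * a)) / c)"
proof (rule has_bochner_integral_nn_integral)
  have "(\<integral>\<^sup>+z. ennreal (exp (- (c * z))) * indicator {a..} z \<partial>lborel) = 0 - (- exp (- (c * a)) / c)"
  proof (rule nn_integral_FTC_atLeast)
    show "((\<lambda>z. - exp (- (c * z)) / c) \<longlongrightarrow> 0) at_top"
    proof -
      have "filterlim (\<lambda>z. - (c * z)) at_bot at_top"
        using filterlim_tendsto_pos_mult_at_top[OF tendsto_const assms filterlim_ident]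
        by (simp add: filterlim_uminus_at_bot)
      from tendsto_divide[OF tendsto_minus[OF filterlim_compose[OF exp_at_bot this]] tendsto_const[of c]]
      show ?thesis using assms by simp
    qed
    show "((\<lambda>z. - exp (- (c * z)) / c) has_real_derivative exp (- (c * x))) (at x)" for x
      using assms by (auto intro!: derivative_eq_intros)
  qed auto
  moreover have "(\<integral>\<^sup>+z. ennreal (exp (- (c * z))) * indicator {a..} z \<partial>lborel)
      = (\<integral>\<^sup>+z. ennreal (if a < z then exp (- (c * z)) else 0) \<partial>lborel)"
    by (rule nn_integral_cong_AE, rule AE_mp[OF AE_lborel_singleton[of a]], rule AE_I2) (auto simp: indicator_def)
  ultimately show "(\<integral>\<^sup>+z. ennreal (if a < z then exp (- (c * z)) else 0) \<partial>lborel) = ennreal (exp (- (c * a)) / c)" by simp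
qed (use assms in auto)

section \<open>The transformation kernel\<close>

text \<open>The conjugated Dirichlet Green function is a difference of two exponentials divided by 2
  \<mu>, that is, the integral of e^(-2 \<mu> z) over an interval; this is the indicator of that
  interval.\<close>

definition window :: "real \<Rightarrow> real \<Rightarrow> real \<Rightarrow> real" where
  "window t s z = (if max 0 (s - t) < z \<and> z < s then 1 else 0)"

lemma window_measurable [measurable (raw)]:
  assumes [measurable]: "f \<in> borel_measurable M" "g \<in> borel_measurable M" "h \<in> borel_measurable M"
  shows "(\<lambda>x. window (f x) (g x) (h x)) \<in> borel_measurable M" unfolding window_def by measurable

lemma window_bounds: "0 \<le> window t s z" "window t s z \<le> 1" "z \<le> 0 \<Longrightarrow> window t s z = 0" by (auto simp: window_def)

text \<open>The function \<open>m = 1 + \<integral> N(\<sqdot>,z) e\<^sup>-\<^sup>2\<^sup>\<mu>\<^sup>z dz\<close> solves \<open>m(t) = 1 - \<integral> g(t,s) Q(s) m(s) ds\<close> with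
  \<open>g(t,s) = \<integral> window t s z e\<^sup>-\<^sup>2\<^sup>\<mu>\<^sup>z dz\<close>, the Green function of \<open>\<mu>\<^sup>2 - d\<^sup>2/dt\<^sup>2\<close> with Dirichlet condition at
  \<open>0\<close>, conjugated by \<open>e\<^sup>-\<^sup>\<mu>\<^sup>t\<close>. Inverting the Laplace transform turns this into a
  fixed point equation for \<open>N\<close>, free of \<open>\<mu>\<close>.\<close>

definition kernel_step :: "(real \<Rightarrow> real) \<Rightarrow> (real \<Rightarrow> real \<Rightarrow> real) \<Rightarrow> real \<Rightarrow> real \<Rightarrow> real" where
  "kernel_step Q N t z =
     - (LBINT s. Q s * (window t s z + (LBINT y. window t s (z - y) * N s y)))"

lemma kernel_step_measurable [measurable (raw)]:
  assumes [measurable]: "Q \<in> borel_measurable borel"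
    "borel2 N"
  shows "borel2 (kernel_step Q N)" unfolding kernel_step_def by measurable

text \<open>\<open>R\<close> is any positive upper bound of the L^1 norm rather than the norm
  itself: two potentials can then share one \<open>R\<close>, and division by \<open>R\<close> stays
  possible when \<open>Q\<close> vanishes.\<close>

locale log_potential =
  fixes Q :: "real \<Rightarrow> real" and R :: real
  assumes Q_borel [measurable]: "Q \<in> borel_measurable borel"
    and Q_int: "integrable lborel Q"
    and Q_supp: "\<And>s. s \<le> 0 \<Longrightarrow> Q s = 0"
    and Q_le: "(LBINT s. \<bar>Q s\<bar>) \<le> R"
    and R_pos: "0 < R"
begin

text \<open>Weight of Bielecki type: its integral over (0,z) is smaller than its value at z by the
  factor 1/(2R). It vanishes for z <= 0, so a bound by \<open>env\<close> also records the
  support.\<close>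

definition env :: "real \<Rightarrow> real" where
  "env z = (if 0 < z then exp (2 * R * z) else 0)"

lemma env_measurable [measurable]: "env \<in> borel_measurable borel" unfolding env_def by measurable

lemma env_nonneg: "0 \<le> env z" by (simp add: env_def)

lemma env_coeff_nonneg:
  assumes "\<bar>x\<bar> \<le> B * env 1" shows "0 \<le> B"
proof (rule ccontr)
  assume "\<not> 0 \<le> B"
  then have "B * env 1 < 0" by (auto simp: env_def mult_neg_pos)
  then show False using assms by linarith
qed

lemma set_integral_env:
  assumes "0 \<le> z"
  shows "integrable lborel (\<lambda>y. indicator {0..z} y * env y)"
    "(LBINT y. indicator {0..z} y * env y) = (exp (2 * R * z) - 1) / (2 * R)"
proof -
  have d: "((\<lambda>y. exp (2 * R * y) / (2 * R)) has_real_derivative exp (2 * R * y)) (at y)" for y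
    using R_pos by (auto intro!: derivative_eq_intros)
  have c: "isCont (\<lambda>y. exp (2 * R * y)) y" for y by (intro continuous_intros)
  have h: "has_bochner_integral lborel (\<lambda>y. indicator {0..z} y * exp (2 * R * y))
      ((exp (2 * R * z) - 1) / (2 * R))" using has_bochner_integral_FTC_Icc_real[where f="\<lambda>y. exp (2 * R * y)", OF assms d c]
    by (simp add: diff_divide_distrib mult.commute)
  have ae: "AE y in lborel. indicator {0..z} y * exp (2 * R * y) = indicator {0..z} y * env y"
    using AE_lborel_singleton[of 0] by eventually_elim (auto simp: env_def indicator_def)
  have "has_bochner_integral lborel (\<lambda>y. indicator {0..z} y * env y) ((exp (2 * R * z) - 1) / (2 * R))"
    by (rule has_bochner_integralI_AE[OF h _ ae]) simp
  then show "integrable lborel (\<lambda>y. indicator {0..z} y * env y)"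
    "(LBINT y. indicator {0..z} y * env y) = (exp (2 * R * z) - 1) / (2 * R)" by (auto simp: has_bochner_integral_iff)
qed

text \<open>A window is at most 1 and vanishes at nonpositive arguments, while \<open>N s\<close>
  lives on y > 0, so only 0 < y < z contributes and the weight is integrated there. The resulting
  1/(2R) compensates the factor \<open>R\<close> of \<open>integral_Q_mult_bound\<close>.\<close>

lemma window_integral:
  assumes [measurable]: "borel2 N"
    and N: "\<And>s y. \<bar>N s y\<bar> \<le> B * env y"
  shows "integrable lborel (\<lambda>y. window t s (z - y) * N s y)"
    and "\<bar>LBINT y. window t s (z - y) * N s y\<bar> \<le> (if 0 < z then B * (exp (2 * R * z) - 1) / (2 * R) else 0)"
proof -
  have B: "0 \<le> B" using env_coeff_nonneg N[of 0 1] by blast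
  have le: "\<bar>window t s (z - y) * N s y\<bar> \<le> B * (indicator {0..z} y * env y)" for y
  proof (cases "0 \<le> y \<and> y \<le> z")
    case True
    have "\<bar>window t s (z - y) * N s y\<bar> \<le> 1 * (B * env y)"
      unfolding abs_mult by (intro mult_mono N) (use B env_nonneg window_bounds in auto)
    then show ?thesis using True by simp
  next
    case False
    then have "window t s (z - y) * N s y = 0" using N[of s y] by (auto simp: window_def env_def)
    then show ?thesis by (simp only: abs_zero) (use B env_nonneg[of y] in auto)
  qed
  show int: "integrable lborel (\<lambda>y. window t s (z - y) * N s y)"
  proof (cases "0 \<le> z")
    case True
    show ?thesis by (rule integrable_bound_lint[OF integrable_mult_right[OF set_integral_env(1)[OF True], of B]])
        (auto simp only: real_norm_def intro!: always_eventually order_trans[OF le abs_ge_self], measurable)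
  next
    case False
    then have "(\<lambda>y. window t s (z - y) * N s y) = (\<lambda>y. 0)" using le by (auto simp: fun_eq_iff)
    then show ?thesis by simp
  qed
  show "\<bar>LBINT y. window t s (z - y) * N s y\<bar> \<le> (if 0 < z then B * (exp (2 * R * z) - 1) / (2 * R) else 0)"
  proof (cases "0 < z")
    case True
    have "\<bar>LBINT y. window t s (z - y) * N s y\<bar> \<le> (LBINT y. \<bar>window t s (z - y) * N s y\<bar>)" by (rule integral_abs_bound)
    also have "\<dots> \<le> (LBINT y. B * (indicator {0..z} y * env y))"
      using int le True by (intro integral_mono integrable_abs integrable_mult_right set_integral_env) auto
    also have "\<dots> = B * ((exp (2 * R * z) - 1) / (2 * R))"
      using set_integral_env(2)[of z] True by (simp del: times_divide_eq_right)
    finally show ?thesis using True by simp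
  next
    case False
    have "(\<lambda>y. window t s (z - y) * N s y) = (\<lambda>_. 0)"
    proof
      fix y show "window t s (z - y) * N s y = 0"
        using le[of y] False by (cases "y = 0") (auto simp: env_def indicator_def split: if_splits)
    qed
    then show ?thesis using False by (simp only: integral_zero) simp
  qed
qed

lemma integral_Q_mult_bound:
  assumes [measurable]: "f \<in> borel_measurable borel" and f: "\<And>s. \<bar>f s\<bar> \<le> C"
  shows "integrable lborel (\<lambda>s. Q s * f s)" "\<bar>LBINT s. Q s * f s\<bar> \<le> R * C"
proof -
  have C: "0 \<le> C" using f[of 0] by auto
  have le: "\<bar>Q s * f s\<bar> \<le> \<bar>Q s\<bar> * C" for s unfolding abs_mult by (intro mult_mono f) auto
  show int: "integrable lborel (\<lambda>s. Q s * f s)"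
    by (rule integrable_bound_lint[OF integrable_mult_left[OF integrable_abs[OF Q_int], of C]])
      (use le C in \<open>auto intro: order_trans simp: abs_mult\<close>)
  have "\<bar>LBINT s. Q s * f s\<bar> \<le> (LBINT s. \<bar>Q s * f s\<bar>)" by (rule integral_abs_bound)
  also have "\<dots> \<le> (LBINT s. \<bar>Q s\<bar> * C)" using int le by (intro integral_mono integrable_abs integrable_mult_left Q_int) auto
  also have "\<dots> = (LBINT s. \<bar>Q s\<bar>) * C" by simp
  also have "\<dots> \<le> R * C" using Q_le C by (rule mult_right_mono)
  finally show "\<bar>LBINT s. Q s * f s\<bar> \<le> R * C" .
qed

text \<open>The window terms cancel in the difference; integration against \<open>Q\<close> costs R
  and the convolution gives D/(2R), which multiply to D/2. The bounds \<open>B\<close> and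
  \<open>B'\<close> guarantee that the integrals may be subtracted.\<close>

lemma kernel_step_contraction:
  assumes mN [measurable]: "borel2 N"
    and mN' [measurable]: "case_prod N' \<in> borel_measurable (borel \<Otimes>\<^sub>M borel)"
    and N: "\<And>s y. \<bar>N s y\<bar> \<le> B * env y" and N': "\<And>s y. \<bar>N' s y\<bar> \<le> B' * env y"
    and d: "\<And>s y. \<bar>N s y - N' s y\<bar> \<le> D * env y"
  shows "\<bar>kernel_step Q N t z - kernel_step Q N' t z\<bar> \<le> (D / 2) * env z"
proof -
  have D: "0 \<le> D" using env_coeff_nonneg d[of 0 1] by blast
  let ?C = "\<lambda>B. if 0 < z then B * (exp (2 * R * z) - 1) / (2 * R) else 0"
  have int: "integrable lborel (\<lambda>s. Q s * (window t s z + (LBINT y. window t s (z - y) * K s y)))"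
    if [measurable]: "borel2 K"
      and K: "\<And>s y. \<bar>K s y\<bar> \<le> B * env y" for K B
  proof (rule integral_Q_mult_bound(1)[where C = "1 + ?C B"])
    fix s
    show "\<bar>window t s z + (LBINT y. window t s (z - y) * K s y)\<bar> \<le> 1 + ?C B"
      using window_integral(2)[OF that, of t s z] window_bounds(1,2)[of t s z] by linarith
  qed measurable
  have "kernel_step Q N t z - kernel_step Q N' t z
      = - (LBINT s. Q s * (LBINT y. window t s (z - y) * (N s y - N' s y)))" unfolding kernel_step_def minus_diff_minus
    apply (subst Bochner_Integration.integral_diff[symmetric])
      apply (rule int[OF mN N])
     apply (rule int[OF mN' N'])
    apply (simp add: right_diff_distrib[symmetric] Bochner_Integration.integral_diff[OF window_integral(1)[OF mN N] window_integral(1)[OF mN' N'], symmetric])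
    done
  also have "\<bar>\<dots>\<bar> \<le> R * ?C D" unfolding abs_minus_cancel
  proof (rule integral_Q_mult_bound(2))
    fix s show "\<bar>LBINT y. window t s (z - y) * (N s y - N' s y)\<bar> \<le> ?C D" by (rule window_integral(2)) (use d in \<open>auto\<close>)
  qed measurable
  also have "\<dots> \<le> (D / 2) * env z" using R_pos D by (auto simp: env_def field_simps)
  finally show ?thesis .
qed

lemma kernel_step_zero_bound: "\<bar>kernel_step Q (\<lambda>_ _. 0) t z\<bar> \<le> R * (if 0 < z then 1 else 0)"
  unfolding kernel_step_def abs_minus_cancel by (rule integral_Q_mult_bound(2)) (auto simp: window_def)

text \<open>The constant 2R reproduces itself: the window term costs R, and the contraction halves
  2R.\<close>

lemma kernel_step_bound:
  assumes [measurable]: "borel2 N"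
    and N: "\<And>s y. \<bar>N s y\<bar> \<le> (2 * R) * env y"
  shows "\<bar>kernel_step Q N t z\<bar> \<le> (2 * R) * env z"
proof -
  have "\<bar>kernel_step Q N t z - kernel_step Q (\<lambda>_ _. 0) t z\<bar> \<le> (2 * R / 2) * env z"
    by (rule kernel_step_contraction[where B' = 0]) (use N in auto)
  moreover have "R * (if 0 < z then 1 else 0) \<le> R * env z" using R_pos by (auto simp: env_def)
  ultimately show ?thesis using kernel_step_zero_bound[of t z] by auto
qed

section \<open>Picard iteration for the transformation kernel\<close>

definition kernel_iter :: "nat \<Rightarrow> real \<Rightarrow> real \<Rightarrow> real" where
  "kernel_iter n = (kernel_step Q ^^ n) (\<lambda>_ _. 0)"

lemma kernel_iter_measurable [measurable]: "borel2 (kernel_iter n)"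
proof (induction n)
  case (Suc n)
  have "borel2 (kernel_step Q (kernel_iter n))" using Suc by measurable
  then show ?case by (simp add: kernel_iter_def)
qed (simp add: kernel_iter_def)

lemma kernel_iter_Suc: "kernel_iter (Suc n) = kernel_step Q (kernel_iter n)" by (simp add: kernel_iter_def)

lemma kernel_iter_bound: "\<bar>kernel_iter n t z\<bar> \<le> (2 * R) * env z"
proof (induction n arbitrary: t z)
  case 0 then show ?case using R_pos env_nonneg by (simp add: kernel_iter_def)
next
  case (Suc n) then show ?case unfolding kernel_iter_Suc by (intro kernel_step_bound) auto
qed

lemma kernel_iter_diff: "\<bar>kernel_iter (Suc n) t z - kernel_iter n t z\<bar> \<le> (2 * R * (1/2) ^ n) * env z"
proof (induction n arbitrary: t z)
  case 0 show ?case using kernel_iter_bound[of 1 t z] by (simp add: kernel_iter_def)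
next
  case (Suc n)
  show ?case
    using kernel_step_contraction[OF kernel_iter_measurable kernel_iter_measurable kernel_iter_bound kernel_iter_bound Suc, of t z]
    unfolding kernel_iter_Suc by simp
qed

definition tkernel :: "real \<Rightarrow> real \<Rightarrow> real" where
  "tkernel t z = lim (\<lambda>n. kernel_iter n t z)"

lemma tkernel_LIMSEQ: "(\<lambda>n. kernel_iter n t z) \<longlonglongrightarrow> tkernel t z"
proof -
  have "summable (\<lambda>n. kernel_iter (Suc n) t z - kernel_iter n t z)"
    by (rule summable_comparison_test'[where g = "\<lambda>n. (2 * R * env z) * (1/2) ^ n" and N = 0])
      (use kernel_iter_diff[of _ t z] in \<open>auto simp: mult_ac intro!: summable_mult summable_geometric\<close>)
  then have "convergent (\<lambda>n. kernel_iter n t z)" using sum_lessThan_telescope[of "\<lambda>n. kernel_iter n t z"]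
    by (simp only: summable_iff_convergent convergent_diff_const_right_iff)
  then show ?thesis unfolding tkernel_def by (rule convergent_LIMSEQ_iff[THEN iffD1])
qed

lemma tkernel_measurable [measurable]: "borel2 tkernel"
proof (rule borel_measurable_LIMSEQ_real)
  show "(\<lambda>n. case_prod (kernel_iter n) x) \<longlonglongrightarrow> case_prod tkernel x" for x by (cases x) (simp add: tkernel_LIMSEQ)
qed measurable

lemma tkernel_bound: "\<bar>tkernel t z\<bar> \<le> (2 * R) * env z"
  by (rule LIMSEQ_le_const2[OF tendsto_rabs[OF tkernel_LIMSEQ]]) (use kernel_iter_bound in auto)

lemma tkernel_fixpoint: "tkernel t z = kernel_step Q tkernel t z"
proof (rule LIMSEQ_unique)
  show "(\<lambda>n. kernel_iter (Suc n) t z) \<longlonglongrightarrow> tkernel t z" using tkernel_LIMSEQ by (rule LIMSEQ_Suc)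
  \<comment> \<open>Geometric tail: the increments 2R (1/2)^i with i >= n add up to 4R (1/2)^n.
    Combined with the contraction, this passes to the limit inside \<open>kernel_step\<close>
    without exchanging limit and integral.\<close>
  have tail: "\<bar>kernel_iter n s y - tkernel s y\<bar> \<le> (4 * R * (1/2)^n) * env y" for n s y
  proof (rule LIMSEQ_le_const2)
    show "(\<lambda>j. \<bar>kernel_iter n s y - kernel_iter (j + n) s y\<bar>) \<longlonglongrightarrow> \<bar>kernel_iter n s y - tkernel s y\<bar>"
      by (intro tendsto_intros LIMSEQ_ignore_initial_segment tkernel_LIMSEQ)
    have "\<bar>kernel_iter n s y - kernel_iter (j + n) s y\<bar> \<le> (4 * R * (1/2)^n) * (1 - (1/2)^j) * env y" for j
    proof (induction j)
      case (Suc j)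
      have "\<bar>kernel_iter n s y - kernel_iter (Suc j + n) s y\<bar> \<le> \<bar>kernel_iter n s y - kernel_iter (j + n) s y\<bar> + (2 * R * (1/2) ^ (j + n)) * env y"
        using kernel_iter_diff[of "j + n" s y] by simp
      then show ?case using Suc by (simp add: power_add algebra_simps)
    qed simp
    moreover have "(4 * R * (1/2)^n) * (1 - (1/2)^j) * env y \<le> (4 * R * (1/2)^n) * env y" for j using R_pos env_nonneg[of y]
      by (intro mult_right_mono mult_left_le) (auto intro!: power_le_one)
    ultimately show "\<exists>N. \<forall>j\<ge>N. \<bar>kernel_iter n s y - kernel_iter (j + n) s y\<bar> \<le> (4 * R * (1/2)^n) * env y"
      by (meson order_trans)
  qed
  have "(\<lambda>n. kernel_step Q (kernel_iter n) t z - kernel_step Q tkernel t z) \<longlonglongrightarrow> 0"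
  proof (rule tendsto_0_le[where K = 1])
    show "(\<lambda>n. (4 * R * env z / 2) * (1/2)^n :: real) \<longlonglongrightarrow> 0" by (auto intro!: tendsto_mult_right_zero LIMSEQ_realpow_zero)
    show "\<forall>\<^sub>F n in sequentially. norm (kernel_step Q (kernel_iter n) t z - kernel_step Q tkernel t z) \<le> norm ((4 * R * env z / 2) * (1/2)^n :: real) * 1"
    proof (intro always_eventually allI)
      fix n
      have "\<bar>kernel_step Q (kernel_iter n) t z - kernel_step Q tkernel t z\<bar> \<le> (4 * R * (1/2)^n) / 2 * env z"
        by (rule kernel_step_contraction[OF kernel_iter_measurable tkernel_measurable kernel_iter_bound tkernel_bound tail])
      then show "norm (kernel_step Q (kernel_iter n) t z - kernel_step Q tkernel t z) \<le> norm ((4 * R * env z / 2) * (1/2)^n :: real) * 1"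
        using R_pos env_nonneg[of z] by (simp add: abs_mult mult_ac)
    qed
  qed
  then show "(\<lambda>n. kernel_iter (Suc n) t z) \<longlonglongrightarrow> kernel_step Q tkernel t z" unfolding kernel_iter_Suc by (rule LIM_zero_cancel)
qed

end

section \<open>Amplitudes and the exchange identity\<close>

definition green :: "real \<Rightarrow> real \<Rightarrow> real \<Rightarrow> real" where
  "green \<mu> t s = (LBINT z. window t s z * decay \<mu> z)"

lemma green_measurable [measurable]:
  "borel2 (green \<mu>)" unfolding green_def by measurable

lemma integrable_window_exp:
  assumes "0 < \<mu>"
  shows "integrable lborel (\<lambda>z. window t s z * decay \<mu> z)"
  by (rule integrable_bound_lint[OF has_bochner_integral_exp_tail[of "2 * \<mu>" 0, THEN integrable.intros]])
    (use assms in \<open>auto simp: window_def\<close>)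

lemma green_bounds:
  assumes "0 < \<mu>"
  shows "0 \<le> green \<mu> t s" "green \<mu> t s \<le> 1 / (2 * \<mu>)"
proof -
  show "0 \<le> green \<mu> t s" unfolding green_def by (intro Bochner_Integration.integral_nonneg) (auto simp: window_bounds)
  have "green \<mu> t s \<le> (LBINT z. (if 0 < z then decay \<mu> z else 0))" unfolding green_def
    using integrable_window_exp[OF assms] has_bochner_integral_exp_tail[of "2 * \<mu>" 0] assms
    by (intro integral_mono) (auto simp: window_def has_bochner_integral_iff)
  also have "\<dots> = 1 / (2 * \<mu>)"
    using has_bochner_integral_exp_tail[of "2 * \<mu>" 0] assms by (auto simp: has_bochner_integral_iff)
  finally show "green \<mu> t s \<le> 1 / (2 * \<mu>)" .
qed

lemma green_eq:
  assumes "0 < \<mu>" "0 \<le> t" "0 < s"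
  shows "green \<mu> t s = (exp (- (2 * \<mu> * max 0 (s - t))) - decay \<mu> s) / (2 * \<mu>)"
proof -
  let ?h = "\<lambda>a z. if a < z then decay \<mu> z else 0"
  have h: "has_bochner_integral lborel (?h a) (decay \<mu> a / (2 * \<mu>))" for a
    using has_bochner_integral_exp_tail[of "2 * \<mu>" a] assms by simp
  have "AE z in lborel. ?h (max 0 (s - t)) z - ?h s z = window t s z * decay \<mu> z"
    by (rule AE_mp[OF AE_lborel_singleton[of s]], rule AE_I2) (use assms in \<open>auto simp: window_def\<close>)
  from has_bochner_integralI_AE[OF has_bochner_integral_diff[OF h h] _ this]
  show ?thesis unfolding green_def by (simp add: has_bochner_integral_iff diff_divide_distrib)
qed

text \<open>Multiplication by \<open>decay \<mu> t\<close> undoes the conjugation: the product is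
  e^(-\<mu> t) G(t,s) e^(-\<mu> s) with the symmetric Dirichlet Green function G of \<mu>^2 -
  d^2/dt^2.\<close>

lemma green_symmetric:
  assumes "0 < \<mu>" "0 < t" "0 < s"
  shows "decay \<mu> t * green \<mu> t s = decay \<mu> s * green \<mu> s t"
proof -
  have e: "decay \<mu> t * green \<mu> t s = (exp (- (2 * \<mu> * max t s)) - exp (- (2 * \<mu> * (t + s)))) / (2 * \<mu>)"
    if "0 < t" "0 < s" for t s
  proof -
    have "decay \<mu> t * exp (- (2 * \<mu> * max 0 (s - t))) = exp (- (2 * \<mu> * max t s))"
      by (auto simp: exp_add[symmetric] max_def algebra_simps)
    then show ?thesis
      using green_eq[of \<mu> t s] assms(1) that by (simp add: right_diff_distrib exp_add[symmetric] algebra_simps)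
  qed
  show ?thesis using e[of t s] e[of s t] assms by (simp add: max.commute add.commute)
qed

context log_potential begin

definition laplace_env :: "real \<Rightarrow> real \<Rightarrow> real" where
  "laplace_env \<mu> z = (if 0 < z then exp (- ((2 * \<mu> - 2 * R) * z)) else 0)"

lemma laplace_env_eq: "env z * decay \<mu> z = laplace_env \<mu> z"
  by (simp add: env_def laplace_env_def exp_add[symmetric] algebra_simps)

lemma has_integral_laplace_env:
  assumes "R < \<mu>" shows "has_bochner_integral lborel (laplace_env \<mu>) (1 / (2 * \<mu> - 2 * R))"
  using has_bochner_integral_exp_tail[of "2 * \<mu> - 2 * R" 0] assms by (simp add: laplace_env_def[abs_def])

lemma laplace_env_measurable [measurable]: "laplace_env \<mu> \<in> borel_measurable borel" unfolding laplace_env_def by measurable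

lemma tkernel_laplace_bound:
  "\<bar>tkernel t z * decay \<mu> z\<bar> \<le> 2 * R * laplace_env \<mu> z" using mult_right_mono[OF tkernel_bound[of t z], of "decay \<mu> z"]
  by (simp add: laplace_env_eq[symmetric] abs_mult mult_ac)

lemma integrable_tkernel_laplace:
  assumes "R < \<mu>" shows "integrable lborel (\<lambda>z. tkernel t z * decay \<mu> z)"
  by (rule integrable_bound_lint[OF integrable_mult_right[OF has_integral_laplace_env[OF assms, THEN integrable.intros], of "2 * R"]])
    (use tkernel_laplace_bound in \<open>auto intro!: always_eventually intro: order_trans[OF _ abs_ge_self] simp only: real_norm_def, measurable\<close>)

definition amp :: "real \<Rightarrow> real \<Rightarrow> real" where
  "amp \<mu> t = 1 + (LBINT z. tkernel t z * decay \<mu> z)"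

lemma amp_measurable [measurable]: "amp \<mu> \<in> borel_measurable borel" unfolding amp_def by measurable

text \<open>Integrating the kernel bound gives 2R / (2 \<mu> - 2R). For \<mu> >= 3R the amplitude
  thus lies in [1/2, 3/2], which keeps the regular solution positive in the uniqueness
  argument.\<close>

lemma amp_near_one:
  assumes "R < \<mu>" shows "\<bar>amp \<mu> t - 1\<bar> \<le> R / (\<mu> - R)"
proof -
  have "\<bar>amp \<mu> t - 1\<bar> \<le> (LBINT z. 2 * R * laplace_env \<mu> z)"
    unfolding amp_def using has_integral_laplace_env[OF assms] integrable_tkernel_laplace[OF assms] tkernel_laplace_bound
    by (simp only: add_diff_cancel_left', intro order_trans[OF integral_abs_bound] integral_mono integrable_abs integrable_mult_right)
      (auto simp: has_bochner_integral_iff)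
  also have "\<dots> = R / (\<mu> - R)"
    using has_integral_laplace_env[OF assms] assms by (simp add: has_bochner_integral_iff field_simps)
  finally show ?thesis .
qed

lemma amp_bound:
  assumes "R < \<mu>" shows "\<bar>amp \<mu> t\<bar> \<le> 1 + R / (\<mu> - R)" using amp_near_one[OF assms, of t] by linarith

lemma integrable_Q_amp:
  assumes "R < \<mu>" shows "integrable lborel (\<lambda>s. Q s * amp \<mu> s)"
  by (rule integral_Q_mult_bound(1)) (use amp_bound[OF assms] in auto)

text \<open>Laplace transform in \<open>z\<close> of the fixed point equation: the window becomes
  \<open>green\<close>, the convolution becomes \<open>green\<close> times the transform of the
  kernel, and together they give \<open>amp\<close> times \<open>green\<close>.\<close>

lemma amp_equation:
  assumes \<mu>: "R < \<mu>"
  shows "amp \<mu> t = 1 - (LBINT s. Q s * amp \<mu> s * green \<mu> t s)"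
proof -
  have \<mu>0: "0 < \<mu>" using \<mu> R_pos by linarith
  define e where "e = (\<lambda>z. decay \<mu> z)"
  have [measurable]: "e \<in> borel_measurable borel" unfolding e_def by measurable
  have e_add: "e z = e (z - y) * e y" for z y by (simp add: e_def exp_add[symmetric] algebra_simps)
  define G where "G s z = (window t s z + (LBINT y. window t s (z - y) * tkernel s y)) * e z" for s z
  have [measurable]: "borel2 G" unfolding G_def by measurable
  \<comment> \<open>The window contributes at most 1 and the convolution at most e^(2 R z) - 1,
    together at most \<open>env z\<close>.\<close>
  have G_le: "\<bar>G s z\<bar> \<le> laplace_env \<mu> z" for s z
  proof -
    have "\<bar>window t s z + (LBINT y. window t s (z - y) * tkernel s y)\<bar> \<le> env z"
      using window_integral(2)[OF tkernel_measurable tkernel_bound, of t s z] window_bounds(1,2)[of t s z] window_bounds(3)[of z t s] R_pos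
      by (auto simp: env_def split: if_splits)
    from mult_right_mono[OF this, of "e z"] show ?thesis by (simp add: G_def laplace_env_eq[symmetric] e_def abs_mult)
  qed
  have G_int: "(LBINT z. G s z) = amp \<mu> s * green \<mu> t s" for s
  proof -
    have w: "integrable lborel (\<lambda>z. window t s z * e z)" unfolding e_def by (rule integrable_window_exp[OF \<mu>0])
    have n: "integrable lborel (\<lambda>z. tkernel s z * e z)" unfolding e_def by (rule integrable_tkernel_laplace[OF \<mu>])
    have [measurable]: "borel2 (\<lambda>y z. window t s z * e z)" by measurable
    have le: "\<bar>window t s z * e z\<bar> \<le> window t s z * e z" for z by (simp add: window_bounds e_def)
    note sh = Fubini_shift[OF n w _ le]
    have eq: "(LBINT y. window t s (z - y) * tkernel s y) * e z
        = (LBINT y. tkernel s y * e y * (window t s (z - y) * e (z - y)))" for z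
      unfolding integral_mult_left_zero[symmetric] by (intro lint_cong refl) (metis (no_types, lifting) e_add mult.assoc mult.commute)
    have "(LBINT z. G s z) = (LBINT z. window t s z * e z)
       + (LBINT z. (LBINT y. tkernel s y * e y * (window t s (z - y) * e (z - y))))" unfolding G_def distrib_right eq
      by (intro Bochner_Integration.integral_add w sh) measurable
    also have "\<dots> = green \<mu> t s + (LBINT y. tkernel s y * e y * green \<mu> t s)" by (subst sh(1)) (auto simp: green_def e_def)
    finally show ?thesis by (simp add: amp_def distrib_right e_def)
  qed
  have "(LBINT z. tkernel t z * e z) = (LBINT z. - (LBINT s. Q s * G s z))"
    by (subst tkernel_fixpoint) (simp add: kernel_step_def G_def mult.assoc[symmetric] flip: integral_mult_left_zero)
  also have "\<dots> = - (LBINT s. Q s * (LBINT z. G s z))"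
    using Fubini_dominated(1)[OF Q_int has_integral_laplace_env[OF \<mu>, THEN integrable.intros] _ G_le] by simp
  finally show ?thesis unfolding G_int amp_def[of \<mu> t] e_def by (simp add: mult_ac)
qed

end

text \<open>Insert the integral equation of m2 into the weighted integral of Q1 m1 m2, and that of
  m1 into the one of Q2 m2 m1. Each expansion contains a double integral of Q1 m1 and Q2 m2 against
  the weighted Green function; the two agree by \<open>green_symmetric\<close> and Fubini, and
  cancel in the difference.\<close>

lemma amp_exchange:
  assumes P1: "log_potential Q1 R" and P2: "log_potential Q2 R" and \<mu>: "R < \<mu>"
  defines "m1 \<equiv> log_potential.amp Q1 \<mu>" and "m2 \<equiv> log_potential.amp Q2 \<mu>"
  shows "(LBINT s. Q1 s * m1 s * decay \<mu> s) - (LBINT s. Q2 s * m2 s * decay \<mu> s)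
    = (LBINT s. (Q1 s - Q2 s) * (m1 s * m2 s * decay \<mu> s))"
proof -
  interpret P1: log_potential Q1 R by fact
  interpret P2: log_potential Q2 R by fact
  have \<mu>0: "0 < \<mu>" using \<mu> P1.R_pos by linarith
  \<comment> \<open>The weight exceeds 1 on the negative axis, so it is cut off where both
    potentials vanish; the truncated weight is bounded by 1.\<close>
  define e where "e = (\<lambda>z. if 0 < z then decay \<mu> z else 0)"
  have e_m [measurable]: "e \<in> borel_measurable borel" unfolding e_def by measurable
  have e_le: "0 \<le> e s" "e s \<le> 1" for s using \<mu>0 by (auto simp: e_def)
  have [measurable]: "m1 \<in> borel_measurable borel" "m2 \<in> borel_measurable borel" by (auto simp: m1_def m2_def)
  define C where "C = 1 + R / (\<mu> - R)"
  have C: "\<bar>m1 s\<bar> \<le> C" "\<bar>m2 s\<bar> \<le> C" "0 \<le> C" for s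
    using P1.amp_bound[OF \<mu>] P2.amp_bound[OF \<mu>] \<mu> P1.R_pos by (auto simp: m1_def m2_def C_def)
  have i1: "integrable lborel (\<lambda>s. Q1 s * m1 s)" and i2: "integrable lborel (\<lambda>s. Q2 s * m2 s)"
    using P1.integrable_Q_amp[OF \<mu>] P2.integrable_Q_amp[OF \<mu>] by (auto simp: m1_def m2_def)
  have J: "integrable lborel (\<lambda>s. q s * m s * (m' s * e s))" "integrable lborel (\<lambda>s. q s * m s * e s)"
    if qm: "integrable lborel (\<lambda>s. q s * m s)" and [measurable]: "m' \<in> borel_measurable borel"
      and m': "\<And>s. \<bar>m' s\<bar> \<le> C" for q m m' :: "real \<Rightarrow> real"
  proof -
    have "\<bar>m' s * e s\<bar> \<le> C * 1" for s unfolding abs_mult using m' e_le C(3) by (intro mult_mono) auto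
    then have "\<bar>q s * m s * (m' s * e s)\<bar> \<le> \<bar>\<bar>q s * m s\<bar> * C\<bar>" for s
      unfolding abs_mult[of "q s * m s"] using C(3) by (auto simp: abs_mult intro!: mult_left_mono)
    moreover have [measurable]: "(\<lambda>s. q s * m s) \<in> borel_measurable lborel" using qm by simp
    ultimately show "integrable lborel (\<lambda>s. q s * m s * (m' s * e s))"
      by (intro integrable_bound_lint[OF integrable_mult_left[OF integrable_abs[OF qm], of C]])
        (auto simp only: real_norm_def, measurable)
    show "integrable lborel (\<lambda>s. q s * m s * e s)" using qm e_le by (intro integrable_bound_lint[OF integrable_abs[OF qm]])
        (auto simp: abs_mult mult_left_le intro!: always_eventually)
  qed
  have G: "(LBINT s. q s * m s * (m' s * e s)) = (LBINT s. q s * m s * e s)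
      - (LBINT t. q t * m t * (LBINT s. e t * green \<mu> t s * (q' s * m' s)))"
    if qm: "integrable lborel (\<lambda>s. q s * m s)" and mm [measurable]: "m' \<in> borel_measurable borel"
      and m': "\<And>s. \<bar>m' s\<bar> \<le> C" and eqn: "\<And>t. m' t = 1 - (LBINT s. q' s * m' s * green \<mu> t s)"
    for q m q' m' :: "real \<Rightarrow> real"
  proof -
    have *: "q t * m t * (LBINT s. e t * green \<mu> t s * (q' s * m' s)) = q t * m t * e t - q t * m t * (m' t * e t)" for t
    proof -
      have "(LBINT s. e t * green \<mu> t s * (q' s * m' s)) = e t * (LBINT s. q' s * m' s * green \<mu> t s)"
        by (simp add: mult_ac flip: integral_mult_right_zero)
      also have "\<dots> = e t * (1 - m' t)" using eqn[of t] by simp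
      finally have h: "(LBINT s. e t * green \<mu> t s * (q' s * m' s)) = e t * (1 - m' t)" .
      show ?thesis unfolding h by (simp add: algebra_simps)
    qed
    show ?thesis unfolding * using J[OF qm mm m'] by (subst Bochner_Integration.integral_diff) auto
  qed
  have F: "(LBINT t. Q1 t * m1 t * (LBINT s. e t * green \<mu> t s * (Q2 s * m2 s)))
      = (LBINT t. Q2 t * m2 t * (LBINT s. e t * green \<mu> t s * (Q1 s * m1 s)))"
  proof -
    have le: "\<bar>e t * green \<mu> t s * (Q2 s * m2 s)\<bar> \<le> (1 / (2 * \<mu>)) * \<bar>Q2 s * m2 s\<bar>" for t s
    proof -
      have "e t * green \<mu> t s \<le> 1 * (1 / (2 * \<mu>))" using e_le green_bounds[OF \<mu>0] by (intro mult_mono) auto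
      then show ?thesis unfolding abs_mult[of "e t * green \<mu> t s"]
        using e_le[of t] green_bounds[OF \<mu>0, of t s] by (intro mult_right_mono) (auto simp: abs_mult)
    qed
    have "(LBINT t. Q1 t * m1 t * (LBINT s. e t * green \<mu> t s * (Q2 s * m2 s)))
       = (LBINT s. (LBINT t. Q1 t * m1 t * (e t * green \<mu> t s * (Q2 s * m2 s))))"
      by (rule Fubini_dominated(1)[OF i1 _ _ le, symmetric])
        (use i2 in \<open>auto intro!: integrable_mult_right integrable_abs simp del: integrable_mult_right_iff\<close>)
    also have "\<dots> = (LBINT s. Q2 s * m2 s * (LBINT t. e s * green \<mu> s t * (Q1 t * m1 t)))"
    proof (intro lint_cong refl)
      fix s
      have "Q1 t * m1 t * (e t * green \<mu> t s * (Q2 s * m2 s)) = Q2 s * m2 s * (e s * green \<mu> s t * (Q1 t * m1 t))" for t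
      proof (cases "0 < t \<and> 0 < s")
        case True
        then show ?thesis using green_symmetric[OF \<mu>0, of t s] by (simp add: e_def mult_ac)
      next
        case False
        then have "Q1 t = 0 \<or> Q2 s = 0" using P1.Q_supp P2.Q_supp by (auto simp: not_less)
        then show ?thesis by auto
      qed
      from this show "(LBINT t. Q1 t * m1 t * (e t * green \<mu> t s * (Q2 s * m2 s))) = Q2 s * m2 s * (LBINT t. e s * green \<mu> s t * (Q1 t * m1 t))"
        by (simp only: integral_mult_right_zero)
    qed
    finally show ?thesis .
  qed
  have e1: "m1 t = 1 - (LBINT s. Q1 s * m1 s * green \<mu> t s)" and e2: "m2 t = 1 - (LBINT s. Q2 s * m2 s * green \<mu> t s)" for t
    unfolding m1_def m2_def by (rule P1.amp_equation[OF \<mu>] P2.amp_equation[OF \<mu>])+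
  have "(LBINT s. Q1 s * m1 s * e s) - (LBINT s. Q2 s * m2 s * e s)
    = (LBINT s. Q1 s * m1 s * (m2 s * e s)) - (LBINT s. Q2 s * m2 s * (m1 s * e s))"
    using G[OF i1 _ C(2) e2] G[OF i2 _ C(1) e1] F by simp
  also have "\<dots> = (LBINT s. (Q1 s - Q2 s) * (m1 s * m2 s * e s))"
  proof -
    have "integrable lborel (\<lambda>s. Q1 s * m1 s * (m2 s * e s))" "integrable lborel (\<lambda>s. Q2 s * m2 s * (m1 s * e s))"
      by (rule J(1)[OF i1 _ C(2)] J(1)[OF i2 _ C(1)], measurable)+
    then show ?thesis by (subst Bochner_Integration.integral_diff[symmetric])
        (auto intro!: lint_cong simp: algebra_simps)
  qed
  finally have *: "(LBINT s. Q1 s * m1 s * e s) - (LBINT s. Q2 s * m2 s * e s) = \<dots>" .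
  have h: "Q1 s * x * e s = Q1 s * x * decay \<mu> s" "Q2 s * x * e s = Q2 s * x * decay \<mu> s"
    "(Q1 s - Q2 s) * (x * e s) = (Q1 s - Q2 s) * (x * decay \<mu> s)" for s x
    using P1.Q_supp[of s] P2.Q_supp[of s] by (auto simp: e_def)
  show ?thesis using * unfolding h .
qed

section \<open>The radial equation in logarithmic variables\<close>

lemma C1_increment:
  fixes F f :: "real \<Rightarrow> real"
  assumes "a \<le> b" "\<And>x. x \<in> {a..b} \<Longrightarrow> (F has_real_derivative f x) (at x within {a..b})"
    "continuous_on {a..b} f"
  shows "set_integrable lborel {a..b} f" "F b - F a = (LINT s:{a..b}|lborel. f s)"
proof -
  have "has_bochner_integral lborel (\<lambda>x. indicator {a..b} x *\<^sub>R f x) (F b - F a)" by (rule has_bochner_integral_FTC_Icc)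
      (use assms in \<open>auto simp: has_real_derivative_iff_has_vector_derivative[symmetric]\<close>)
  then show "set_integrable lborel {a..b} f" "F b - F a = (LINT s:{a..b}|lborel. f s)"
    by (auto simp: has_bochner_integral_iff set_integrable_def set_lebesgue_integral_def)
qed

text \<open>Integration by parts for factors whose derivatives are merely integrable, as happens for
  e^(-2 \<nu> t) \<beta>' with an L^1 potential. Absolute continuity is expressed through
  increments, and everything reduces to Fubini on a triangle.\<close>

lemma product_increment:
  fixes f g F G :: "real \<Rightarrow> real"
  assumes ab: "a \<le> b" and f: "set_integrable lborel {a..b} f" and g: "set_integrable lborel {a..b} g"
    and F: "\<And>t. t \<in> {a..b} \<Longrightarrow> F t - F a = (LINT s:{a..t}|lborel. f s)"
    and G: "\<And>t. t \<in> {a..b} \<Longrightarrow> G t - G a = (LINT s:{a..t}|lborel. g s)"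
  shows "set_integrable lborel {a..b} (\<lambda>t. f t * G t + F t * g t)"
    and "F b * G b - F a * G a = (LINT t:{a..b}|lborel. f t * G t + F t * g t)"
proof -
  define f' g' where "f' = (\<lambda>s. indicator {a..b} s * f s)" and "g' = (\<lambda>s. indicator {a..b} s * g s)"
  have f': "integrable lborel f'" and g': "integrable lborel g'" using f g by (auto simp: f'_def g'_def set_integrable_def)
  have [measurable]: "f' \<in> borel_measurable borel" "g' \<in> borel_measurable borel" using f' g' by auto
  define I where "I h t = (LBINT s. (if s \<le> t then h s else 0))" for h :: "real \<Rightarrow> real" and t
  have I_meas [measurable]: "I h \<in> borel_measurable borel" if [measurable]: "h \<in> borel_measurable borel" for h
    unfolding I_def by measurable
  have I_int: "integrable lborel (\<lambda>s. if s \<le> t then h s else 0)" if "integrable lborel h" for h :: "real \<Rightarrow> real" and t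
    by (rule integrable_bound_lint[OF that]) (use that in auto)
  have I_bound: "\<bar>I h t\<bar> \<le> (LBINT s. \<bar>h s\<bar>)" if "integrable lborel h" for h t unfolding I_def using that I_int[OF that]
    by (intro order_trans[OF integral_abs_bound] integral_mono integrable_abs) auto
  have I_set: "I (\<lambda>s. indicator {a..b} s * h s) t = (LINT s:{a..t}|lborel. h s)" if "t \<in> {a..b}" for h t
    unfolding I_def set_lebesgue_integral_def by (rule lint_cong[OF refl]) (use that in \<open>auto simp: indicator_def\<close>)
  have Fe: "F t = F a + I f' t" and Ge: "G t = G a + I g' t" if "t \<in> {a..b}" for t
    using F[OF that] G[OF that] I_set[OF that] by (auto simp: f'_def g'_def)
  have I_prod: "integrable lborel (\<lambda>t. h t * I k t)" if h: "integrable lborel h" and k: "integrable lborel k" for h k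
  proof (rule integrable_bound_lint[OF integrable_mult_left[OF integrable_abs[OF h], of "LBINT s. \<bar>k s\<bar>"]])
    have [measurable]: "h \<in> borel_measurable borel" "k \<in> borel_measurable borel" using h k by auto
    show "(\<lambda>t. h t * I k t) \<in> borel_measurable lborel" by measurable
    show "AE x in lborel. norm (h x * I k x) \<le> norm (\<bar>h x\<bar> * (LBINT s. \<bar>k s\<bar>))"
      using I_bound[OF k] by (auto simp: abs_mult intro!: always_eventually mult_left_mono)
  qed
  have Ib: "I h b = (LBINT s. h s)" if "\<And>s. s > b \<Longrightarrow> h s = 0" for h unfolding I_def using that by (intro lint_cong) auto
  have f'0: "f' s = 0" "g' s = 0" if "s > b" for s using that by (auto simp: f'_def g'_def)
  \<comment> \<open>Exchanging the order on the triangle s <= t turns an integral up to t into one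
    from s to b, that is, the total minus an initial part.\<close>
  have swap: "(LBINT t. f' t * I g' t) = I f' b * I g' b - (LBINT t. g' t * I f' t)"
  proof -
    have le: "\<bar>if s \<le> t then g' s else 0\<bar> \<le> \<bar>g' s\<bar>" for s t by auto
    have "(LBINT t. f' t * I g' t) = (LBINT s. (LBINT t. f' t * (if s \<le> t then g' s else 0)))"
      unfolding I_def by (rule Fubini_dominated(1)[OF f' integrable_abs[OF g'] _ le, symmetric]) measurable
    also have "\<dots> = (LBINT s. g' s * (I f' b - I f' s))"
    proof (rule lint_cong[OF refl])
      fix s
      have "(LBINT t. f' t * (if s \<le> t then g' s else 0)) = g' s * (LBINT t. (if s \<le> t then f' t else 0))"
        unfolding integral_mult_right_zero[symmetric] by (rule lint_cong[OF refl]) simp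
      also have "(LBINT t. (if s \<le> t then f' t else 0)) = (LBINT t. f' t - (if t \<le> s then f' t else 0))"
      proof (rule integral_cong_AE)
        show "AE t in lborel. (if s \<le> t then f' t else 0) = f' t - (if t \<le> s then f' t else 0)"
          by (rule AE_mp[OF AE_lborel_singleton[of s]], rule AE_I2) auto
      qed measurable
      also have "\<dots> = I f' b - I f' s" using Ib[OF f'0(1)] I_int[OF f'] f' by (simp add: I_def)
      finally show "(LBINT t. f' t * (if s \<le> t then g' s else 0)) = g' s * (I f' b - I f' s)" .
    qed
    also have "\<dots> = I f' b * I g' b - (LBINT t. g' t * I f' t)"
      using I_prod[OF g' f'] g' Ib[OF f'0(2)] by (simp add: right_diff_distrib)
    finally show ?thesis .
  qed
  have eq: "indicator {a..b} t * (f t * G t + F t * g t) = (G a * f' t + f' t * I g' t) + (F a * g' t + g' t * I f' t)" for t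
    using Fe[of t] Ge[of t] by (auto simp: f'_def g'_def indicator_def algebra_simps)
  show "set_integrable lborel {a..b} (\<lambda>t. f t * G t + F t * g t)" unfolding set_integrable_def real_scaleR_def eq
    using f' g' I_prod[OF f' g'] I_prod[OF g' f'] by (intro Bochner_Integration.integrable_add integrable_mult_right)
  have "(LINT t:{a..b}|lborel. f t * G t + F t * g t) = G a * I f' b + F a * I g' b + I f' b * I g' b"
    unfolding set_lebesgue_integral_def real_scaleR_def eq
    using f' g' I_prod[OF f' g'] I_prod[OF g' f'] swap Ib[OF f'0(1)] Ib[OF f'0(2)] by simp
  also have "\<dots> = F b * G b - F a * G a" using Fe[of b] Ge[of b] ab by (simp add: algebra_simps)
  finally show "F b * G b - F a * G a = (LINT t:{a..b}|lborel. f t * G t + F t * g t)" ..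
qed

text \<open>For \<open>\<beta>(t) = b(e\<^sup>-\<^sup>t)\<close> and \<open>p = e\<^sup>-\<^sup>2\<^sup>\<nu>\<^sup>t \<beta>'\<close> the radial equation reads
  \<open>p' = e\<^sup>-\<^sup>2\<^sup>\<nu>\<^sup>t (K + Q) \<beta>\<close>, with \<open>K = k (k + 2 \<nu>)\<close>.\<close>

definition log_solution :: "real \<Rightarrow> real \<Rightarrow> (real \<Rightarrow> real) \<Rightarrow> (real \<Rightarrow> real) \<Rightarrow> (real \<Rightarrow> real) \<Rightarrow> bool" where
  "log_solution \<nu> K Q \<beta> p \<longleftrightarrow>
     (\<forall>t\<ge>0. (\<beta> has_real_derivative exp (2 * \<nu> * t) * p t) (at t within {0..})) \<and>
     (\<forall>a b. 0 \<le> a \<longrightarrow> a \<le> b \<longrightarrow>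
        set_integrable lborel {a..b} (log_rhs \<nu> K Q \<beta>) \<and>
        p b - p a = (LINT s:{a..b}|lborel. log_rhs \<nu> K Q \<beta> s))"

lemma at_within_Ici_eq_Icc:
  fixes t :: real assumes "0 \<le> t" shows "at t within {0..} = at t within {0..t + 1}"
proof (rule at_within_nhd)
  show "t \<in> {..<t + 1}" "open {..<t + 1}" by auto
  show "{0..} \<inter> {..<t + 1} - {t} = {0..t + 1} \<inter> {..<t + 1} - {t}" by auto
qed

lemma increment_continuous:
  fixes p f :: "real \<Rightarrow> real"
  assumes "\<And>a b. 0 \<le> a \<Longrightarrow> a \<le> b \<Longrightarrow> set_integrable lborel {a..b} f \<and> p b - p a = (LINT s:{a..b}|lborel. f s)"
  shows "continuous_on {0..} p"
proof -
  have "continuous_on {0..T} p" if "0 \<le> T" for T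
  proof -
    have c: "continuous_on {0..T} (\<lambda>t. p 0 + integral {0..t} f)"
      using set_borel_integral_eq_integral(1)[of "{0..T}" f] assms[of 0 T] that
      by (intro continuous_intros indefinite_integral_continuous_1) auto
    have e: "p 0 + integral {0..t} f = p t" if "t \<in> {0..T}" for t
    proof -
      have "p t - p 0 = (LINT s:{0..t}|lborel. f s)" "set_integrable lborel {0..t} f" using assms[of 0 t] that by auto
      then show ?thesis using set_borel_integral_eq_integral(2)[of "{0..t}" f] by simp
    qed
    show ?thesis by (rule continuous_on_eq[OF c e])
  qed
  then have "continuous (at t within {0..t + 1}) p" if "0 \<le> t" for t
    using that continuous_on_eq_continuous_within[of "{0..t + 1}" p] by force
  then show ?thesis unfolding continuous_on_eq_continuous_within by (simp add: at_within_Ici_eq_Icc)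
qed

lemma increment_derivative:
  fixes p f :: "real \<Rightarrow> real"
  assumes inc: "\<And>a b. 0 \<le> a \<Longrightarrow> a \<le> b \<Longrightarrow> set_integrable lborel {a..b} f \<and> p b - p a = (LINT s:{a..b}|lborel. f s)"
    and f: "continuous_on {0..} f" and t: "0 \<le> t"
  shows "(p has_real_derivative f t) (at t within {0..})"
proof -
  have "((\<lambda>x. integral {0..x} f) has_real_derivative f t) (at t within {0..t + 1})"
  proof (rule integral_has_real_derivative)
    show "continuous_on {0..t + 1} f" by (rule continuous_on_subset[OF f]) simp
    show "t \<in> {0..t + 1}" using t by simp
  qed
  from DERIV_add[OF DERIV_const[of "p 0"] this]
  have d: "((\<lambda>x. p 0 + integral {0..x} f) has_real_derivative f t) (at t within {0..t + 1})" by simp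
  have e: "p 0 + integral {0..x} f = p x" if "x \<in> {0..t + 1}" for x
  proof -
    have "p x - p 0 = (LINT s:{0..x}|lborel. f s)" "set_integrable lborel {0..x} f" using inc[of 0 x] that by auto
    then show ?thesis using set_borel_integral_eq_integral(2)[of "{0..x}" f] by simp
  qed
  have "(p has_real_derivative f t) (at t within {0..t + 1})"
    by (rule has_field_derivative_transform_within[OF d, of 1]) (use t e in simp_all)
  then show ?thesis using at_within_Ici_eq_Icc[OF t] by simp
qed

section \<open>The amplitude as a solution of the logarithmic equation\<close>

context log_potential begin

text \<open>Up to the factor -e^(2 \<mu> t) this is m'; at t = 0 it is the eigenvalue shift
  \<lambda>_k - k (\<open>amp_tail_zero\<close>, \<open>dn_eigenvalue_eq\<close>).\<close>

definition amp_tail :: "real \<Rightarrow> real \<Rightarrow> real" where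
  "amp_tail \<mu> t = (LBINT s. (if t < s then Q s * amp \<mu> s * decay \<mu> s else 0))"

lemma integrable_Q_amp_exp:
  assumes \<mu>: "R < \<mu>"
  shows "integrable lborel (\<lambda>s. Q s * amp \<mu> s * decay \<mu> s)"
proof (rule integrable_bound_lint[OF integrable_abs[OF integrable_Q_amp[OF \<mu>]]])
  have "norm (Q s * amp \<mu> s * decay \<mu> s) \<le> norm \<bar>Q s * amp \<mu> s\<bar>" for s
    using Q_supp[of s] \<mu> R_pos by (cases "s \<le> 0") (auto simp: abs_mult intro!: mult_left_le)
  then show "AE s in lborel. norm (Q s * amp \<mu> s * decay \<mu> s) \<le> norm \<bar>Q s * amp \<mu> s\<bar>" by simp
qed measurable

lemma amp_tail_zero: "amp_tail \<mu> 0 = (LBINT s. Q s * amp \<mu> s * decay \<mu> s)"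
  unfolding amp_tail_def using Q_supp by (intro lint_cong refl) (auto simp: not_less)

lemma amp_tail_increment:
  assumes \<mu>: "R < \<mu>" and ab: "0 \<le> a" "a \<le> b"
  shows "set_integrable lborel {a..b} (\<lambda>s. - (Q s * amp \<mu> s * decay \<mu> s))"
    and "amp_tail \<mu> b - amp_tail \<mu> a = (LINT s:{a..b}|lborel. - (Q s * amp \<mu> s * decay \<mu> s))"
proof -
  let ?h = "\<lambda>s. Q s * amp \<mu> s * decay \<mu> s"
  note h = integrable_Q_amp_exp[OF \<mu>]
  have [measurable]: "?h \<in> borel_measurable lborel" using h by simp
  show "set_integrable lborel {a..b} (\<lambda>s. - ?h s)"
    unfolding set_integrable_def by (rule integrable_bound_lint[OF h]) (auto simp: indicator_def)
  have i: "integrable lborel (\<lambda>s. if t < s then ?h s else 0)" for t by (rule integrable_bound_lint[OF h]) auto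
  have "amp_tail \<mu> b - amp_tail \<mu> a = (LBINT s. (if b < s then ?h s else 0) - (if a < s then ?h s else 0))"
    unfolding amp_tail_def by (rule Bochner_Integration.integral_diff[symmetric]) (rule i)+
  also have "\<dots> = (LINT s:{a..b}|lborel. - ?h s)" unfolding set_lebesgue_integral_def
  proof (rule integral_cong_AE)
    show "AE s in lborel. (if b < s then ?h s else 0) - (if a < s then ?h s else 0) = indicator {a..b} s *\<^sub>R - ?h s"
      by (rule AE_mp[OF AE_lborel_singleton[of a]], rule AE_I2) (use ab in \<open>auto simp: indicator_def\<close>)
  qed measurable
  finally show "amp_tail \<mu> b - amp_tail \<mu> a = (LINT s:{a..b}|lborel. - ?h s)" .
qed

lemma amp_tail_continuous:
  assumes "R < \<mu>" shows "continuous_on {0..} (amp_tail \<mu>)"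
  by (rule increment_continuous[where f = "\<lambda>s. - (Q s * amp \<mu> s * decay \<mu> s)"]) (use amp_tail_increment[OF assms] in blast)

text \<open>In its first variable z, \<open>green\<close> has derivative e^(2 \<mu> (z - s)) for z <
  s and is constant for z > s; the endpoints truncated at \<open>s\<close> encode the
  latter.\<close>

lemma green_increment:
  assumes \<mu>: "0 < \<mu>" and ab: "0 \<le> a" "a \<le> b" and s: "0 < s"
  shows "green \<mu> b s - green \<mu> a s = (LBINT z. indicator {a..b} z * (if z < s then exp (2 * \<mu> * (z - s)) else 0))"
proof -
  define a' b' where "a' = min a s" and "b' = min b s"
  have le: "a' \<le> b'" using ab by (auto simp: a'_def b'_def)
  have d: "((\<lambda>z. exp (2 * \<mu> * (z - s)) / (2 * \<mu>)) has_real_derivative exp (2 * \<mu> * (z - s))) (at z)" for z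
    using \<mu> by (auto intro!: derivative_eq_intros)
  have c: "isCont (\<lambda>z. exp (2 * \<mu> * (z - s))) z" for z by (intro continuous_intros)
  have "(LBINT z. indicator {a..b} z * (if z < s then exp (2 * \<mu> * (z - s)) else 0))
      = (LBINT z. exp (2 * \<mu> * (z - s)) * indicator {a'..b'} z)"
  proof (rule integral_cong_AE)
    show "AE z in lborel. indicator {a..b} z * (if z < s then exp (2 * \<mu> * (z - s)) else 0) = exp (2 * \<mu> * (z - s)) * indicator {a'..b'} z"
      by (rule AE_mp[OF AE_lborel_singleton[of s]], rule AE_I2) (use ab in \<open>auto simp: indicator_def a'_def b'_def\<close>)
  qed measurable
  also have "\<dots> = exp (2 * \<mu> * (b' - s)) / (2 * \<mu>) - exp (2 * \<mu> * (a' - s)) / (2 * \<mu>)"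
    using has_bochner_integral_FTC_Icc_real[OF le d c] by (simp add: has_bochner_integral_iff)
  also have "2 * \<mu> * (b' - s) = - (2 * \<mu> * max 0 (s - b))" by (auto simp: b'_def algebra_simps max_def min_def)
  also have "2 * \<mu> * (a' - s) = - (2 * \<mu> * max 0 (s - a))" by (auto simp: a'_def algebra_simps max_def min_def)
  finally show ?thesis using green_eq[OF \<mu> _ s, of a] green_eq[OF \<mu> _ s, of b] ab by (simp add: diff_divide_distrib)
qed

text \<open>Integrated form of the formula for m': put \<open>green_increment\<close> into
  \<open>amp_equation\<close> and exchange the integrals.\<close>

lemma amp_increment:
  assumes \<mu>: "R < \<mu>" and ab: "0 \<le> a" "a \<le> b"
  shows "set_integrable lborel {a..b} (\<lambda>z. - (exp (2 * \<mu> * z) * amp_tail \<mu> z))"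
    and "amp \<mu> b - amp \<mu> a = (LINT z:{a..b}|lborel. - (exp (2 * \<mu> * z) * amp_tail \<mu> z))"
proof -
  have \<mu>0: "0 < \<mu>" using \<mu> R_pos by linarith
  show "set_integrable lborel {a..b} (\<lambda>z. - (exp (2 * \<mu> * z) * amp_tail \<mu> z))" by (rule borel_integrable_atLeastAtMost')
      (intro continuous_intros continuous_on_subset[OF amp_tail_continuous[OF \<mu>]], use ab in auto)
  let ?D = "\<lambda>s. Q s * amp \<mu> s"
  let ?G = "\<lambda>s z. indicator {a..b} z * (if z < s then exp (2 * \<mu> * (z - s)) else 0)"
  note D = integrable_Q_amp[OF \<mu>]
  have Gi: "integrable lborel (\<lambda>s. ?D s * green \<mu> t s)" for t
  proof (rule integrable_bound_lint[OF integrable_mult_left[OF integrable_abs[OF D], of "1 / (2 * \<mu>)"]])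
    show "AE s in lborel. norm (?D s * green \<mu> t s) \<le> norm (\<bar>?D s\<bar> * (1 / (2 * \<mu>)))"
    proof (rule AE_I2)
      fix s show "norm (?D s * green \<mu> t s) \<le> norm (\<bar>?D s\<bar> * (1 / (2 * \<mu>)))"
        unfolding norm_mult[of "?D s"] norm_mult[of "\<bar>?D s\<bar>"] using green_bounds[OF \<mu>0, of t s] \<mu>0 by (intro mult_mono) auto
    qed
  qed measurable
  have ind: "integrable lborel (indicator {a..b} :: real \<Rightarrow> real)" by (rule integrable_real_indicator) (use ab in auto)
  have le: "\<bar>?G s z\<bar> \<le> indicator {a..b} z" for s z using \<mu>0 by (auto simp: indicator_def mult_nonneg_nonpos)
  have "amp \<mu> b - amp \<mu> a = - (LBINT s. ?D s * green \<mu> b s - ?D s * green \<mu> a s)"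
    using amp_equation[OF \<mu>, of a] amp_equation[OF \<mu>, of b] Gi by (subst Bochner_Integration.integral_diff) auto
  also have "(LBINT s. ?D s * green \<mu> b s - ?D s * green \<mu> a s) = (LBINT s. ?D s * (LBINT z. ?G s z))"
  proof (rule lint_cong[OF refl])
    fix s show "?D s * green \<mu> b s - ?D s * green \<mu> a s = ?D s * (LBINT z. ?G s z)"
      using green_increment[OF \<mu>0 ab, of s] Q_supp[of s] by (cases "s \<le> 0") (simp_all add: right_diff_distrib[symmetric])
  qed
  also have "\<dots> = (LBINT z. (LBINT s. ?D s * ?G s z))" by (rule Fubini_dominated(1)[OF D ind _ le, symmetric]) measurable
  also have "- \<dots> = (LINT z:{a..b}|lborel. - (exp (2 * \<mu> * z) * amp_tail \<mu> z))" unfolding set_lebesgue_integral_def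
  proof (subst integral_minus[symmetric], intro lint_cong refl)
    fix z
    have "(LBINT s. ?D s * ?G s z)
        = (LBINT s. indicator {a..b} z * exp (2 * \<mu> * z) * (if z < s then ?D s * decay \<mu> s else 0))"
    proof (rule lint_cong[OF refl])
      fix s
      have ee: "exp (2 * \<mu> * (z - s)) = exp (2 * \<mu> * z) * decay \<mu> s" by (simp add: exp_add[symmetric] algebra_simps)
      show "?D s * ?G s z = indicator {a..b} z * exp (2 * \<mu> * z) * (if z < s then ?D s * decay \<mu> s else 0)"
        unfolding ee by simp
    qed
    also have "\<dots> = indicator {a..b} z * exp (2 * \<mu> * z) * amp_tail \<mu> z"
      unfolding amp_tail_def by (rule integral_mult_right_zero)
    finally show "- (LBINT s. ?D s * ?G s z) = indicator {a..b} z *\<^sub>R - (exp (2 * \<mu> * z) * amp_tail \<mu> z)" by simp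
  qed
  finally show "amp \<mu> b - amp \<mu> a = (LINT z:{a..b}|lborel. - (exp (2 * \<mu> * z) * amp_tail \<mu> z))" .
qed

text \<open>The window for t = 0 is empty, which is the Dirichlet condition of the Green function;
  hence the kernel vanishes there.\<close>

lemma amp_zero: "amp \<mu> 0 = 1"
proof -
  have "tkernel 0 z = 0" for z
  proof -
    have "window 0 s y = 0" for s y by (auto simp: window_def)
    then show ?thesis by (subst tkernel_fixpoint) (simp add: kernel_step_def)
  qed
  then show ?thesis by (simp add: amp_def)
qed

text \<open>The second function is e^(-2 \<nu> t) times the derivative of the first. Its
  \<open>amp_tail\<close> term comes from m' and carries e^(k t) because 2 \<mu> - k - 2 \<nu> =
  k.\<close>

lemma amp_log_solution:
  assumes \<mu>: "R < k + \<nu>"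
  defines "\<mu> \<equiv> k + \<nu>"
  shows "log_solution \<nu> (k * (k + 2 * \<nu>)) Q (\<lambda>t. exp (- (k * t)) * amp \<mu> t)
    (\<lambda>t. - (k * exp (- ((k + 2 * \<nu>) * t))) * amp \<mu> t + - exp (k * t) * amp_tail \<mu> t)"
proof -
  have \<mu>R: "R < \<mu>" using \<mu> by (simp add: \<mu>_def)
  note tc = amp_tail_continuous[OF \<mu>R]
  have am: "(amp \<mu> has_real_derivative - (exp (2 * \<mu> * t) * amp_tail \<mu> t)) (at t within {0..})" if "0 \<le> t" for t
    by (rule increment_derivative[OF _ _ that]) (use amp_increment[OF \<mu>R] tc in \<open>auto intro!: continuous_intros\<close>)
  show ?thesis unfolding log_solution_def
  proof (intro conjI allI impI)
    fix t :: real assume "0 \<le> t"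
    have d: "((\<lambda>t. exp (- (k * t)) * amp \<mu> t) has_real_derivative
        exp (- (k * t)) * (- k) * amp \<mu> t + - (exp (2 * \<mu> * t) * amp_tail \<mu> t) * exp (- (k * t))) (at t within {0..})"
      by (rule DERIV_mult[OF _ am[OF \<open>0 \<le> t\<close>]]) (auto intro!: derivative_eq_intros)
    have e: "exp (2 * \<nu> * t) * exp (- ((k + 2 * \<nu>) * t)) = exp (- (k * t))"
      "exp (2 * \<nu> * t) * exp (k * t) = exp (2 * \<mu> * t) * exp (- (k * t))"
      by (simp_all add: exp_add[symmetric] \<mu>_def algebra_simps)
    have "exp (2 * \<nu> * t) * (- (k * exp (- ((k + 2 * \<nu>) * t))) * amp \<mu> t + - exp (k * t) * amp_tail \<mu> t)
        = - k * amp \<mu> t * (exp (2 * \<nu> * t) * exp (- ((k + 2 * \<nu>) * t))) - amp_tail \<mu> t * (exp (2 * \<nu> * t) * exp (k * t))"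
      by (simp add: algebra_simps)
    also have "\<dots> = exp (- (k * t)) * (- k) * amp \<mu> t + - (exp (2 * \<mu> * t) * amp_tail \<mu> t) * exp (- (k * t))"
      unfolding e by simp
    finally show "((\<lambda>t. exp (- (k * t)) * amp \<mu> t) has_real_derivative
        exp (2 * \<nu> * t) * (- (k * exp (- ((k + 2 * \<nu>) * t))) * amp \<mu> t + - exp (k * t) * amp_tail \<mu> t)) (at t within {0..})"
      using d by simp
  next
    fix a b :: real assume ab: "0 \<le> a" "a \<le> b"
    let ?f = "\<lambda>s. exp (- (2 * \<nu> * s)) * ((k * (k + 2 * \<nu>) + Q s) * (exp (- (k * s)) * amp \<mu> s))"
    let ?F1 = "\<lambda>t. - (k * exp (- ((k + 2 * \<nu>) * t)))" and ?f1 = "\<lambda>t. k * (k + 2 * \<nu>) * exp (- ((k + 2 * \<nu>) * t))"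
    let ?F2 = "\<lambda>t. - exp (k * t)" and ?f2 = "\<lambda>t. - (k * exp (k * t))"
    let ?am = "\<lambda>z. - (exp (2 * \<mu> * z) * amp_tail \<mu> z)" and ?ta = "\<lambda>s. - (Q s * amp \<mu> s * decay \<mu> s)"
    have F1: "set_integrable lborel {a..t} ?f1 \<and> ?F1 t - ?F1 a = (LINT s:{a..t}|lborel. ?f1 s)" if "t \<in> {a..b}" for t
    proof -
      have d: "(?F1 has_real_derivative ?f1 x) (at x within {a..t})" for x
        by ((rule derivative_eq_intros refl | simp)+, simp add: algebra_simps)
      have c: "continuous_on {a..t} ?f1" by (intro continuous_intros)
      show ?thesis using C1_increment[OF _ d c] that by simp
    qed
    have F2: "set_integrable lborel {a..t} ?f2 \<and> ?F2 t - ?F2 a = (LINT s:{a..t}|lborel. ?f2 s)" if "t \<in> {a..b}" for t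
    proof -
      have d: "(?F2 has_real_derivative ?f2 x) (at x within {a..t})" for x by (rule derivative_eq_intros refl | simp)+
      have c: "continuous_on {a..t} ?f2" by (intro continuous_intros)
      show ?thesis using C1_increment[OF _ d c] that by simp
    qed
    have bb: "b \<in> {a..b}" using ab by simp
    have am1: "amp \<mu> t - amp \<mu> a = (LINT s:{a..t}|lborel. ?am s)" if "t \<in> {a..b}" for t
      by (rule amp_increment(2)[OF \<mu>R ab(1)]) (use that in simp)
    have ta1: "amp_tail \<mu> t - amp_tail \<mu> a = (LINT s:{a..t}|lborel. ?ta s)" if "t \<in> {a..b}" for t
      by (rule amp_tail_increment(2)[OF \<mu>R ab(1)]) (use that in simp)
    note p1 = product_increment[OF ab(2) conjunct1[OF F1[OF bb]] amp_increment(1)[OF \<mu>R ab] conjunct2[OF F1] am1]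
    note p2 = product_increment[OF ab(2) conjunct1[OF F2[OF bb]] amp_tail_increment(1)[OF \<mu>R ab] conjunct2[OF F2] ta1]
    \<comment> \<open>The two terms with \<open>amp_tail\<close>, one from m' and one from
      differentiating e^(k t), cancel; the terms with K and with \<open>Q\<close> remain.\<close>
    have eq: "(?f1 t * amp \<mu> t + ?F1 t * ?am t) + (?f2 t * amp_tail \<mu> t + ?F2 t * ?ta t) = ?f t" for t
    proof -
      have e: "exp (- ((k + 2 * \<nu>) * t)) = exp (- (2 * \<nu> * t)) * exp (- (k * t))"
        "exp (- ((k + 2 * \<nu>) * t)) * exp (2 * \<mu> * t) = exp (k * t)"
        "exp (k * t) * decay \<mu> t = exp (- (2 * \<nu> * t)) * exp (- (k * t))"
        by (simp_all add: exp_add[symmetric] \<mu>_def algebra_simps)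
      have "(?f1 t * amp \<mu> t + ?F1 t * ?am t) + (?f2 t * amp_tail \<mu> t + ?F2 t * ?ta t)
        = k * (k + 2 * \<nu>) * exp (- ((k + 2 * \<nu>) * t)) * amp \<mu> t
          + k * amp_tail \<mu> t * (exp (- ((k + 2 * \<nu>) * t)) * exp (2 * \<mu> * t)) - k * exp (k * t) * amp_tail \<mu> t
          + Q t * amp \<mu> t * (exp (k * t) * decay \<mu> t)" by (simp add: algebra_simps)
      also have "\<dots> = ?f t" unfolding e(2,3) unfolding e(1) by (simp add: algebra_simps)
      finally show ?thesis .
    qed
    show "set_integrable lborel {a..b} ?f" using set_integral_add(1)[OF p1(1) p2(1)] unfolding eq .
    show "(?F1 b * amp \<mu> b + ?F2 b * amp_tail \<mu> b) - (?F1 a * amp \<mu> a + ?F2 a * amp_tail \<mu> a) = (LINT s:{a..b}|lborel. ?f s)"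
      using set_integral_add(2)[OF p1(1) p2(1)] p1(2) p2(2) unfolding eq by simp
  qed
qed

end

section \<open>Uniqueness of the square integrable solution\<close>

lemma not_integrable_const_Ici:
  fixes c :: real assumes "c \<noteq> 0"
  shows "\<not> integrable lborel (\<lambda>t::real. indicator {1..} t * c)"
proof
  assume "integrable lborel (\<lambda>t::real. indicator {1..} t * c)"
  from integrable_mult_left[OF this, of "1 / c"] assms
  have "integrable lborel (indicator {1..} :: real \<Rightarrow> real)" by simp
  then have fin: "emeasure lborel {1::real..} < \<infinity>" by (simp add: integrable_indicator_iff)
  have le: "ennreal (real n) \<le> emeasure lborel {1::real..}" for n :: nat
    using emeasure_mono[of "{1..1 + real n}" "{1..}" lborel] by simp
  from fin obtain r where r: "emeasure lborel {1::real..} = ennreal r" "0 \<le> r" by (cases "emeasure lborel {1::real..}") auto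
  obtain n :: nat where "r < real n" using reals_Archimedean2 by blast
  then show False using le[of n] r by simp
qed

lemma log_solution_continuous:
  assumes "log_solution \<nu> K Q \<beta> p"
  shows "continuous_on {0..} \<beta>" "continuous_on {0..} p"
proof -
  show "continuous_on {0..} \<beta>" using assms by (intro DERIV_continuous_on) (auto simp: log_solution_def)
  show "continuous_on {0..} p" by (rule increment_continuous[where f = "\<lambda>s. log_rhs \<nu> K Q \<beta> s"])
      (use assms in \<open>auto simp: log_solution_def\<close>)
qed

lemma log_solution_increment:
  assumes "log_solution \<nu> K Q \<beta> p" "0 \<le> a" "a \<le> b"
  shows "set_integrable lborel {a..b} (\<lambda>s. exp (2 * \<nu> * s) * p s)"
    "\<beta> b - \<beta> a = (LINT s:{a..b}|lborel. exp (2 * \<nu> * s) * p s)"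
proof -
  have d: "(\<beta> has_real_derivative exp (2 * \<nu> * x) * p x) (at x within {a..b})" if "x \<in> {a..b}" for x
  proof (rule has_field_derivative_subset)
    show "(\<beta> has_real_derivative exp (2 * \<nu> * x) * p x) (at x within {0..})"
      using assms that by (auto simp: log_solution_def)
  qed (use assms in auto)
  have c: "continuous_on {a..b} (\<lambda>s. exp (2 * \<nu> * s) * p s)"
    by (intro continuous_intros continuous_on_subset[OF log_solution_continuous(2)[OF assms(1)]]) (use assms in auto)
  show "set_integrable lborel {a..b} (\<lambda>s. exp (2 * \<nu> * s) * p s)"
    "\<beta> b - \<beta> a = (LINT s:{a..b}|lborel. exp (2 * \<nu> * s) * p s)" by (rule C1_increment[OF assms(3) d c], assumption)+
qed

text \<open>The product rule for p \<eta> has the integrand e^(-2 \<nu> s) (K + Q) \<beta> \<eta> +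
  e^(2 \<nu> s) p \<rho>, which is symmetric in the two solutions. Working with \<open>p\<close> in
  place of \<beta>' removes the first order term, so the Wronskian is constant and not
  exponential.\<close>

lemma wronskian_constant:
  assumes b: "log_solution \<nu> K Q \<beta> p" and b0: "log_solution \<nu> K Q \<eta> \<rho>" and t: "0 \<le> t"
  shows "p t * \<eta> t - \<rho> t * \<beta> t = p 0 * \<eta> 0 - \<rho> 0 * \<beta> 0"
proof -
  let ?f = "\<lambda>\<beta> s. log_rhs \<nu> K Q \<beta> s"
  have inc: "p t * \<eta> t - p 0 * \<eta> 0 = (LINT s:{0..t}|lborel. ?f \<beta> s * \<eta> s + p s * (exp (2 * \<nu> * s) * \<rho> s))"
    if "log_solution \<nu> K Q \<beta> p" "log_solution \<nu> K Q \<eta> \<rho>" for \<beta> p \<eta> \<rho>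
  proof (rule product_increment(2)[OF t])
    show "set_integrable lborel {0..t} (?f \<beta>)" using that t by (auto simp: log_solution_def)
    show "set_integrable lborel {0..t} (\<lambda>s. exp (2 * \<nu> * s) * \<rho> s)" by (rule log_solution_increment(1)[OF that(2) _ t]) simp
    show "p s - p 0 = (LINT s:{0..s}|lborel. ?f \<beta> s)" if "s \<in> {0..t}" for s
      using \<open>log_solution \<nu> K Q \<beta> p\<close> that by (auto simp: log_solution_def)
    show "\<eta> s - \<eta> 0 = (LINT s:{0..s}|lborel. exp (2 * \<nu> * s) * \<rho> s)" if "s \<in> {0..t}" for s
      by (rule log_solution_increment(2)[OF \<open>log_solution \<nu> K Q \<eta> \<rho>\<close>]) (use that in auto)
  qed
  have "(\<lambda>s. ?f \<beta> s * \<eta> s + p s * (exp (2 * \<nu> * s) * \<rho> s)) = (\<lambda>s. ?f \<eta> s * \<beta> s + \<rho> s * (exp (2 * \<nu> * s) * p s))"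
    by (auto simp: fun_eq_iff)
  then have "p t * \<eta> t - p 0 * \<eta> 0 = \<rho> t * \<beta> t - \<rho> 0 * \<beta> 0" using inc[OF b b0] inc[OF b0 b] by simp
  then show ?thesis by linarith
qed

text \<open>If the Wronskian were a nonzero constant \<open>c\<close>, then \<open>(\<beta> / \<eta>)' = c e\<^sup>2\<^sup>\<nu>\<^sup>t / \<eta>\<^sup>2\<close> would grow like
  \<open>e\<^sup>2\<^sup>\<mu>\<^sup>t\<close>, contradicting square integrability.\<close>

lemma log_solution_unique:
  fixes k \<nu> :: real
  assumes b: "log_solution \<nu> K Q \<beta> p" and b0: "log_solution \<nu> K Q (\<lambda>t. exp (- (k * t)) * m t) \<rho>"
    and init: "\<beta> 0 = 1" "m 0 = 1" and m: "\<And>t. 0 \<le> t \<Longrightarrow> \<bar>m t - 1\<bar> \<le> 1 / 2" and \<mu>: "0 < k + \<nu>"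
    and L2: "weighted_L2 \<nu> \<beta>"
  shows "p 0 = \<rho> 0"
proof (rule ccontr)
  assume ne: "p 0 \<noteq> \<rho> 0"
  define \<mu> where "\<mu> = k + \<nu>"
  define c where "c = p 0 - \<rho> 0"
  define \<eta> where "\<eta> t = exp (- (k * t)) * m t" for t
  have b0': "log_solution \<nu> K Q \<eta> \<rho>" using b0 by (simp add: \<eta>_def[abs_def])
  have sq: "(exp (- (a * t)))\<^sup>2 = exp (- (2 * a * t))" for a t :: real
    using exp_double[of "- (a * t)"] by (simp add: mult.assoc)
  have \<mu>0: "0 < \<mu>" using \<mu> by (simp add: \<mu>_def)
  have c0: "c \<noteq> 0" using ne by (simp add: c_def)
  have init0: "\<eta> 0 = 1" using init by (simp add: \<eta>_def)
  have mb: "1 / 2 \<le> m t" "m t \<le> 3 / 2" if "0 \<le> t" for t using m[OF that] by linarith+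
  have pos: "0 < \<eta> t" if "0 \<le> t" for t using mb[OF that] by (simp add: \<eta>_def)
  have W: "p t * \<eta> t - \<rho> t * \<beta> t = c" if "0 \<le> t" for t
    using wronskian_constant[OF b b0' that] init init0 by (simp add: c_def)
  \<comment> \<open>Difference of the two sides of the intended growth bound. The constant 4/9 is
    (3/2)^(-2): \<eta> <= (3/2) e^(-k t) gives e^(2 \<nu> t) / \<eta>^2 >= (4/9) e^(2 \<mu> t), so
    \<open>Y\<close> increases from 0.\<close>
  define Y where "Y t = (\<beta> t / \<eta> t - 1) / c - (4 / 9) * (exp (2 * \<mu> * t) - 1) / (2 * \<mu>)" for t
  have dY: "(Y has_real_derivative exp (2 * \<nu> * t) / (\<eta> t)\<^sup>2 - (4 / 9) * exp (2 * \<mu> * t)) (at t within {0..})"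
    if t: "0 \<le> t" for t
  proof -
    have d1: "(\<beta> has_real_derivative exp (2 * \<nu> * t) * p t) (at t within {0..})"
      and d2: "(\<eta> has_real_derivative exp (2 * \<nu> * t) * \<rho> t) (at t within {0..})"
      using b b0' t by (auto simp: log_solution_def)
    have d3: "((\<lambda>t. (4 / 9) * (exp (2 * \<mu> * t) - 1) / (2 * \<mu>)) has_real_derivative (4 / 9) * exp (2 * \<mu> * t)) (at t within {0..})"
      using \<mu>0 by (auto intro!: derivative_eq_intros)
    have n: "\<eta> t \<noteq> 0" using pos[OF t] by simp
    have d4: "((\<lambda>t. \<beta> t / \<eta> t) has_real_derivative
        (exp (2 * \<nu> * t) * p t * \<eta> t - \<beta> t * (exp (2 * \<nu> * t) * \<rho> t)) / (\<eta> t * \<eta> t)) (at t within {0..})"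
      by (rule DERIV_divide[OF d1 d2 n])
    have "exp (2 * \<nu> * t) * p t * \<eta> t - \<beta> t * (exp (2 * \<nu> * t) * \<rho> t) = exp (2 * \<nu> * t) * c"
      unfolding W[OF t, symmetric] by (simp add: algebra_simps)
    then have e: "((exp (2 * \<nu> * t) * p t * \<eta> t - \<beta> t * (exp (2 * \<nu> * t) * \<rho> t)) / (\<eta> t * \<eta> t) - 0) / c = exp (2 * \<nu> * t) / (\<eta> t)\<^sup>2"
      using c0 by (simp add: power2_eq_square)
    show ?thesis unfolding Y_def e[symmetric] by (intro DERIV_diff DERIV_cdivide d4 d3 DERIV_const)
  qed
  have Y_nonneg: "0 \<le> Y t" if t: "0 \<le> t" for t
  proof -
    have "Y 0 \<le> Y t"
    proof (rule DERIV_nonneg_imp_increasing_open[OF t])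
      show "continuous_on {0..t} Y" by (rule continuous_on_subset[OF DERIV_continuous_on[OF dY]]) auto
      fix x :: real assume x: "0 < x" "x < t"
      have "(Y has_real_derivative exp (2 * \<nu> * x) / (\<eta> x)\<^sup>2 - (4 / 9) * exp (2 * \<mu> * x)) (at x)"
        using dY[of x] x by (simp add: at_within_interior[of x "{0..}"])
      moreover have "0 \<le> exp (2 * \<nu> * x) / (\<eta> x)\<^sup>2 - (4 / 9) * exp (2 * \<mu> * x)"
      proof -
        have "(\<eta> x)\<^sup>2 \<le> (exp (- (k * x)) * (3 / 2))\<^sup>2" using mb[of x] x by (intro power_mono) (auto simp: \<eta>_def)
        also have "\<dots> = 9 / 4 * exp (- (2 * k * x))" by (simp add: power_mult_distrib sq power_divide)
        finally have "(4 / 9) * exp (2 * \<mu> * x) * (\<eta> x)\<^sup>2 \<le> (4 / 9) * exp (2 * \<mu> * x) * (9 / 4 * exp (- (2 * k * x)))"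
          by (intro mult_left_mono) auto
        also have "\<dots> = exp (2 * \<nu> * x)" by (simp add: exp_add[symmetric] \<mu>_def algebra_simps)
        finally show ?thesis using pos[of x] x by (simp add: le_divide_eq)
      qed
      ultimately show "\<exists>y. (Y has_real_derivative y) (at x) \<and> 0 \<le> y" by blast
    qed
    then show ?thesis using init init0 by (simp add: Y_def)
  qed
  \<comment> \<open>The lower bound obtained below at t = 1 with m replaced by 1/2; it persists for
    t >= 1 because sinh increases.\<close>
  define \<epsilon> where "\<epsilon> = \<bar>c\<bar> / (9 * \<mu>) * (exp \<mu> - exp (- \<mu>))"
  have \<epsilon>: "0 < \<epsilon>" using c0 \<mu>0 by (simp add: \<epsilon>_def)
  have lower: "\<epsilon> \<le> exp (- (\<nu> * t)) * \<bar>\<beta> t - \<eta> t\<bar>" if t: "1 \<le> t" for t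
  proof -
    have "(4 / 9) * (exp (2 * \<mu> * t) - 1) / (2 * \<mu>) \<le> (\<beta> t / \<eta> t - 1) / c" using Y_nonneg[of t] t by (simp add: Y_def)
    also have "\<dots> \<le> \<bar>\<beta> t - \<eta> t\<bar> / (\<eta> t * \<bar>c\<bar>)"
    proof -
      have "(\<beta> t / \<eta> t - 1) / c = (\<beta> t - \<eta> t) / (\<eta> t * c)" using pos[of t] t by (simp add: diff_divide_distrib)
      also have "\<dots> \<le> \<bar>(\<beta> t - \<eta> t) / (\<eta> t * c)\<bar>" by (rule abs_ge_self)
      also have "\<dots> = \<bar>\<beta> t - \<eta> t\<bar> / (\<eta> t * \<bar>c\<bar>)" using pos[of t] t by (simp add: abs_divide abs_mult)
      finally show ?thesis .
    qed
    finally have "(4 / 9) * (exp (2 * \<mu> * t) - 1) / (2 * \<mu>) * (\<eta> t * \<bar>c\<bar>) \<le> \<bar>\<beta> t - \<eta> t\<bar>"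
      using pos[of t] t c0 by (subst (asm) pos_le_divide_eq) auto
    then have "exp (- (\<nu> * t)) * ((4 / 9) * (exp (2 * \<mu> * t) - 1) / (2 * \<mu>) * (\<eta> t * \<bar>c\<bar>)) \<le> exp (- (\<nu> * t)) * \<bar>\<beta> t - \<eta> t\<bar>"
      by (rule mult_left_mono) simp
    moreover have "\<epsilon> \<le> exp (- (\<nu> * t)) * ((4 / 9) * (exp (2 * \<mu> * t) - 1) / (2 * \<mu>) * (\<eta> t * \<bar>c\<bar>))"
    proof -
      have ex: "exp (- (\<nu> * t)) * (exp (2 * \<mu> * t) - 1) * exp (- (k * t)) = exp (\<mu> * t) - exp (- (\<mu> * t))"
        by (simp add: algebra_simps \<mu>_def exp_add[symmetric])
      have e: "exp (- (\<nu> * t)) * ((4 / 9) * (exp (2 * \<mu> * t) - 1) / (2 * \<mu>) * (\<eta> t * \<bar>c\<bar>))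
         = (2 * \<bar>c\<bar> / (9 * \<mu>)) * m t * (exp (\<mu> * t) - exp (- (\<mu> * t)))"
        unfolding ex[symmetric] using \<mu>0 by (simp add: \<eta>_def field_simps)
      have "exp \<mu> - exp (- \<mu>) \<le> exp (\<mu> * t) - exp (- (\<mu> * t))"
        using \<mu>0 t by (intro diff_mono) (auto simp: mult_le_cancel_left1)
      moreover have "0 \<le> exp \<mu> - exp (- \<mu>)" using \<mu>0 by simp
      ultimately have "(2 * \<bar>c\<bar> / (9 * \<mu>)) * (1 / 2) * (exp \<mu> - exp (- \<mu>)) \<le> (2 * \<bar>c\<bar> / (9 * \<mu>)) * m t * (exp (\<mu> * t) - exp (- (\<mu> * t)))"
        using mb[of t] t \<mu>0 by (intro mult_mono mult_left_mono) auto
      then show ?thesis unfolding e by (simp add: \<epsilon>_def)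
    qed
    ultimately show ?thesis by linarith
  qed
  \<comment> \<open>Both \<beta> and \<eta> are square integrable with the weight e^(-2 \<nu> t), so
    (\<beta> - \<eta>)^2 <= 2 \<beta>^2 + 2 \<eta>^2 gives an integrable majorant of the constant
    \<epsilon>^2 on a half line. The factor 9/4 bounds m^2.\<close>
  have "integrable lborel (\<lambda>t::real. indicator {1..} t * \<epsilon>\<^sup>2)"
  proof (rule integrable_bound_lint)
    show "integrable lborel (\<lambda>t. 2 * (indicator {0..} t * ((\<beta> t)\<^sup>2 * exp (- (2 * \<nu> * t)))) + 2 * (9 / 4) * (if 0 < t then decay \<mu> t else 0))"
      using L2 has_bochner_integral_exp_tail[of "2 * \<mu>" 0] \<mu>0
      by (intro Bochner_Integration.integrable_add integrable_mult_right) (auto simp: has_bochner_integral_iff)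
    show "AE t in lborel. norm (indicator {1..} t * \<epsilon>\<^sup>2) \<le> norm (2 * (indicator {0..} t * ((\<beta> t)\<^sup>2 * exp (- (2 * \<nu> * t)))) + 2 * (9 / 4) * (if 0 < t then decay \<mu> t else 0))"
    proof (rule AE_I2)
      fix t :: real
      show "norm (indicator {1..} t * \<epsilon>\<^sup>2) \<le> norm (2 * (indicator {0..} t * ((\<beta> t)\<^sup>2 * exp (- (2 * \<nu> * t)))) + 2 * (9 / 4) * (if 0 < t then decay \<mu> t else 0))"
      proof (cases "1 \<le> t")
        case True
        have e2: "decay \<mu> t = exp (- (2 * \<nu> * t)) * exp (- (2 * k * t))"
          by (simp add: \<mu>_def exp_add[symmetric] algebra_simps)
        have "\<epsilon>\<^sup>2 \<le> (exp (- (\<nu> * t)) * \<bar>\<beta> t - \<eta> t\<bar>)\<^sup>2" using lower[OF True] \<epsilon> by (intro power_mono) auto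
        also have "\<dots> = exp (- (2 * \<nu> * t)) * (\<beta> t - \<eta> t)\<^sup>2" by (simp add: power_mult_distrib sq)
        also have "(\<beta> t - \<eta> t)\<^sup>2 \<le> 2 * (\<beta> t)\<^sup>2 + 2 * (\<eta> t)\<^sup>2"
          using zero_le_power2[of "\<beta> t + \<eta> t"] by (simp add: power2_eq_square algebra_simps)
        also have "exp (- (2 * \<nu> * t)) * (2 * (\<beta> t)\<^sup>2 + 2 * (\<eta> t)\<^sup>2) = 2 * ((\<beta> t)\<^sup>2 * exp (- (2 * \<nu> * t))) + 2 * (m t)\<^sup>2 * decay \<mu> t"
          unfolding e2 by (simp add: \<eta>_def power_mult_distrib sq algebra_simps)
        also have "(m t)\<^sup>2 \<le> (3 / 2)\<^sup>2" using mb[of t] True by (intro power_mono) auto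
        finally show ?thesis using True \<epsilon> by (simp add: power2_eq_square)
      qed simp
    qed
  qed measurable
  then show False using not_integrable_const_Ici[of "\<epsilon>\<^sup>2"] \<epsilon> by simp
qed

section \<open>Uniqueness of moments\<close>

lemma integral_poly_exp_zero:
  fixes f :: "real \<Rightarrow> real"
  assumes f: "integrable lborel f" and f0: "\<And>s. s \<le> 0 \<Longrightarrow> f s = 0"
    and mom: "\<And>n::nat. (LBINT s. f s * exp (- (2 * s)) ^ n) = 0"
    and p: "real_polynomial_function p"
  shows "(LBINT s. f s * p (exp (- (2 * s)))) = 0"
proof -
  obtain a n where p: "p = (\<lambda>x. \<Sum>i\<le>n. a i * x ^ i)" using p unfolding real_polynomial_function_iff_sum by blast
  have int: "integrable lborel (\<lambda>s. a i * (f s * exp (- (2 * s)) ^ i))" for i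
  proof (intro integrable_mult_right integrable_dominated[OF f])
    show "(\<lambda>s. f s * exp (- (2 * s)) ^ i) \<in> borel_measurable lborel" using f by measurable
    show "norm (f s * exp (- (2 * s)) ^ i) \<le> norm (f s)" for s
      by (cases "s \<le> 0") (auto simp: f0 abs_mult intro!: mult_left_le power_le_one)
  qed
  have "(LBINT s. f s * p (exp (- (2 * s)))) = (LBINT s. (\<Sum>i\<le>n. a i * (f s * exp (- (2 * s)) ^ i)))"
    by (simp add: p sum_distrib_left mult_ac)
  also have "\<dots> = (\<Sum>i\<le>n. a i * (LBINT s. f s * exp (- (2 * s)) ^ i))"
    using int by (subst Bochner_Integration.integral_sum) simp_all
  finally show ?thesis by (simp add: mom)
qed

text \<open>Under x = e^(-2 s) the half line s > 0 goes into (0,1), where Weierstrass approximates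
  \<open>\<phi>\<close> uniformly by polynomials; the error is controlled by the L^1 norm of
  \<open>f\<close>.\<close>

lemma integral_continuous_exp_zero:
  fixes f :: "real \<Rightarrow> real"
  assumes f: "integrable lborel f" and f0: "\<And>s. s \<le> 0 \<Longrightarrow> f s = 0"
    and mom: "\<And>n::nat. (LBINT s. f s * exp (- (2 * s)) ^ n) = 0"
    and c: "continuous_on UNIV \<phi>"
  shows "(LBINT s. f s * \<phi> (exp (- (2 * s)))) = 0"
proof -
  let ?I = "LBINT s. f s * \<phi> (exp (- (2 * s)))"
  have [measurable]: "\<phi> \<in> borel_measurable borel" "f \<in> borel_measurable borel"
    using c f by (auto intro: borel_measurable_continuous_onI)
  have "\<bar>?I\<bar> \<le> e * (LBINT s. \<bar>f s\<bar>)" if e: "0 < e" for e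
  proof -
    have c01: "continuous_on {0..1} \<phi>" by (rule continuous_on_subset[OF c]) simp
    obtain p where p: "real_polynomial_function p" "\<And>x. x \<in> {0..1} \<Longrightarrow> \<bar>\<phi> x - p x\<bar> < e"
      using Stone_Weierstrass_real_polynomial_function[OF compact_Icc c01 e] by blast
    have pc: "continuous_on UNIV p"
      using continuous_real_polymonial_function[OF p(1)] by (simp add: continuous_at_imp_continuous_on)
    then have [measurable]: "p \<in> borel_measurable borel" by (rule borel_measurable_continuous_onI)
    have le: "\<bar>f s * (\<phi> (exp (- (2 * s))) - p (exp (- (2 * s))))\<bar> \<le> e * \<bar>f s\<bar>" for s
    proof (cases "s \<le> 0")
      case False
      then show ?thesis using p(2)[of "exp (- (2 * s))"] by (auto simp: abs_mult mult.commute[of e] intro!: mult_left_mono)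
    qed (simp add: f0)
    have d: "integrable lborel (\<lambda>s. f s * (\<phi> (exp (- (2 * s))) - p (exp (- (2 * s)))))"
      by (rule integrable_bound_lint[OF integrable_mult_right[OF integrable_abs[OF f], of e]])
        (use le e in \<open>auto simp: abs_mult\<close>)
    have "continuous_on {0..1} p" by (rule continuous_on_subset[OF pc]) simp
    from compact_imp_bounded[OF compact_continuous_image[OF this compact_Icc]]
    obtain B where "\<forall>x\<in>{0..1}. \<bar>p x\<bar> \<le> B" unfolding bounded_iff by auto
    then have B: "\<bar>p x\<bar> \<le> B" if "x \<in> {0..1}" for x using that by blast
    have "0 \<le> B" using B[of 0] by auto
    have pi: "integrable lborel (\<lambda>s. f s * p (exp (- (2 * s))))"
    proof (rule integrable_dominated[OF integrable_mult_left[OF integrable_abs[OF f], of B]])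
      show "norm (f s * p (exp (- (2 * s)))) \<le> norm (\<bar>f s\<bar> * B)" for s
        using B[of "exp (- (2 * s))"] \<open>0 \<le> B\<close> by (cases "s \<le> 0") (auto simp: f0 abs_mult intro!: mult_left_mono)
    qed measurable
    have "?I = (LBINT s. f s * (\<phi> (exp (- (2 * s))) - p (exp (- (2 * s)))) + f s * p (exp (- (2 * s))))"
      by (simp add: algebra_simps)
    also have "\<dots> = (LBINT s. f s * (\<phi> (exp (- (2 * s))) - p (exp (- (2 * s)))))"
      using integral_poly_exp_zero[OF f f0 mom p(1)] by (subst Bochner_Integration.integral_add[OF d pi]) auto
    also have "\<bar>\<dots>\<bar> \<le> (LBINT s. e * \<bar>f s\<bar>)"
      using d f le by (intro order_trans[OF integral_abs_bound] integral_mono integrable_abs integrable_mult_right) auto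
    finally show ?thesis by simp
  qed
  then have bnd: "\<bar>?I\<bar> \<le> e * (LBINT s. \<bar>f s\<bar>)" if "0 < e" for e using that by blast
  have lim: "((\<lambda>e. e * (LBINT s. \<bar>f s\<bar>)) \<longlongrightarrow> 0 * (LBINT s. \<bar>f s\<bar>)) (at_right 0)" by (intro tendsto_intros)
  have "\<bar>?I\<bar> \<le> 0 * (LBINT s. \<bar>f s\<bar>)"
    by (rule tendsto_lowerbound[OF lim]) (auto simp: eventually_at_filter intro!: always_eventually bnd)
  then show ?thesis by simp
qed

text \<open>Hausdorff moment uniqueness in the variable x = e^(-2 s). Continuous test functions are
  upgraded to indicators of half lines, and these determine the measures whose densities are the
  positive and the negative part of \<open>f\<close>.\<close>

lemma moments_zero_imp_AE_zero:
  fixes f :: "real \<Rightarrow> real"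
  assumes f: "integrable lborel f" and f0: "\<And>s. s \<le> 0 \<Longrightarrow> f s = 0"
    and mom: "\<And>n::nat. (LBINT s. f s * exp (- (2 * s)) ^ n) = 0"
  shows "AE s in lborel. f s = 0"
proof -
  have [measurable]: "f \<in> borel_measurable borel" using f by auto
  have tail: "(LBINT s. f s * indicator {a<..} s) = 0" for a
  proof -
    \<comment> \<open>Steepening ramps in x with values in [0,1]; they converge pointwise to the
      indicator of x < e^(-2 a), that is, of s > a.\<close>
    define \<phi> where "\<phi> n x = max 0 (min 1 (real n * (exp (- (2 * a)) - x)))" for n :: nat and x :: real
    have [measurable]: "\<phi> n \<in> borel_measurable borel" for n unfolding \<phi>_def by measurable
    have "(\<lambda>n. LBINT s. f s * \<phi> n (exp (- (2 * s)))) \<longlonglongrightarrow> (LBINT s. f s * indicator {a<..} s)"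
    proof (rule integral_dominated_convergence[where w = "\<lambda>s. \<bar>f s\<bar>"])
      show "AE s in lborel. (\<lambda>n. f s * \<phi> n (exp (- (2 * s)))) \<longlonglongrightarrow> f s * indicator {a<..} s"
      proof (intro AE_I2 tendsto_mult tendsto_const)
        fix s :: real
        show "(\<lambda>n. \<phi> n (exp (- (2 * s)))) \<longlonglongrightarrow> indicator {a<..} s"
        proof (cases "a < s")
          case True
          define h where "h = exp (- (2 * a)) - exp (- (2 * s))"
          have h: "0 < h" using True by (simp add: h_def)
          obtain n0 :: nat where n0: "1 / h < real n0" using reals_Archimedean2 by blast
          have "\<phi> n (exp (- (2 * s))) = 1" if "n \<ge> n0" for n
          proof -
            have "1 / h < real n" using n0 that by simp
            then have "1 < real n * h" using h by (simp add: divide_less_eq)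
            then show ?thesis by (simp add: \<phi>_def h_def[symmetric])
          qed
          then show ?thesis using True by (intro tendsto_eventually) (auto simp: eventually_sequentially)
        next
          case False
          then have "real n * (exp (- (2 * a)) - exp (- (2 * s))) \<le> 0" for n by (intro mult_nonneg_nonpos) auto
          then have "\<phi> n (exp (- (2 * s))) = 0" for n unfolding \<phi>_def using min.coboundedI2 by (intro max_absorb1) blast
          then show ?thesis using False by simp
        qed
      qed
      show "AE s in lborel. norm (f s * \<phi> n (exp (- (2 * s)))) \<le> \<bar>f s\<bar>" for n
        by (intro AE_I2) (auto simp: abs_mult \<phi>_def intro!: mult_left_le)
    qed (use f in auto)
    moreover have "(LBINT s. f s * \<phi> n (exp (- (2 * s)))) = 0" for n
      by (rule integral_continuous_exp_zero[OF f f0 mom]) (auto simp: \<phi>_def intro!: continuous_intros)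
    ultimately show ?thesis by (simp add: LIMSEQ_const_iff)
  qed
  define P N where "P s = max 0 (f s)" and "N s = max 0 (- f s)" for s
  have PN: "integrable lborel P" "integrable lborel N" using f by (auto simp: P_def[abs_def] N_def[abs_def])
  have [measurable]: "P \<in> borel_measurable borel" "N \<in> borel_measurable borel" using PN by auto
  have i: "integrable lborel (\<lambda>s. g s * indicator {a<..} s)" if "integrable lborel g" for g :: "real \<Rightarrow> real" and a :: real
    by (rule integrable_real_mult_indicator[OF _ that]) simp
  have em: "emeasure (density lborel (\<lambda>s. ennreal (g s))) {a<..} = ennreal (LBINT s. g s * indicator {a<..} s)"
    if g: "integrable lborel g" "\<And>s. 0 \<le> g s" for g :: "real \<Rightarrow> real" and a
  proof -
    have [measurable]: "g \<in> borel_measurable borel" using g by auto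
    have "emeasure (density lborel (\<lambda>s. ennreal (g s))) {a<..} = (\<integral>\<^sup>+s. ennreal (g s * indicator {a<..} s) \<partial>lborel)"
      by (subst emeasure_density) (auto intro!: nn_integral_cong simp: indicator_def)
    also have "\<dots> = ennreal (LBINT s. g s * indicator {a<..} s)"
      by (rule nn_integral_eq_integral[OF i[OF g(1)]]) (use g in auto)
    finally show ?thesis .
  qed
  have eqi: "(LBINT s. P s * indicator {a<..} s) = (LBINT s. N s * indicator {a<..} s)" for a
  proof -
    have "(LBINT s. P s * indicator {a<..} s) - (LBINT s. N s * indicator {a<..} s) = (LBINT s. f s * indicator {a<..} s)"
      by (subst Bochner_Integration.integral_diff[symmetric, OF i[OF PN(1)] i[OF PN(2)]])
        (auto intro!: lint_cong simp: P_def N_def algebra_simps max_def)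
    then show ?thesis using tail[of a] by simp
  qed
  have "density lborel (\<lambda>s. ennreal (P s)) = density lborel (\<lambda>s. ennreal (N s))"
    by (rule measure_eqI_lessThan) (use em[OF PN(1)] em[OF PN(2)] eqi in \<open>auto simp: P_def N_def\<close>)
  then have "AE s in lborel. ennreal (P s) = ennreal (N s)"
    by (intro sigma_finite_measure.density_unique[OF lborel.sigma_finite_measure_axioms]) auto
  then show ?thesis by eventually_elim (auto simp: P_def N_def max_def split: if_splits)
qed

section \<open>Spherical harmonics\<close>

lemma real_polynomial_Re_Im_power:
  fixes i j :: "'a::euclidean_space"
  shows "real_polynomial_function (\<lambda>x. Re (Complex (x \<bullet> i) (x \<bullet> j) ^ k))"
    "real_polynomial_function (\<lambda>x. Im (Complex (x \<bullet> i) (x \<bullet> j) ^ k))"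
proof (induction k)
  case 0
  { case 1 show ?case by (simp add: real_polynomial_function.intros(2)) }
  { case 2 show ?case by (simp add: real_polynomial_function.intros(2)) }
next
  case (Suc k)
  have l: "real_polynomial_function (\<lambda>x::'a. x \<bullet> i)" for i
    by (intro real_polynomial_function.intros(1) bounded_linear_inner_left)
  { case 1 show ?case unfolding power_Suc times_complex.simps complex.sel
      by (intro real_polynomial_function_diff real_polynomial_function.intros(4) Suc l) }
  { case 2 show ?case unfolding power_Suc times_complex.simps complex.sel
      by (intro real_polynomial_function.intros(3,4) Suc l) }
qed

lemma deriv_Re_power:
  fixes z c \<zeta> :: complex
  shows "deriv (\<lambda>t. Re (\<zeta> * (z + of_real t * c) ^ k)) = (\<lambda>t. Re (\<zeta> * of_nat k * c * (z + of_real t * c) ^ (k - 1)))"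
proof
  fix t :: real
  have "((\<lambda>w. \<zeta> * (z + w * c) ^ k) has_field_derivative \<zeta> * of_nat k * c * (z + of_real t * c) ^ (k - 1)) (at (of_real t))"
    by (auto intro!: derivative_eq_intros)
  from bounded_linear.has_vector_derivative[OF bounded_linear_Re has_vector_derivative_real_field[OF this]]
  show "deriv (\<lambda>t. Re (\<zeta> * (z + of_real t * c) ^ k)) t = Re (\<zeta> * of_nat k * c * (z + of_real t * c) ^ (k - 1))"
    by (intro DERIV_imp_deriv) (simp add: has_real_derivative_iff_has_vector_derivative)
qed

text \<open>Each second derivative of a power of x_i + \<i> x_j carries the square of a coefficient
  of this linear form, and these squares sum to 1 + \<i>^2 = 0. The factor \<open>\<zeta>\<close>
  covers real and imaginary parts at once, by the values 1 and -\<i>.\<close>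

lemma spherical_harmonic_power:
  fixes i j :: "'a::euclidean_space"
  assumes ij: "i \<in> Basis" "j \<in> Basis" "i \<noteq> j"
  shows "spherical_harmonic k (\<lambda>x. Re (\<zeta> * Complex (x \<bullet> i) (x \<bullet> j) ^ k))" unfolding spherical_harmonic_def
proof (intro exI conjI ballI allI refl)
  let ?z = "\<lambda>x. Complex (x \<bullet> i) (x \<bullet> j)"
  have "real_polynomial_function (\<lambda>x. Re \<zeta> * Re (?z x ^ k) - Im \<zeta> * Im (?z x ^ k))"
    by (intro real_polynomial_function_diff real_polynomial_function.intros(4) real_polynomial_function.intros(2) real_polynomial_Re_Im_power)
  then show "real_polynomial_function (\<lambda>x. Re (\<zeta> * ?z x ^ k))" by simp
next
  fix t :: real and x :: 'a
  have "Complex (t *\<^sub>R x \<bullet> i) (t *\<^sub>R x \<bullet> j) = of_real t * Complex (x \<bullet> i) (x \<bullet> j)" by (simp add: complex_eq_iff)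
  then show "Re (\<zeta> * Complex (t *\<^sub>R x \<bullet> i) (t *\<^sub>R x \<bullet> j) ^ k) = t ^ k * Re (\<zeta> * Complex (x \<bullet> i) (x \<bullet> j) ^ k)"
    by (simp add: power_mult_distrib of_real_power[symmetric] algebra_simps del: of_real_power)
next
  fix x :: 'a
  define z where "z = Complex (x \<bullet> i) (x \<bullet> j)"
  define c where "c e = Complex (e \<bullet> i) (e \<bullet> j)" for e :: 'a
  have line: "Complex ((x + t *\<^sub>R e) \<bullet> i) ((x + t *\<^sub>R e) \<bullet> j) = z + of_real t * c e" for t e
    by (simp add: complex_eq_iff z_def c_def inner_add_left)
  have "(deriv ^^ 2) (\<lambda>t. Re (\<zeta> * Complex ((x + t *\<^sub>R e) \<bullet> i) ((x + t *\<^sub>R e) \<bullet> j) ^ k)) 0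
      = Re (\<zeta> * of_nat k * of_nat (k - 1) * z ^ (k - 2) * (c e)\<^sup>2)" for e
    unfolding line numeral_2_eq_2 funpow.simps o_def id_def deriv_Re_power
    by (simp add: power2_eq_square mult_ac numeral_2_eq_2)
  then have "laplacian (\<lambda>x. Re (\<zeta> * Complex (x \<bullet> i) (x \<bullet> j) ^ k)) x
      = Re (\<zeta> * of_nat k * of_nat (k - 1) * z ^ (k - 2) * (\<Sum>e\<in>Basis. (c e)\<^sup>2))" by (simp add: laplacian_def sum_distrib_left)
  also have "(\<Sum>e\<in>Basis. (c e)\<^sup>2) = (\<Sum>e\<in>{i, j}. (c e)\<^sup>2)"
    by (rule sum.mono_neutral_right) (use ij in \<open>auto simp: c_def inner_Basis complex_eq_iff\<close>)
  also have "\<dots> = 0" using ij by (simp add: c_def inner_Basis complex_eq_iff power2_eq_square)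
  finally show "laplacian (\<lambda>x. Re (\<zeta> * Complex (x \<bullet> i) (x \<bullet> j) ^ k)) x = 0" by simp
qed (rule refl)

text \<open>Some coordinate of a unit vector is at least \<open>1 / d\<close> in absolute value, so the harmonics
  \<open>Re (x\<^sub>i + \<i> x\<^sub>j)\<^sup>k\<close> and \<open>Im (x\<^sub>i + \<i> x\<^sub>j)\<^sup>k\<close> cannot all be small at the same point.\<close>

lemma spherical_harmonics_lower_bound:
  assumes "DIM('a::euclidean_space) \<ge> 2"
  obtains F :: "('a::euclidean_space \<Rightarrow> real) set" where "finite F" "\<And>Y. Y \<in> F \<Longrightarrow> spherical_harmonic k Y"
    "\<And>x. norm x = 1 \<Longrightarrow> (1 / real DIM('a)) ^ (2 * k) \<le> (\<Sum>Y\<in>F. (Y x)\<^sup>2)"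
proof -
  define Y where "Y \<zeta> i j x = Re (\<zeta> * Complex (x \<bullet> i) (x \<bullet> j) ^ k)" for \<zeta> and i j x :: 'a
  define F where "F = (\<lambda>(\<zeta>, i, j). Y \<zeta> i j) ` ({1, - \<i>} \<times> {(i, j). i \<in> Basis \<and> j \<in> Basis \<and> i \<noteq> j})"
  have fin: "finite F"
    unfolding F_def by (intro finite_imageI finite_cartesian_product finite_subset[of "{(i, j). i \<in> Basis \<and> j \<in> Basis \<and> i \<noteq> j}" "Basis \<times> Basis"]) auto
  have mem: "Y 1 i j \<in> F" "Y (- \<i>) i j \<in> F" if "i \<in> Basis" "j \<in> Basis" "i \<noteq> j" for i j using that unfolding F_def by force+
  have lower: "(1 / real DIM('a)) ^ (2 * k) \<le> (\<Sum>Y\<in>F. (Y x)\<^sup>2)" if x: "norm x = 1" for x :: 'a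
  proof -
    have "\<exists>i\<in>Basis. 1 / real DIM('a) \<le> \<bar>x \<bullet> i\<bar>"
    proof (rule ccontr)
      assume "\<not> ?thesis"
      then have "(\<Sum>i\<in>Basis. \<bar>x \<bullet> i\<bar>) < (\<Sum>i\<in>(Basis::'a set). 1 / real DIM('a))" by (intro sum_strict_mono) (auto simp: not_le)
      then show False using norm_le_l1[of x] x by simp
    qed
    then obtain i where i: "i \<in> Basis" "1 / real DIM('a) \<le> \<bar>x \<bullet> i\<bar>" by blast
    obtain j where j: "j \<in> Basis" "i \<noteq> j"
    proof -
      have "\<not> Basis \<subseteq> {i}" using assms card_mono[of "{i}" "Basis :: 'a set"] by auto
      then show ?thesis using that by blast
    qed
    let ?z = "Complex (x \<bullet> i) (x \<bullet> j)"
    have cm: "(1 / real DIM('a)) ^ (2 * k) \<le> (cmod (?z ^ k))\<^sup>2"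
    proof -
      have "1 / real DIM('a) \<le> cmod ?z" using i(2) abs_Re_le_cmod[of ?z] by simp
      then have "(1 / real DIM('a)) ^ (2 * k) \<le> cmod ?z ^ (2 * k)" by (intro power_mono) auto
      then show ?thesis by (simp add: norm_power power_mult[symmetric] mult.commute)
    qed
    have y: "(Y 1 i j x)\<^sup>2 + (Y (- \<i>) i j x)\<^sup>2 = (cmod (?z ^ k))\<^sup>2" by (simp add: Y_def cmod_power2)
    show ?thesis
    \<comment> \<open>\<open>F\<close> is a set, so the two harmonics are counted separately only if
      they differ; at the point \<open>i\<close> their values are 1 and 0.\<close>
    proof (cases "Y 1 i j = Y (- \<i>) i j")
      case False
      have "(\<Sum>Y\<in>{Y 1 i j, Y (- \<i>) i j}. (Y x)\<^sup>2) \<le> (\<Sum>Y\<in>F. (Y x)\<^sup>2)" by (rule sum_mono2[OF fin]) (use mem[OF i(1) j] in auto)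
      then show ?thesis using False cm y by simp
    next
      case True
      have e: "Y 1 i j w = Y (- \<i>) i j w" for w using True by simp
      from e[of i] have "Re (Complex 1 0 ^ k) = Im (Complex 1 0 ^ k)" using i(1) j by (simp add: Y_def inner_Basis)
      then show ?thesis by (simp add: one_complex.code[symmetric] flip: Complex_eq_1)
    qed
  qed
  show ?thesis
  proof (rule that[OF fin _ lower])
    show "spherical_harmonic k f" if "f \<in> F" for f
      using that spherical_harmonic_power[of _ _ k] unfolding F_def Y_def[abs_def] by auto
  qed
qed

section \<open>Radial functions in logarithmic variables\<close>

definition log_radius :: "'a::euclidean_space \<Rightarrow> real" where
  "log_radius x = - ln (norm x)"

text \<open>The factor \<open>exp (- 2 t)\<close> turns the radial equation in the variable \<open>t = - ln r\<close> into
  a Schroedinger equation on the half line with potential \<open>log_density v\<close>.\<close>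

definition log_density :: "(real \<Rightarrow> real) \<Rightarrow> real \<Rightarrow> real" where
  "log_density v t = (if 0 < t then exp (- (2 * t)) * v t else 0)"

lemma log_density_measurable [measurable (raw)]:
  assumes [measurable]: "v \<in> borel_measurable borel"
  shows "log_density v \<in> borel_measurable borel" unfolding log_density_def by measurable

lemma log_density_zero: "t \<le> 0 \<Longrightarrow> log_density v t = 0" by (simp add: log_density_def)

lemma log_radius_measurable [measurable]: "log_radius \<in> borel_measurable borel" unfolding log_radius_def by measurable

lemma log_radius_pos: "x \<in> ball 0 1 \<Longrightarrow> x \<noteq> 0 \<Longrightarrow> 0 < log_radius x" by (simp add: log_radius_def)

lemma exp_log_radius: "x \<noteq> 0 \<Longrightarrow> exp (- log_radius x) = norm x" by (simp add: log_radius_def)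

lemma sphere_measure_sphere:
  "sphere_measure (sphere 0 1 :: 'a::euclidean_space set) = real DIM('a) * measure lborel (ball (0::'a) 1)"
proof -
  have "{t *\<^sub>R x | t x. 0 < t \<and> t < 1 \<and> x \<in> sphere 0 1 \<inter> sphere 0 1} = ball 0 1 - {0 :: 'a}" (is "?L = ?R")
  proof
    show "?L \<subseteq> ?R" by auto
    show "?R \<subseteq> ?L"
    proof
      fix y :: 'a assume "y \<in> ?R"
      then have "y = norm y *\<^sub>R (y /\<^sub>R norm y) \<and> 0 < norm y \<and> norm y < 1 \<and> y /\<^sub>R norm y \<in> sphere 0 1 \<inter> sphere 0 1" by auto
      then show "y \<in> ?L" by blast
    qed
  qed
  moreover have "measure lebesgue (ball 0 1 - {0 :: 'a}) = measure lebesgue (ball (0::'a) 1)"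
    by (rule measure_Diff_null_set) (auto simp: negligible_iff_null_sets[symmetric])
  ultimately show ?thesis unfolding sphere_measure_def by simp
qed

lemma sphere_measure_pos: "0 < sphere_measure (sphere 0 1 :: 'a::euclidean_space set)"
  unfolding sphere_measure_sphere using content_ball_pos[of 1 "0::'a"] by simp

text \<open>Polar coordinates for radial integrands. Measures on the line are compared on half
  lines: for a >= 0 the preimage of (a, \<infinity>) is a punctured ball of radius e^(-a), whose
  volume scales like e^(-d a). The factor d in \<open>sphere_measure\<close> cancels the 1/d from
  the exponential integral.\<close>

lemma radial_pushforward:
  "distr (density lborel (\<lambda>x::'a::euclidean_space. indicator (ball 0 1) x)) borel log_radius
    = density lborel (\<lambda>t. ennreal (sphere_measure (sphere 0 1 :: 'a set) * (if 0 < t then exp (- (real DIM('a) * t)) else 0)))"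
    (is "?M = ?N")
proof (rule measure_eqI_lessThan)
  have b [measurable]: "ball (0::'a) 1 \<in> sets borel" by simp
  let ?d = "real DIM('a)" and ?w = "measure lborel (ball (0::'a) 1)"
  have M: "emeasure ?M {a<..} = ennreal (exp (- (?d * max 0 a)) * ?w)" for a
  proof -
    have "emeasure ?M {a<..} = emeasure (density lborel (\<lambda>x::'a. indicator (ball 0 1) x)) (log_radius -` {a<..})"
      by (subst emeasure_distr) auto
    also have "\<dots> = emeasure lborel (ball (0::'a) 1 \<inter> log_radius -` {a<..})"
    proof -
      have "log_radius -` {a<..} \<in> sets (borel :: 'a measure)"
        using measurable_sets[OF log_radius_measurable, of "{a<..}"] by simp
      then show ?thesis using b by (subst emeasure_density)
          (auto simp flip: nn_integral_indicator intro!: nn_integral_cong simp: indicator_def[of "_ \<inter> _"] indicator_def[of "_ -` _"])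
    qed
    also have "\<dots> = ennreal (exp (- (?d * max 0 a)) * ?w)"
    proof (cases "0 \<le> a")
      case True
      have "log_radius x > a \<longleftrightarrow> norm x < exp (- a)" if "x \<noteq> 0" for x :: 'a
        using that ln_less_cancel_iff[of "norm x" "exp (- a)"] by (auto simp: log_radius_def)
      moreover have "norm x < exp (- a) \<Longrightarrow> norm x < 1" for x :: 'a
        using True by (meson exp_le_one_iff less_le_trans neg_le_0_iff_le)
      moreover have "log_radius (0::'a) = 0" by (simp add: log_radius_def)
      ultimately have "x \<in> ball (0::'a) 1 \<inter> log_radius -` {a<..} \<longleftrightarrow> x \<in> ball 0 (exp (- a)) - {0}" for x
        using True by (cases "x = 0") auto
      then have "ball (0::'a) 1 \<inter> log_radius -` {a<..} = ball 0 (exp (- a)) - {0}" by blast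
      then have "emeasure lborel (ball (0::'a) 1 \<inter> log_radius -` {a<..}) = emeasure lborel (ball (0::'a) (exp (- a)))"
        by (simp only:) (rule emeasure_Diff_null_set, auto simp: finite_imp_null_set_lborel)
      also have "\<dots> = ennreal (measure lborel (ball (0::'a) (exp (- a))))"
        by (rule emeasure_eq_ennreal_measure) (use emeasure_bounded_finite[of "ball (0::'a) (exp (- a))"] in auto)
      also have "measure lborel (ball (0::'a) (exp (- a))) = exp (- a) ^ DIM('a) * ?w"
        using content_ball_conv_unit_ball[of "exp (- a)" "0::'a"] by simp
      also have "exp (- a) ^ DIM('a) = exp (- (?d * max 0 a))" using True by (simp add: exp_of_nat_mult[symmetric])
      finally show ?thesis .
    next
      case False
      have "a < log_radius x" if "norm x < 1" for x :: 'a
      proof (cases "x = 0")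
        case True then show ?thesis using False by (simp add: log_radius_def)
      next
        case False
        then have "0 < log_radius x" using that by (intro log_radius_pos) auto
        then show ?thesis using \<open>\<not> 0 \<le> a\<close> by linarith
      qed
      then have "ball (0::'a) 1 \<inter> log_radius -` {a<..} = ball 0 1" by auto
      then show ?thesis using False emeasure_bounded_finite[of "ball (0::'a) 1"]
        by (simp add: max_def emeasure_eq_ennreal_measure)
    qed
    finally show ?thesis .
  qed
  have N: "emeasure ?N {a<..} = ennreal (exp (- (?d * max 0 a)) * ?w)" for a
  proof -
    let ?S = "sphere_measure (sphere 0 1 :: 'a set)"
    have h: "has_bochner_integral lborel (\<lambda>t. ?S * (if max 0 a < t then exp (- (?d * t)) else 0)) (?S * (exp (- (?d * max 0 a)) / ?d))"
      by (intro has_bochner_integral_mult_right has_bochner_integral_exp_tail) simp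
    have "emeasure ?N {a<..} = (\<integral>\<^sup>+t. ennreal (?S * (if max 0 a < t then exp (- (?d * t)) else 0)) \<partial>lborel)"
      by (subst emeasure_density) (auto intro!: nn_integral_cong simp: indicator_def)
    also have "\<dots> = ennreal (?S * (exp (- (?d * max 0 a)) / ?d))"
      using h sphere_measure_pos[where 'a='a] by (subst nn_integral_eq_integral) (auto simp: has_bochner_integral_iff)
    finally show ?thesis by (simp add: sphere_measure_sphere mult.commute)
  qed
  show "emeasure ?M {a<..} < \<infinity>" "emeasure ?M {a<..} = emeasure ?N {a<..}" for a by (simp_all add: M N)
qed auto

definition radial_weight :: "'a::euclidean_space itself \<Rightarrow> real \<Rightarrow> real" where
  "radial_weight _ t = sphere_measure (sphere 0 1 :: 'a set) * (if 0 < t then exp (- (real DIM('a) * t)) else 0)"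

lemma radial_integral:
  fixes h :: "real \<Rightarrow> real"
  assumes [measurable]: "h \<in> borel_measurable borel"
  shows "integrable ball_measure (\<lambda>x::'a::euclidean_space. h (log_radius x))
      \<longleftrightarrow> integrable lborel (\<lambda>t. radial_weight TYPE('a) t * h t)" (is ?I)
    and "(LINT x|lebesgue_on (ball (0::'a) 1). h (log_radius x)) = (LBINT t. radial_weight TYPE('a) t * h t)" (is ?E)
proof -
  let ?D = "density lborel (\<lambda>x::'a. indicator (ball 0 1) x)"
  let ?W = "density lborel (\<lambda>t. ennreal (radial_weight TYPE('a) t))"
  have D: "?D = density lborel (\<lambda>x::'a. ennreal (indicator (ball 0 1) x))" by (simp add: ennreal_indicator)
  have dist: "distr ?D borel log_radius = ?W" using radial_pushforward[where 'a='a] by (simp add: radial_weight_def[abs_def])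
  have [measurable]: "radial_weight TYPE('a) \<in> borel_measurable borel" unfolding radial_weight_def[abs_def] by measurable
  have w: "0 \<le> radial_weight TYPE('a) t" for t using sphere_measure_pos[where 'a='a] by (simp add: radial_weight_def)
  have b [measurable]: "ball (0::'a) 1 \<in> sets borel" by simp
  have m: "(\<lambda>x::'a. indicator (ball 0 1) x *\<^sub>R h (log_radius x)) \<in> borel_measurable lborel" by measurable
  have "integrable ball_measure (\<lambda>x::'a. h (log_radius x))
      \<longleftrightarrow> integrable lborel (\<lambda>x::'a. indicator (ball 0 1) x *\<^sub>R h (log_radius x))"
    by (subst integrable_restrict_space, simp, rule integrable_completion[OF m])
  also have "\<dots> \<longleftrightarrow> integrable ?D (\<lambda>x. h (log_radius x))" unfolding D by (subst integrable_density) auto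
  also have "\<dots> \<longleftrightarrow> integrable ?W h" unfolding dist[symmetric] by (subst integrable_distr_eq) auto
  also have "\<dots> \<longleftrightarrow> integrable lborel (\<lambda>t. radial_weight TYPE('a) t * h t)" by (subst integrable_density) (auto simp: w)
  finally show ?I .
  have "(LINT x|lebesgue_on (ball (0::'a) 1). h (log_radius x)) = (LBINT x. indicator (ball (0::'a) 1) x *\<^sub>R h (log_radius x))"
    by (subst integral_restrict_space, simp, rule integral_completion[OF m])
  also have "\<dots> = (\<integral>x. h (log_radius x) \<partial>?D)" unfolding D by (subst integral_density) auto
  also have "\<dots> = (\<integral>t. h t \<partial>?W)" unfolding dist[symmetric] by (subst integral_distr) auto
  also have "\<dots> = (LBINT t. radial_weight TYPE('a) t * h t)" by (subst integral_density) (auto simp: w)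
  finally show ?E .
qed

lemma AE_ball_iff:
  fixes P :: "'a::euclidean_space \<Rightarrow> bool"
  shows "(AE x in ball_measure. P x) \<longleftrightarrow> (AE x in lborel. x \<in> ball 0 1 \<longrightarrow> P x)"
  by (subst AE_restrict_space_iff) (simp_all add: AE_completion_iff)

lemma AE_log_radius_borel:
  assumes [measurable]: "Measurable.pred borel P"
  shows "(AE x in lebesgue_on (ball (0::'a::euclidean_space) 1). P (log_radius x)) \<longleftrightarrow> (AE t in lborel. 0 < t \<longrightarrow> P t)"
proof -
  have b [measurable]: "ball (0::'a) 1 \<in> sets borel" by simp
  let ?D = "density lborel (\<lambda>x::'a. indicator (ball 0 1) x :: ennreal)"
  have "(AE x in lebesgue_on (ball (0::'a) 1). P (log_radius x)) \<longleftrightarrow> (AE x in ?D. P (log_radius x))"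
    unfolding AE_ball_iff by (subst AE_density) (auto simp: indicator_def)
  also have "\<dots> \<longleftrightarrow> (AE t in distr ?D borel log_radius. P t)" by (subst AE_distr_iff) auto
  also have "\<dots> \<longleftrightarrow> (AE t in lborel. 0 < t \<longrightarrow> P t)" unfolding radial_pushforward using sphere_measure_pos[where 'a='a]
    by (subst AE_density) (auto intro!: AE_cong)
  finally show ?thesis .
qed

text \<open>\<open>P\<close> is an arbitrary predicate because it has to speak about arbitrary
  profiles; the measurable case is applied to the complement of a Borel null set.\<close>

lemma AE_log_radius:
  assumes "AE t in lborel. 0 < t \<longrightarrow> P t"
  shows "AE x in lebesgue_on (ball (0::'a::euclidean_space) 1). P (log_radius x)"
proof -
  from assms obtain N where N: "{t \<in> space lborel. \<not> (0 < t \<longrightarrow> P t)} \<subseteq> N" "N \<in> null_sets lborel"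
    unfolding eventually_ae_filter by blast
  have [measurable]: "N \<in> sets borel" using N(2) by auto
  have "AE x in lebesgue_on (ball (0::'a) 1). log_radius x \<notin> N"
    by (subst AE_log_radius_borel) (use AE_not_in[OF N(2)] in auto)
  moreover have "AE x in lebesgue_on (ball (0::'a) 1). x \<noteq> 0 \<and> x \<in> ball 0 1"
    unfolding AE_ball_iff using AE_lborel_singleton[of "0::'a"] by eventually_elim auto
  ultimately show ?thesis by eventually_elim (use N(1) log_radius_pos in auto)
qed

text \<open>A Lebesgue set of the ball that is a union of spheres has a Lebesgue set of radii: it and its
  complement contain, up to null sets, countable unions of compact sets, whose radii form Borel sets.\<close>

lemma lebesgue_log_radius:
  fixes E :: "real set"
  assumes E: "E \<subseteq> {0<..}" and A: "{x::'a::euclidean_space. x \<in> ball 0 1 - {0} \<and> log_radius x \<in> E} \<in> sets lebesgue"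
  shows "E \<in> sets lebesgue"
proof -
  let ?B = "ball (0::'a) 1 - {0}"
  have cont: "continuous_on ?B log_radius" unfolding log_radius_def by (intro continuous_intros) auto
  have img: "log_radius ` C \<in> sets borel" if "fsigma C" "C \<subseteq> ?B" for C
  proof -
    obtain F :: "nat \<Rightarrow> 'a set" where F: "range F \<subseteq> Collect compact" "C = \<Union>(F ` UNIV)"
      using \<open>fsigma C\<close> fsigma_Union_compact by metis
    have "compact (log_radius ` F n)" for n
      by (rule compact_continuous_image[OF continuous_on_subset[OF cont]]) (use F that in auto)
    then have "(\<Union>n. log_radius ` F n) \<in> sets borel" by (intro sets.countable_UN) (auto intro: borel_compact)
    then show ?thesis by (simp add: F(2) image_UN)
  qed
  let ?A = "{x. x \<in> ?B \<and> log_radius x \<in> E}"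
  have "?B - ?A \<in> sets lebesgue" using A by (intro sets.Diff) auto
  then obtain C' T' where C': "fsigma C'" "T' \<in> null_sets lebesgue" "C' \<union> T' = ?B - ?A" "disjnt C' T'"
    by (rule lebesgue_set_almost_fsigma)
  obtain C T where C: "fsigma C" "T \<in> null_sets lebesgue" "C \<union> T = ?A" "disjnt C T"
    using A by (rule lebesgue_set_almost_fsigma)
  have "C \<subseteq> C \<union> T" "C' \<subseteq> C' \<union> T'" by auto
  then have CA: "C \<subseteq> ?A" "C' \<subseteq> ?B - ?A" by (simp_all only: C(3) C'(3))
  then have CB: "C \<subseteq> ?B" "C' \<subseteq> ?B" by blast+
  define E1 E2 where "E1 = log_radius ` C" and "E2 = log_radius ` C'"
  have [measurable]: "E1 \<in> sets borel" "E2 \<in> sets borel"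
    unfolding E1_def E2_def by (rule img[OF C(1) CB(1)] img[OF C'(1) CB(2)])+
  have sub: "E1 \<subseteq> E" "E2 \<inter> E = {}" using CA by (auto simp: E1_def E2_def)
  \<comment> \<open>The logarithmic radii met by neither sigma-compact part. Almost every point of
    the ball lies in \<open>C\<close> or \<open>C'\<close>, so \<open>Z\<close> is null, and
    \<open>E\<close> differs from the Borel set \<open>E1\<close> by a subset of
    \<open>Z\<close>.\<close>
  define Z where "Z = {0<..} - E1 - E2"
  have [measurable]: "Z \<in> sets borel" unfolding Z_def by measurable
  have "AE x in lebesgue. x \<notin> T \<union> T' \<union> {0}"
    using C(2) C'(2) by (intro AE_not_in null_sets.Un) (auto simp: negligible_iff_null_sets[symmetric])
  then have "AE x in lebesgue_on (ball (0::'a) 1). log_radius x \<notin> Z"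
  proof (subst AE_restrict_space_iff, simp, eventually_elim)
    fix x assume x: "x \<notin> T \<union> T' \<union> {0}"
    show "x \<in> ball (0::'a) 1 \<longrightarrow> log_radius x \<notin> Z"
    proof
      assume "x \<in> ball 0 1"
      then have "x \<in> ?A \<or> x \<in> ?B - ?A" using x by auto
      then have "x \<in> C \<or> x \<in> C'" using x C(3) C'(3) by blast
      then show "log_radius x \<notin> Z" by (auto simp: Z_def E1_def E2_def)
    qed
  qed
  then have "AE t in lborel. 0 < t \<longrightarrow> t \<notin> Z" by (subst (asm) AE_log_radius_borel) auto
  then have "AE t in lborel. t \<notin> Z" by eventually_elim (auto simp: Z_def)
  then have "Z \<in> null_sets lborel" by (subst (asm) AE_iff_null) (auto simp: Collect_mem_eq)
  then have "negligible Z" by (simp add: negligible_iff_null_sets null_sets_completionI)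
  then have "negligible (E \<inter> Z)" by (rule negligible_subset) simp
  then have "E \<inter> Z \<in> sets lebesgue" by (rule negligible_imp_sets)
  moreover have "E1 \<in> sets lebesgue" by simp
  ultimately have "E1 \<union> E \<inter> Z \<in> sets lebesgue" by (rule sets.Un[rotated])
  also have "E1 \<union> E \<inter> Z = E" using sub E by (auto simp: Z_def)
  finally show ?thesis .
qed

text \<open>Sublevel sets of the arbitrary profile \<open>q\<close> pull back to those of
  \<open>V\<close> up to a null set, hence are Lebesgue by \<open>lebesgue_log_radius\<close>, and a
  Lebesgue measurable function has a Borel version. The last conclusion later identifies all
  profiles of the same \<open>V\<close>.\<close>

lemma radial_profile_borel:
  fixes V :: "'a::euclidean_space \<Rightarrow> real"
  assumes V: "V \<in> borel_measurable ball_measure" and q: "radial_profile V q"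
  obtains v where "v \<in> borel_measurable borel" "AE x in ball_measure. V x = v (log_radius x)"
    "AE t in lborel. 0 < t \<longrightarrow> q (exp (- t)) = v t"
proof -
  let ?B = "ball (0::'a) 1 - {0}"
  define g where "g t = (if 0 < t then q (exp (- t)) else 0)" for t
  have E: "{t. 0 < t \<and> q (exp (- t)) < c} \<in> sets lebesgue" for c
  proof (rule lebesgue_log_radius[where 'a = 'a])
    let ?A = "{x::'a. x \<in> ?B \<and> log_radius x \<in> {t. 0 < t \<and> q (exp (- t)) < c}}"
    have A: "?A = {x. x \<in> ?B \<and> q (norm x) < c}" using log_radius_pos by (auto simp: exp_log_radius)
    have "AE x in lebesgue. x \<in> ball 0 1 \<longrightarrow> V x = q (norm x)"
      using q unfolding radial_profile_def by (subst (asm) AE_restrict_space_iff) auto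
    then obtain N where N: "{x. \<not> (x \<in> ball 0 1 \<longrightarrow> V x = q (norm x))} \<subseteq> N" "N \<in> null_sets lebesgue"
      by (auto simp: eventually_ae_filter)
    have "V -` {..<c} \<inter> space ball_measure \<in> sets ball_measure" using V by (rule measurable_sets) simp
    then have "V -` {..<c} \<inter> ball 0 1 \<in> sets lebesgue" by (simp add: space_restrict_space sets_restrict_space_iff)
    moreover have "N \<in> sets lebesgue" "{0::'a} \<in> sets lebesgue" using N by auto
    moreover have "?A \<inter> N \<in> sets lebesgue"
      by (rule negligible_imp_sets[OF negligible_subset[of N]]) (use N(2) in \<open>auto simp: negligible_iff_null_sets\<close>)
    ultimately have "(V -` {..<c} \<inter> ball 0 1 - N - {0}) \<union> (?A \<inter> N) \<in> sets lebesgue" by (intro sets.Un sets.Diff)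
    also have "(V -` {..<c} \<inter> ball 0 1 - N - {0}) \<union> (?A \<inter> N) = ?A" unfolding A using N(1) by auto
    finally show "?A \<in> sets lebesgue" .
  qed auto
  have "g \<in> borel_measurable lebesgue"
  proof (rule borel_measurableI_less)
    fix c
    have "{t \<in> space lebesgue. g t < c} = {t. 0 < t \<and> q (exp (- t)) < c} \<union> (if 0 < c then {..0} else {})"
      by (auto simp: g_def)
    also have "\<dots> \<in> sets lebesgue" using E by auto
    finally show "{t \<in> space lebesgue. g t < c} \<in> sets lebesgue" .
  qed
  then obtain v where v: "v \<in> borel_measurable lborel" "AE t in lborel. g t = v t"
    using completion_ex_borel_measurable_real by blast
  have gv: "AE t in lborel. 0 < t \<longrightarrow> q (exp (- t)) = v t" using v(2) by eventually_elim (auto simp: g_def)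
  have "AE x in lebesgue_on (ball (0::'a) 1). x \<noteq> 0"
    unfolding AE_ball_iff using AE_lborel_singleton[of "0::'a"] by eventually_elim auto
  with AE_log_radius[OF gv] q[unfolded radial_profile_def]
  have "AE x in ball_measure. V x = v (log_radius x)" by eventually_elim (simp add: exp_log_radius)
  with v(1) gv show ?thesis by (intro that) auto
qed

section \<open>Eigenvalues of the Dirichlet-to-Neumann map\<close>

lemma absolutely_integrable_Icc_borel:
  fixes h :: "real \<Rightarrow> real"
  assumes m: "(\<lambda>t. indicator {a..b} t * h t) \<in> borel_measurable borel"
  shows "h absolutely_integrable_on {a..b} \<and> integral {a..b} h = c
    \<longleftrightarrow> set_integrable lborel {a..b} h \<and> (LINT t:{a..b}|lborel. h t) = c"
proof -
  have "h absolutely_integrable_on {a..b} \<longleftrightarrow> set_integrable lborel {a..b} h"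
    unfolding set_integrable_def real_scaleR_def by (rule integrable_completion) (use m in simp)
  then show ?thesis using set_borel_integral_eq_integral(2)[of "{a..b}" h] by auto
qed

text \<open>Substitution r = e^(-t), whose Jacobian is the factor \<open>exp (- t)\<close> in the
  last assumption. \<open>F\<close> comes from a Borel version of the potential and matches the
  transformed integrand only almost everywhere.\<close>

lemma radial_log_integral:
  fixes f F :: "real \<Rightarrow> real"
  assumes ab: "0 \<le> a" "a \<le> b"
    and m: "(\<lambda>t. indicator {a..b} t * F t) \<in> borel_measurable borel"
    and ae: "AE t in lborel. 0 < t \<longrightarrow> exp (- t) * f (exp (- t)) = F t"
  shows "f absolutely_integrable_on {exp (- b)..exp (- a)} \<and> integral {exp (- b)..exp (- a)} f = c
    \<longleftrightarrow> set_integrable lborel {a..b} F \<and> (LINT t:{a..b}|lborel. F t) = c"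
proof -
  let ?g = "\<lambda>t. \<bar>- exp (- t)\<bar> * f (exp (- t)) :: real"
  have img: "(\<lambda>t. exp (- t)) ` {a..b} = {exp (- b)..exp (- a)}"
  proof (intro equalityI subsetI)
    fix r assume r: "r \<in> {exp (- b)..exp (- a)}"
    then have "0 < r" by (auto intro: less_le_trans[OF exp_gt_zero])
    then have "r = exp (- (- ln r))" "- ln r \<in> {a..b}"
      using r ln_ge_iff[of r "- b"] ln_le_cancel_iff[of r "exp (- a)"] by auto
    then show "r \<in> (\<lambda>t. exp (- t)) ` {a..b}" by blast
  qed auto
  have "f absolutely_integrable_on {exp (- b)..exp (- a)} \<and> integral {exp (- b)..exp (- a)} f = c
    \<longleftrightarrow> ?g absolutely_integrable_on {a..b} \<and> integral {a..b} ?g = c" unfolding img[symmetric]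
    by (rule has_absolute_integral_change_of_variables_1'[symmetric])
      (auto intro!: derivative_eq_intros inj_onI)
  also have "\<dots> \<longleftrightarrow> F absolutely_integrable_on {a..b} \<and> integral {a..b} F = c"
  proof -
    obtain N where N: "\<And>t. t \<in> space lborel - N \<Longrightarrow> 0 < t \<longrightarrow> exp (- t) * f (exp (- t)) = F t" "N \<in> null_sets lborel"
      using ae by (rule AE_E3) (rule that; simp)
    define N' where "N' = insert 0 N"
    have "negligible N" using N(2) by (simp add: negligible_iff_null_sets null_sets_completionI)
    then have neg: "negligible N'" by (simp add: N'_def)
    have eq: "?g t = F t" if "t \<in> {a..b} - N'" for t
    proof -
      have "0 < t" "t \<notin> N" using that ab by (auto simp: N'_def less_le)
      then show ?thesis using N(1)[of t] by simp
    qed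
    have "?g absolutely_integrable_on {a..b} \<longleftrightarrow> F absolutely_integrable_on {a..b}"
    proof
      assume "?g absolutely_integrable_on {a..b}"
      then show "F absolutely_integrable_on {a..b}" by (rule absolutely_integrable_spike[OF _ neg]) (rule eq[symmetric])
    next
      assume "F absolutely_integrable_on {a..b}"
      then show "?g absolutely_integrable_on {a..b}" by (rule absolutely_integrable_spike[OF _ neg]) (rule eq)
    qed
    moreover have "integral {a..b} ?g = integral {a..b} F" by (rule integral_spike[OF neg]) (use eq in auto)
    ultimately show ?thesis by simp
  qed
  also have "\<dots> \<longleftrightarrow> set_integrable lborel {a..b} F \<and> (LINT t:{a..b}|lborel. F t) = c"
    by (rule absolutely_integrable_Icc_borel[OF m])
  finally show ?thesis .
qed

lemma indicator_Icc_mult_measurable: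
  fixes \<beta> :: "real \<Rightarrow> real"
  assumes Q: "Q \<in> borel_measurable borel" and c: "continuous_on {0..} \<beta>" and "0 \<le> a"
  shows "(\<lambda>t. indicator {a..b} t * (exp (- (2 * \<nu> * t)) * ((K + Q t) * \<beta> t))) \<in> borel_measurable borel"
proof -
  have "continuous_on {a..b} \<beta>" by (rule continuous_on_subset[OF c]) (use assms in auto)
  then have [measurable]: "(\<lambda>t. indicator {a..b} t *\<^sub>R \<beta> t) \<in> borel_measurable borel"
    by (intro borel_measurable_continuous_on_indicator) auto
  have "(\<lambda>t. indicator {a..b} t * (exp (- (2 * \<nu> * t)) * ((K + Q t) * \<beta> t)))
      = (\<lambda>t. exp (- (2 * \<nu> * t)) * ((K + Q t) * (indicator {a..b} t *\<^sub>R \<beta> t)))" by (auto simp: fun_eq_iff)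
  also have "\<dots> \<in> borel_measurable borel" using Q by measurable
  finally show ?thesis .
qed

context
  fixes d :: nat and \<nu> :: real and q Q :: "real \<Rightarrow> real" and k :: nat
  assumes d: "2 \<le> d" and \<nu>: "\<nu> = (real d - 2) / 2"
    and Q: "Q \<in> borel_measurable borel"
    and qQ: "AE t in lborel. 0 < t \<longrightarrow> exp (- (2 * t)) * q (exp (- t)) = Q t"
begin

lemma power_pred: "(x::real) ^ (d - 1) = x ^ (d - 2) * x"
proof -
  obtain n where "d = 2 + n" using d le_Suc_ex by blast
  then show ?thesis by simp
qed

lemma exp_two_nu: "exp (- (2 * \<nu> * t)) = exp (- t) ^ (d - 2)" using d by (simp add: \<nu> exp_of_nat_mult[symmetric] of_nat_diff)

text \<open>The power r^(d-1), the Jacobian r and a factor r^(-2) taken out of the bracket combine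
  to r^(d-2) = e^(-2 \<nu> t); the bracket becomes K + Q.\<close>

lemma radial_log_integrand:
  assumes "0 \<le> a" "a \<le> b" and c: "continuous_on {0..} \<beta>" and \<beta>: "\<And>t. 0 \<le> t \<Longrightarrow> \<beta> t = u (exp (- t))"
  defines "f \<equiv> \<lambda>r. r ^ (d - 1) * ((real k * (real k + real d - 2) / r\<^sup>2 + q r) * u r)"
    and "F \<equiv> \<lambda>s. log_rhs \<nu> (real k * (real k + 2 * \<nu>)) Q \<beta> s"
  shows "f absolutely_integrable_on {exp (- b)..exp (- a)} \<and> integral {exp (- b)..exp (- a)} f = x
    \<longleftrightarrow> set_integrable lborel {a..b} F \<and> (LINT t:{a..b}|lborel. F t) = x"
proof (rule radial_log_integral[OF assms(1,2)])
  show "(\<lambda>t. indicator {a..b} t * F t) \<in> borel_measurable borel"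
    unfolding F_def by (rule indicator_Icc_mult_measurable[OF Q c assms(1)])
  show "AE t in lborel. 0 < t \<longrightarrow> exp (- t) * f (exp (- t)) = F t" using qQ
  proof eventually_elim
    case (elim t)
    show ?case
    proof
      assume t: "0 < t"
      define e where "e = exp (- t)"
      have e0: "e \<noteq> 0" and e2: "exp (- (2 * t)) = e\<^sup>2" by (simp_all add: e_def exp_double[symmetric])
      have Qt: "Q t = e\<^sup>2 * q e" using elim t e2 by (simp add: e_def)
      have pw: "e * e ^ (d - 1) = e ^ (d - 2) * e\<^sup>2" unfolding power_pred by (simp add: power2_eq_square)
      have "exp (- t) * f (exp (- t)) = (e * e ^ (d - 1)) * ((real k * (real k + real d - 2) / e\<^sup>2 + q e) * u e)"
        by (simp add: f_def e_def)
      also have "\<dots> = e ^ (d - 2) * ((real k * (real k + real d - 2) + e\<^sup>2 * q e) * u e)"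
        unfolding pw using e0 by (simp add: field_simps)
      also have "\<dots> = F t" using t \<beta>[of t] by (simp add: F_def exp_two_nu Qt e_def[symmetric]) (simp add: \<nu>)
      finally show "exp (- t) * f (exp (- t)) = F t" .
    qed
  qed
qed

lemma radial_solution_imp_log_solution:
  assumes "radial_solution d q k u"
  obtains p where "log_solution \<nu> (real k * (real k + 2 * \<nu>)) Q (\<lambda>t. u (exp (- t))) p"
    "(u has_real_derivative - p 0) (at 1 within {0<..1})"
proof -
  define f where "f = (\<lambda>r. r ^ (d - 1) * ((real k * (real k + real d - 2) / r\<^sup>2 + q r) * u r))"
  obtain w where w: "\<And>r. r \<in> {0<..1} \<Longrightarrow> (u has_real_derivative w r) (at r within {0<..1})"
    and wi: "\<And>s r. 0 < s \<Longrightarrow> s \<le> r \<Longrightarrow> r \<le> 1 \<Longrightarrow>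
      f absolutely_integrable_on {s..r} \<and> r ^ (d - 1) * w r - s ^ (d - 1) * w s = integral {s..r} f"
    using assms unfolding radial_solution_def Let_def f_def by blast
  \<comment> \<open>The minus sign comes from dr/dt = -r; it makes \<open>- p 0\<close> the
    derivative of \<open>u\<close> at r = 1.\<close>
  define p where "p t = - (exp (- t) ^ (d - 1) * w (exp (- t)))" for t
  have der: "((\<lambda>t. u (exp (- t))) has_real_derivative exp (2 * \<nu> * t) * p t) (at t within {0..})" if t: "0 \<le> t" for t
  proof -
    have "(u has_real_derivative w (exp (- t))) (at (exp (- t)) within (\<lambda>t. exp (- t)) ` {0..})"
      by (rule has_field_derivative_subset[OF w]) (use t in auto)
    moreover have "((\<lambda>t. exp (- t)) has_real_derivative - exp (- t)) (at t within {0..})"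
      by (auto intro!: derivative_eq_intros)
    ultimately have "((u \<circ> (\<lambda>t. exp (- t))) has_real_derivative w (exp (- t)) * - exp (- t)) (at t within {0..})"
      by (rule DERIV_image_chain)
    moreover have "w (exp (- t)) * - exp (- t) = exp (2 * \<nu> * t) * p t"
    proof -
      have "exp (- t) ^ (d - 1) = exp (- (2 * \<nu> * t)) * exp (- t)" unfolding exp_two_nu by (rule power_pred)
      then show ?thesis by (simp add: p_def exp_minus field_simps)
    qed
    ultimately show ?thesis by (simp add: o_def)
  qed
  have c: "continuous_on {0..} (\<lambda>t. u (exp (- t)))" by (rule DERIV_continuous_on[OF der]) simp
  have "log_solution \<nu> (real k * (real k + 2 * \<nu>)) Q (\<lambda>t. u (exp (- t))) p" unfolding log_solution_def
  proof (intro conjI allI impI)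
    fix a b :: real assume ab: "0 \<le> a" "a \<le> b"
    have "f absolutely_integrable_on {exp (- b)..exp (- a)} \<and> integral {exp (- b)..exp (- a)} f = p b - p a"
      using wi[of "exp (- b)" "exp (- a)"] ab by (simp add: p_def)
    then have *: "set_integrable lborel {a..b} (\<lambda>s. log_rhs \<nu> (real k * (real k + 2 * \<nu>)) Q (\<lambda>t. u (exp (- t))) s) \<and>
        (LINT s:{a..b}|lborel. log_rhs \<nu> (real k * (real k + 2 * \<nu>)) Q (\<lambda>t. u (exp (- t))) s) = p b - p a"
      using radial_log_integrand[OF ab c refl, of "p b - p a"] by (simp add: f_def)
    then show "set_integrable lborel {a..b} (\<lambda>s. log_rhs \<nu> (real k * (real k + 2 * \<nu>)) Q (\<lambda>t. u (exp (- t))) s)"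
      "p b - p a = (LINT s:{a..b}|lborel. log_rhs \<nu> (real k * (real k + 2 * \<nu>)) Q (\<lambda>t. u (exp (- t))) s)" by simp_all
  qed (rule der)
  moreover have "(u has_real_derivative - p 0) (at 1 within {0<..1})" using w[of 1] by (simp add: p_def)
  ultimately show ?thesis by (rule that)
qed

lemma log_solution_imp_radial_solution:
  assumes sol: "log_solution \<nu> (real k * (real k + 2 * \<nu>)) Q \<beta> p"
  shows "radial_solution d q k (\<lambda>r. \<beta> (- ln r))"
    and "((\<lambda>r. \<beta> (- ln r)) has_real_derivative - p 0) (at 1 within {0<..1})"
proof -
  have c: "continuous_on {0..} \<beta>" using sol by (intro DERIV_continuous_on) (auto simp: log_solution_def)
  define w where "w r = - (p (- ln r) / r ^ (d - 1))" for r
  have der: "((\<lambda>r. \<beta> (- ln r)) has_real_derivative w r) (at r within {0<..1})" if r: "r \<in> {0<..1}" for r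
  proof -
    have "(\<beta> has_real_derivative exp (2 * \<nu> * - ln r) * p (- ln r)) (at (- ln r) within {0..})"
    proof -
      have "0 \<le> - ln r" using r by simp
      then show ?thesis using sol unfolding log_solution_def by blast
    qed
    then have "(\<beta> has_real_derivative exp (2 * \<nu> * - ln r) * p (- ln r)) (at (- ln r) within (\<lambda>r. - ln r) ` {0<..1})"
      by (rule has_field_derivative_subset) auto
    moreover have "((\<lambda>r. - ln r) has_real_derivative - (1 / r)) (at r within {0<..1})"
      using r by (auto intro!: derivative_eq_intros)
    ultimately have "((\<beta> \<circ> (\<lambda>r. - ln r)) has_real_derivative exp (2 * \<nu> * - ln r) * p (- ln r) * - (1 / r)) (at r within {0<..1})"
      by (rule DERIV_image_chain)
    moreover have "exp (2 * \<nu> * - ln r) * p (- ln r) * - (1 / r) = w r"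
    proof -
      have "exp (2 * \<nu> * - ln r) = 1 / exp (- (2 * \<nu> * - ln r))" by (simp add: exp_minus field_simps)
      also have "\<dots> = 1 / r ^ (d - 2)" using r by (simp only: exp_two_nu) simp
      finally have e: "exp (2 * \<nu> * - ln r) = 1 / r ^ (d - 2)" .
      have "r ^ (d - 1) = r ^ (d - 2) * r" by (rule power_pred)
      then show ?thesis unfolding e w_def by simp
    qed
    ultimately show ?thesis by (simp add: o_def)
  qed
  show "((\<lambda>r. \<beta> (- ln r)) has_real_derivative - p 0) (at 1 within {0<..1})" using der[of 1] by (simp add: w_def)
  show "radial_solution d q k (\<lambda>r. \<beta> (- ln r))" unfolding radial_solution_def Let_def
  proof (intro exI[of _ w] conjI ballI allI impI; (elim conjE)?)
    fix s r :: real assume sr: "0 < s" "s \<le> r" "r \<le> 1"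
    let ?f = "\<lambda>r. r ^ (d - 1) * ((real k * (real k + real d - 2) / r\<^sup>2 + q r) * \<beta> (- ln r))"
    have ab: "0 \<le> - ln r" "- ln r \<le> - ln s" using sr by auto
    note h = sol[unfolded log_solution_def, THEN conjunct2, rule_format, OF ab]
    have "set_integrable lborel {- ln r..- ln s} (log_rhs \<nu> (real k * (real k + 2 * \<nu>)) Q \<beta>)
      \<and> (LINT s:{- ln r..- ln s}|lborel. log_rhs \<nu> (real k * (real k + 2 * \<nu>)) Q \<beta> s) = p (- ln s) - p (- ln r)"
      by (rule conjI[OF conjunct1[OF h] conjunct2[OF h, symmetric]])
    then have "?f absolutely_integrable_on {exp (- (- ln s))..exp (- (- ln r))} \<and> integral {exp (- (- ln s))..exp (- (- ln r))} ?f = p (- ln s) - p (- ln r)"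
      by (subst radial_log_integrand[OF ab c]) simp_all
    then show "?f absolutely_integrable_on {s..r}" "r ^ (d - 1) * w r - s ^ (d - 1) * w s = integral {s..r} ?f"
      using sr by (auto simp: w_def)
  qed (use der in auto)
qed

end

text \<open>\<open>h\<close> is a Borel form of b^2 |x|^(-2), cut off at t < 0 because \<beta> is
  controlled only on t >= 0. The weight e^(-d t) of the ball and the factor e^(2 t) from |x|^(-2)
  combine to e^(-2 \<nu> t).\<close>

lemma radial_L2_iff:
  fixes b \<beta> :: "real \<Rightarrow> real" and \<nu> :: real
  assumes \<nu>: "\<nu> = (real DIM('a::euclidean_space) - 2) / 2"
    and \<beta>: "\<And>t. 0 \<le> t \<Longrightarrow> \<beta> t = b (exp (- t))" and c: "continuous_on {0..} \<beta>"
  obtains h where "h \<in> borel_measurable borel" "\<And>t. 0 \<le> h t"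
    "\<And>x::'a. x \<in> ball 0 1 \<Longrightarrow> x \<noteq> 0 \<Longrightarrow> (b (norm x))\<^sup>2 * norm x powr (-2) = h (log_radius x)"
    "integrable ball_measure (\<lambda>x::'a. h (log_radius x))
      \<longleftrightarrow> weighted_L2 \<nu> \<beta>"
proof
  define g where "g t = indicator {0..} t *\<^sub>R \<beta> t" for t
  have g [measurable]: "g \<in> borel_measurable borel"
    unfolding g_def[abs_def] using c by (intro borel_measurable_continuous_on_indicator) auto
  define h where "h t = (g t)\<^sup>2 * exp (2 * t)" for t
  show hm: "h \<in> borel_measurable borel" unfolding h_def[abs_def] by measurable
  show "0 \<le> h t" for t by (simp add: h_def)
  show "(b (norm x))\<^sup>2 * norm x powr (-2) = h (log_radius x)" if "x \<in> ball 0 1" "x \<noteq> 0" for x :: 'a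
  proof -
    have l: "0 \<le> log_radius x" using log_radius_pos[OF that] by simp
    have "exp (2 * log_radius x) = norm x powr (-2)" using that by (simp add: log_radius_def powr_def)
    then show ?thesis using l \<beta>[OF l] that by (simp add: h_def g_def exp_log_radius)
  qed
  let ?S = "sphere_measure (sphere 0 1 :: 'a set)"
  have "integrable ball_measure (\<lambda>x::'a. h (log_radius x)) \<longleftrightarrow> integrable lborel (\<lambda>t. radial_weight TYPE('a) t * h t)"
    by (rule radial_integral(1)[OF hm])
  also have "\<dots> \<longleftrightarrow> integrable lborel (\<lambda>t. ?S * ((g t)\<^sup>2 * exp (- (2 * \<nu> * t))))"
  proof (rule integrable_cong_AE)
    have [measurable]: "radial_weight TYPE('a) \<in> borel_measurable borel" unfolding radial_weight_def[abs_def] by measurable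
    show "(\<lambda>t. radial_weight TYPE('a) t * h t) \<in> borel_measurable lborel" using hm by measurable
    show "AE t in lborel. radial_weight TYPE('a) t * h t = ?S * ((g t)\<^sup>2 * exp (- (2 * \<nu> * t)))"
    proof (rule AE_mp[OF AE_lborel_singleton[of 0]], rule AE_I2, rule impI)
      fix t :: real assume "t \<noteq> 0"
      have e: "exp (- (real DIM('a) * t)) * exp (2 * t) = exp (- (2 * \<nu> * t))"
        by (simp add: exp_add[symmetric] \<nu> field_simps)
      show "radial_weight TYPE('a) t * h t = ?S * ((g t)\<^sup>2 * exp (- (2 * \<nu> * t)))"
      proof (cases "0 < t")
        case True
        then show ?thesis unfolding e[symmetric] by (simp add: radial_weight_def h_def)
      next
        case False
        then show ?thesis using \<open>t \<noteq> 0\<close> by (simp add: radial_weight_def h_def g_def)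
      qed
    qed
  qed measurable
  also have "\<dots> \<longleftrightarrow> integrable lborel (\<lambda>t. (g t)\<^sup>2 * exp (- (2 * \<nu> * t)))"
    using sphere_measure_pos[where 'a = 'a] by (subst integrable_mult_left_iff) auto
  also have "(\<lambda>t. (g t)\<^sup>2 * exp (- (2 * \<nu> * t))) = (\<lambda>t. indicator {0..} t * ((\<beta> t)\<^sup>2 * exp (- (2 * \<nu> * t))))"
    by (auto simp: g_def fun_eq_iff indicator_def)
  finally show "integrable ball_measure (\<lambda>x::'a. h (log_radius x))
      \<longleftrightarrow> weighted_L2 \<nu> \<beta>" .
qed

lemma borel_imp_lebesgue_on_ball:
  fixes f :: "'a::euclidean_space \<Rightarrow> real"
  assumes "f \<in> borel_measurable borel"
  shows "f \<in> borel_measurable ball_measure" using assms by (intro measurable_restrict_space1 measurable_completion) simp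

lemma L2_imp_harmonic_integrable:
  fixes b \<beta> :: "real \<Rightarrow> real" and \<nu> :: real and Y :: "'a::euclidean_space \<Rightarrow> real"
  assumes \<nu>: "\<nu> = (real DIM('a) - 2) / 2"
    and \<beta>: "\<And>t. 0 \<le> t \<Longrightarrow> \<beta> t = b (exp (- t))" and c: "continuous_on {0..} \<beta>"
    and L2: "weighted_L2 \<nu> \<beta>"
    and Y: "spherical_harmonic k Y"
  shows "integrable ball_measure (\<lambda>x::'a. (b (norm x) * Y (x /\<^sub>R norm x))\<^sup>2 * norm x powr (-2))"
proof -
  obtain h where h [measurable]: "h \<in> borel_measurable borel" and h0: "\<And>t. 0 \<le> h t"
    and hx: "\<And>x::'a. x \<in> ball 0 1 \<Longrightarrow> x \<noteq> 0 \<Longrightarrow> (b (norm x))\<^sup>2 * norm x powr (-2) = h (log_radius x)"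
    and iff: "integrable ball_measure (\<lambda>x::'a. h (log_radius x))
      \<longleftrightarrow> weighted_L2 \<nu> \<beta>" by (rule radial_L2_iff[OF \<nu> \<beta> c], assumption, (rule that; (assumption | blast)))
  have hi: "integrable ball_measure (\<lambda>x::'a. h (log_radius x))" using iff L2 by simp
  obtain P where P: "real_polynomial_function P" "\<And>x. x \<in> sphere 0 1 \<Longrightarrow> Y x = P x"
    using Y unfolding spherical_harmonic_def by blast
  have Pc: "continuous_on UNIV P"
    using continuous_real_polymonial_function[OF P(1)] by (simp add: continuous_at_imp_continuous_on)
  then have [measurable]: "P \<in> borel_measurable borel" by (rule borel_measurable_continuous_onI)
  have "continuous_on (sphere 0 1) P" by (rule continuous_on_subset[OF Pc]) simp
  from compact_imp_bounded[OF compact_continuous_image[OF this compact_sphere]]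
  obtain B where "\<forall>x\<in>sphere 0 1. \<bar>P x\<bar> \<le> B" unfolding bounded_iff by auto
  then have B: "\<bar>P x\<bar> \<le> B" if "x \<in> sphere 0 1" for x using that by blast
  let ?f = "\<lambda>x::'a. indicator (- {0}) x * (h (log_radius x) * (P (x /\<^sub>R norm x))\<^sup>2)"
  have eq: "(b (norm x) * Y (x /\<^sub>R norm x))\<^sup>2 * norm x powr (-2) = ?f x" if "x \<in> ball 0 1" for x
  proof (cases "x = 0")
    case False
    then have "x /\<^sub>R norm x \<in> sphere 0 1" by simp
    then show ?thesis using hx[OF that False] P(2) False by (simp add: power_mult_distrib mult_ac)
  qed simp
  have "integrable ball_measure ?f"
  proof (rule integrable_dominated[OF integrable_mult_left[OF hi, of "B\<^sup>2"]])
    show "?f \<in> borel_measurable ball_measure" by (rule borel_imp_lebesgue_on_ball) measurable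
    show "norm (?f x) \<le> norm (h (log_radius x) * B\<^sup>2)" for x
    proof (cases "x = 0")
      case False
      then have "x /\<^sub>R norm x \<in> sphere 0 1" by simp
      from B[OF this] have "(P (x /\<^sub>R norm x))\<^sup>2 \<le> B\<^sup>2" by (metis abs_ge_zero power2_abs power_mono)
      then show ?thesis using False h0[of "log_radius x"] by (simp add: abs_mult mult_left_mono)
    qed simp
  qed
  also have "?this \<longleftrightarrow> ?thesis" by (rule Bochner_Integration.integrable_cong) (use eq in \<open>auto simp: space_restrict_space\<close>)
  finally show ?thesis .
qed

text \<open>A single harmonic has zeros and would lose information; the squares of the finite family
  in \<open>spherical_harmonics_lower_bound\<close> sum to a function bounded below on the sphere,
  which removes the angular factor.\<close>

lemma harmonic_integrable_imp_L2:
  fixes b \<beta> :: "real \<Rightarrow> real" and \<nu> :: real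
  assumes d: "DIM('a::euclidean_space) \<ge> 2" and \<nu>: "\<nu> = (real DIM('a) - 2) / 2"
    and \<beta>: "\<And>t. 0 \<le> t \<Longrightarrow> \<beta> t = b (exp (- t))" and c: "continuous_on {0..} \<beta>"
    and int: "\<And>Y :: 'a \<Rightarrow> real. spherical_harmonic k Y \<Longrightarrow>
      integrable ball_measure (\<lambda>x::'a. (b (norm x) * Y (x /\<^sub>R norm x))\<^sup>2 * norm x powr (-2))"
  shows "weighted_L2 \<nu> \<beta>"
proof -
  obtain h where h [measurable]: "h \<in> borel_measurable borel" and h0: "\<And>t. 0 \<le> h t"
    and hx: "\<And>x::'a. x \<in> ball 0 1 \<Longrightarrow> x \<noteq> 0 \<Longrightarrow> (b (norm x))\<^sup>2 * norm x powr (-2) = h (log_radius x)"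
    and hi: "integrable ball_measure (\<lambda>x::'a. h (log_radius x))
      \<longleftrightarrow> weighted_L2 \<nu> \<beta>" by (rule radial_L2_iff[OF \<nu> \<beta> c], assumption, (rule that; (assumption | blast)))
  obtain F :: "('a \<Rightarrow> real) set" where F: "finite F" "\<And>Y. Y \<in> F \<Longrightarrow> spherical_harmonic k Y"
    "\<And>x. norm x = 1 \<Longrightarrow> (1 / real DIM('a)) ^ (2 * k) \<le> (\<Sum>Y\<in>F. (Y x)\<^sup>2)"
    by (rule spherical_harmonics_lower_bound[OF d, of k]) (rule that; (assumption | blast))
  define C where "C = (1 / real DIM('a)) ^ (2 * k)"
  have C: "0 < C" by (simp add: C_def)
  let ?G = "\<lambda>x::'a. \<Sum>Y\<in>F. (b (norm x) * Y (x /\<^sub>R norm x))\<^sup>2 * norm x powr (-2)"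
  have G: "integrable ball_measure ?G" by (rule Bochner_Integration.integrable_sum) (use int F(2) in blast)
  have "integrable ball_measure (\<lambda>x::'a. C * h (log_radius x))"
  proof (rule integrable_bound_lint[OF G])
    show "(\<lambda>x::'a. C * h (log_radius x)) \<in> borel_measurable ball_measure" by (rule borel_imp_lebesgue_on_ball) measurable
    have "norm (C * h (log_radius x)) \<le> norm (?G x)" if x: "x \<in> ball 0 1" "x \<noteq> 0" for x :: 'a
    proof -
      have "C * h (log_radius x) \<le> (\<Sum>Y\<in>F. (Y (x /\<^sub>R norm x))\<^sup>2) * h (log_radius x)"
        unfolding C_def using F(3)[of "x /\<^sub>R norm x"] x h0 by (intro mult_right_mono) auto
      also have "\<dots> = ?G x" unfolding hx[OF x, symmetric] sum_distrib_right by (simp add: power_mult_distrib mult_ac)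
      finally show ?thesis using C h0[of "log_radius x"] by simp
    qed
    then have "AE x in lborel. x \<in> ball 0 1 \<longrightarrow> norm (C * h (log_radius x)) \<le> norm (?G x)"
      by (intro AE_mp[OF AE_lborel_singleton[of "0::'a"] AE_I2]) blast
    then show "AE x in ball_measure. norm (C * h (log_radius x)) \<le> norm (?G x)" unfolding AE_ball_iff .
  qed
  then have "integrable ball_measure (\<lambda>x::'a. h (log_radius x))" using C by (subst (asm) integrable_mult_left_iff) auto
  then show ?thesis using hi by simp
qed

text \<open>The eigenvalue is a definite description, so existence and uniqueness are both required:
  the amplitude gives a regular solution with derivative \<open>- p 0\<close> at 1, and
  \<open>log_solution_unique\<close> forces the same derivative on every other one. The condition 3R
  <= k yields R / (\<mu> - R) <= 1/2.\<close>

lemma dn_eigenvalue_eq: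
  fixes V :: "'a::euclidean_space \<Rightarrow> real" and v :: "real \<Rightarrow> real" and k :: nat
  assumes d: "DIM('a) \<ge> 2" and V: "V \<in> borel_measurable ball_measure"
    and v [measurable]: "v \<in> borel_measurable borel" and Vv: "AE x in ball_measure. V x = v (log_radius x)"
    and P: "log_potential (log_density v) R"
    and k: "3 * R \<le> real k"
  defines "Q \<equiv> log_density v" and "\<mu> \<equiv> real k + (real DIM('a) - 2) / 2"
  shows "dn_eigenvalue V k = real k + (LBINT s. Q s * log_potential.amp Q \<mu> s * decay \<mu> s)"
proof -
  interpret log_potential Q R using P by (simp add: Q_def)
  define \<nu> where "\<nu> = (real DIM('a) - 2) / 2"
  have \<nu>0: "0 \<le> \<nu>" using d by (simp add: \<nu>_def)
  have \<mu>: "\<mu> = real k + \<nu>" by (simp add: \<mu>_def \<nu>_def)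
  have \<mu>R: "R < \<mu>" and \<mu>3: "3 * R \<le> \<mu>" using k R_pos \<nu>0 by (auto simp: \<mu>)
  have near: "\<bar>amp \<mu> t - 1\<bar> \<le> 1 / 2" for t
  proof -
    have "R / (\<mu> - R) \<le> 1 / 2" using \<mu>3 R_pos by (simp add: divide_le_eq)
    then show ?thesis using amp_near_one[OF \<mu>R, of t] by linarith
  qed
  let ?K = "real k * (real k + 2 * \<nu>)"
  define \<beta> where "\<beta> t = exp (- (real k * t)) * amp \<mu> t" for t
  define p where "p t = - (real k * exp (- ((real k + 2 * \<nu>) * t))) * amp \<mu> t + - exp (real k * t) * amp_tail \<mu> t" for t
  have sol: "log_solution \<nu> ?K Q \<beta> p"
    using amp_log_solution[of "real k" \<nu>] \<mu>R unfolding \<beta>_def[abs_def] p_def[abs_def] \<mu> by simp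
  have c: "continuous_on {0..} \<beta>" by (rule log_solution_continuous(1)[OF sol])
  have p0: "- p 0 = real k + (LBINT s. Q s * amp \<mu> s * decay \<mu> s)" by (simp add: p_def amp_zero amp_tail_zero)
  have L2: "weighted_L2 \<nu> \<beta>"
  proof (rule integrable_bound_lint)
    show "integrable lborel (\<lambda>t. (9 / 4) * (if 0 < t then decay \<mu> t else 0))"
      using has_bochner_integral_exp_tail[of "2 * \<mu>" 0] \<mu>R R_pos by (auto simp: has_bochner_integral_iff)
    have "norm (indicator {0..} t * ((\<beta> t)\<^sup>2 * exp (- (2 * \<nu> * t)))) \<le> norm ((9 / 4) * (if 0 < t then decay \<mu> t else 0))" if "t \<noteq> 0" for t
    proof (cases "0 < t")
      case True
      have "0 \<le> amp \<mu> t" "amp \<mu> t \<le> 3 / 2" using near[of t] by linarith+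
      then have "(amp \<mu> t)\<^sup>2 \<le> (3 / 2)\<^sup>2" by (rule power_mono[rotated])
      moreover have "(\<beta> t)\<^sup>2 * exp (- (2 * \<nu> * t)) = (amp \<mu> t)\<^sup>2 * decay \<mu> t"
      proof -
        have "(exp (- (real k * t)))\<^sup>2 * exp (- (2 * \<nu> * t)) = decay \<mu> t"
          by (simp add: exp_double[symmetric] exp_add[symmetric] \<mu> algebra_simps)
        then show ?thesis by (simp add: \<beta>_def power_mult_distrib mult_ac)
      qed
      ultimately show ?thesis using True by (simp add: power2_eq_square)
    qed (use that in simp)
    then show "AE t in lborel. norm (indicator {0..} t * ((\<beta> t)\<^sup>2 * exp (- (2 * \<nu> * t)))) \<le> norm ((9 / 4) * (if 0 < t then decay \<mu> t else 0))"
      by (intro AE_mp[OF AE_lborel_singleton[of "0::real"] AE_I2]) blast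
  qed (simp add: \<beta>_def)
  \<comment> \<open>\<open>regular_solution\<close> admits any profile of \<open>V\<close>; all of
    them give the same \<open>Q\<close> almost everywhere, so competing solutions satisfy one and
    the same equation.\<close>
  have profile: "AE t in lborel. 0 < t \<longrightarrow> exp (- (2 * t)) * q (exp (- t)) = Q t" if q: "radial_profile V q" for q
  proof -
    obtain v' where v' [measurable]: "v' \<in> borel_measurable borel" and Vv': "AE x in ball_measure. V x = v' (log_radius x)"
      and qv': "AE t in lborel. 0 < t \<longrightarrow> q (exp (- t)) = v' t" by (rule radial_profile_borel[OF V q])
    from Vv Vv' have "AE x in lebesgue_on (ball (0::'a) 1). v (log_radius x) = v' (log_radius x)" by eventually_elim simp
    then have "AE t in lborel. 0 < t \<longrightarrow> v t = v' t" by (subst (asm) AE_log_radius_borel) auto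
    with qv' show ?thesis by eventually_elim (simp add: Q_def log_density_def)
  qed
  show ?thesis unfolding p0[symmetric] dn_eigenvalue_def
  proof (rule the_equality)
    let ?b = "\<lambda>r. \<beta> (- ln r)"
    define q where "q r = v (- ln r)" for r
    have q: "radial_profile V q" unfolding radial_profile_def using Vv by eventually_elim (simp add: q_def log_radius_def)
    have "regular_solution V k ?b" unfolding regular_solution_def
    proof (intro conjI exI[of _ q] q allI impI)
      show "radial_solution DIM('a) q k ?b"
        by (rule log_solution_imp_radial_solution(1)[OF d \<nu>_def Q_borel profile[OF q] sol])
      show "?b 1 = 1" by (simp add: \<beta>_def amp_zero)
      fix Y :: "'a \<Rightarrow> real" assume "spherical_harmonic k Y"
      then show "integrable ball_measure (\<lambda>x. (?b (norm x) * Y (x /\<^sub>R norm x))\<^sup>2 * norm x powr (-2))"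
        by (intro L2_imp_harmonic_integrable[OF \<nu>_def _ c L2, where b = ?b]) auto
    qed
    moreover have "(?b has_real_derivative - p 0) (at 1 within {0<..1})"
      by (rule log_solution_imp_radial_solution(2)[OF d \<nu>_def Q_borel profile[OF q] sol])
    ultimately show "\<exists>b. regular_solution V k b \<and> (b has_real_derivative - p 0) (at 1 within {0<..1})" by blast
  next
    fix l assume "\<exists>b. regular_solution V k b \<and> (b has_real_derivative l) (at 1 within {0<..1})"
    then obtain b q where q: "radial_profile V q" and b: "radial_solution DIM('a) q k b" "b 1 = 1"
      and int: "\<And>Y :: 'a \<Rightarrow> real. spherical_harmonic k Y \<Longrightarrow>
        integrable ball_measure (\<lambda>x. (b (norm x) * Y (x /\<^sub>R norm x))\<^sup>2 * norm x powr (-2))"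
      and l: "(b has_real_derivative l) (at 1 within {0<..1})" unfolding regular_solution_def by blast
    obtain p' where p': "log_solution \<nu> ?K Q (\<lambda>t. b (exp (- t))) p'"
      and l': "(b has_real_derivative - p' 0) (at 1 within {0<..1})"
      by (rule radial_solution_imp_log_solution[OF d \<nu>_def Q_borel profile[OF q] b(1)])
    have L2': "integrable lborel (\<lambda>t. indicator {0..} t * ((b (exp (- t)))\<^sup>2 * exp (- (2 * \<nu> * t))))"
      by (rule harmonic_integrable_imp_L2[OF d \<nu>_def refl log_solution_continuous(1)[OF p'] int])
    have "0 < real k + \<nu>" using \<mu>R R_pos by (simp add: \<mu>)
    from log_solution_unique[OF p' sol[unfolded \<beta>_def[abs_def]] _ amp_zero near this L2']
    have "p' 0 = p 0" using b(2) by simp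
    moreover have "l = - p' 0"
    proof (rule has_field_derivative_unique[OF l l'])
      show "at (1::real) within {0<..1} \<noteq> bot"
      proof -
        have "{0<..1} - {1::real} = {0<..<1}" by auto
        then show ?thesis by (simp add: at_within_eq_bot_iff closure_greaterThanLessThan)
      qed
    qed
    ultimately show "l = - p 0" by simp
  qed
qed

section \<open>Stability\<close>

definition pair_kernel :: "(real \<Rightarrow> real \<Rightarrow> real) \<Rightarrow> (real \<Rightarrow> real \<Rightarrow> real) \<Rightarrow> real \<Rightarrow> real \<Rightarrow> real" where
  "pair_kernel N\<^sub>1 N\<^sub>2 t z = N\<^sub>1 t z + N\<^sub>2 t z + (LBINT y. N\<^sub>1 t y * N\<^sub>2 t (z - y))"

locale two_potentials = P1: log_potential Q1 R + P2: log_potential Q2 R for Q1 Q2 R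
begin

abbreviation "N1 \<equiv> P1.tkernel"
abbreviation "N2 \<equiv> P2.tkernel"
abbreviation "H \<equiv> pair_kernel N1 N2"

lemma pair_kernel_measurable [measurable]: "borel2 H" unfolding pair_kernel_def by measurable

lemma convolution_bound:
  "\<bar>LBINT y. N1 t y * N2 t (z - y)\<bar> \<le> (if 0 < z then 4 * R\<^sup>2 * z * exp (2 * R * z) else 0)"
proof (cases "0 < z")
  case True
  have le: "\<bar>N1 t y * N2 t (z - y)\<bar> \<le> indicator {0..z} y * (4 * R\<^sup>2 * exp (2 * R * z))" for y
  proof -
    have "\<bar>N1 t y * N2 t (z - y)\<bar> \<le> (2 * R * P1.env y) * (2 * R * P1.env (z - y))"
      unfolding abs_mult using P1.tkernel_bound P2.tkernel_bound P1.env_nonneg P1.R_pos by (intro mult_mono) auto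
    also have "\<dots> \<le> indicator {0..z} y * (4 * R\<^sup>2 * exp (2 * R * z))"
    proof (cases "0 < y \<and> y < z")
      case True
      have "exp (2 * R * y) * exp (2 * R * (z - y)) = exp (2 * R * z)" by (simp add: exp_add[symmetric] algebra_simps)
      moreover have "(2 * R * exp (2 * R * y)) * (2 * R * exp (2 * R * (z - y))) = 4 * R\<^sup>2 * (exp (2 * R * y) * exp (2 * R * (z - y)))"
        by (simp add: power2_eq_square)
      ultimately have "(2 * R * exp (2 * R * y)) * (2 * R * exp (2 * R * (z - y))) = 4 * R\<^sup>2 * exp (2 * R * z)"
        by (simp only:)
      then show ?thesis using True by (simp add: P1.env_def)
    qed (auto simp: P1.env_def)
    finally show ?thesis .
  qed
  have ind: "integrable lborel (\<lambda>y::real. indicator {0..z} y * (4 * R\<^sup>2 * exp (2 * R * z)))"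
    by (intro integrable_mult_left integrable_real_indicator) (use True in auto)
  have "\<bar>LBINT y. N1 t y * N2 t (z - y)\<bar> \<le> (LBINT y. indicator {0..z} y * (4 * R\<^sup>2 * exp (2 * R * z)))"
  proof (rule order_trans[OF integral_abs_bound], rule integral_mono_AE')
    show "AE y in lborel. \<bar>N1 t y * N2 t (z - y)\<bar> \<le> indicator {0..z} y * (4 * R\<^sup>2 * exp (2 * R * z))"
      using le by (rule AE_I2)
  qed (use ind in auto)
  also have "\<dots> = 4 * R\<^sup>2 * z * exp (2 * R * z)" using True by simp
  finally show ?thesis using True by simp
next
  case False
  have "N1 t y * N2 t (z - y) = 0" for y using P1.tkernel_bound[of t y] P2.tkernel_bound[of t "z - y"] False
    by (cases "0 < y") (auto simp: P1.env_def)
  then have "(\<lambda>y. N1 t y * N2 t (z - y)) = (\<lambda>_. 0)" by (rule ext)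
  then show ?thesis using False by (simp only: integral_zero) simp
qed

text \<open>The convolution in the pair kernel brings a polynomial factor, 4R (1 + R z) e^(2 R z) in
  total; 1 + R z <= e^(R z) absorbs it at the price of the rate 3R.\<close>

definition henv :: "real \<Rightarrow> real" where
  "henv z = (if 0 < z then 4 * R * exp (3 * R * z) else 0)"

lemma henv_measurable [measurable]: "henv \<in> borel_measurable borel" unfolding henv_def by measurable

lemma henv_nonneg: "0 \<le> henv z" using P1.R_pos by (simp add: henv_def)

lemma pair_kernel_bound: "\<bar>H t z\<bar> \<le> henv z"
proof -
  have "\<bar>H t z\<bar> \<le> 2 * R * P1.env z + 2 * R * P1.env z + (if 0 < z then 4 * R\<^sup>2 * z * exp (2 * R * z) else 0)"
    unfolding pair_kernel_def using P1.tkernel_bound[of t z] P2.tkernel_bound[of t z] convolution_bound[of t z] by linarith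
  also have "\<dots> \<le> henv z"
  proof (cases "0 < z")
    case True
    have "4 * R * exp (2 * R * z) * (1 + R * z) \<le> 4 * R * exp (2 * R * z) * exp (R * z)"
      using P1.R_pos by (intro mult_left_mono exp_ge_add_one_self) auto
    also have "\<dots> = 4 * R * exp (3 * R * z)" by (simp add: exp_add[symmetric] algebra_simps)
    finally show ?thesis using True by (simp add: P1.env_def henv_def algebra_simps power2_eq_square)
  qed (simp add: P1.env_def henv_def)
  finally show ?thesis .
qed

lemma has_integral_henv:
  assumes "3 * R < c"
  shows "has_bochner_integral lborel (\<lambda>z. henv z * exp (- (c * z))) (4 * R / (c - 3 * R))"
proof -
  have "has_bochner_integral lborel (\<lambda>z. 4 * R * (if 0 < z then exp (- ((c - 3 * R) * z)) else 0)) (4 * R * (exp (- ((c - 3 * R) * 0)) / (c - 3 * R)))"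
    by (intro has_bochner_integral_mult_right has_bochner_integral_exp_tail) (use assms in auto)
  moreover have "4 * R * (if 0 < z then exp (- ((c - 3 * R) * z)) else 0) = henv z * exp (- (c * z))" for z
    by (simp add: henv_def exp_add[symmetric] algebra_simps)
  ultimately show ?thesis by simp
qed

lemma pair_kernel_laplace:
  assumes \<mu>: "R < \<mu>"
  shows "1 + (LBINT z. H t z * decay \<mu> z) = P1.amp \<mu> t * P2.amp \<mu> t"
proof -
  define e where "e = (\<lambda>z. decay \<mu> z)"
  have e_add: "e z = e y * e (z - y)" for z y by (simp add: e_def exp_add[symmetric] algebra_simps)
  have [measurable]: "e \<in> borel_measurable borel" unfolding e_def by measurable
  have i1: "integrable lborel (\<lambda>z. N1 t z * e z)" and i2: "integrable lborel (\<lambda>z. N2 t z * e z)"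
    unfolding e_def by (rule P1.integrable_tkernel_laplace[OF \<mu>] P2.integrable_tkernel_laplace[OF \<mu>])+
  have le: "\<bar>N2 t z * e z\<bar> \<le> \<bar>N2 t z * e z\<bar>" for z by simp
  have m: "borel2 (\<lambda>y z. N2 t z * e z)" by measurable
  note sh = Fubini_shift[OF i1 integrable_abs[OF i2] m le]
  have eq: "(LBINT y. N1 t y * N2 t (z - y)) * e z = (LBINT y. N1 t y * e y * (N2 t (z - y) * e (z - y)))" for z
  proof -
    have "N1 t y * N2 t (z - y) * e z = N1 t y * e y * (N2 t (z - y) * e (z - y))" for y using e_add[of z y] by simp
    then show ?thesis by (simp only: integral_mult_left_zero[symmetric])
  qed
  have "(LBINT z. H t z * e z) = (LBINT z. N1 t z * e z + N2 t z * e z + (LBINT y. N1 t y * e y * (N2 t (z - y) * e (z - y))))"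
    unfolding pair_kernel_def distrib_right eq ..
  also have "\<dots> = (LBINT z. N1 t z * e z) + (LBINT z. N2 t z * e z) + (LBINT z. (LBINT y. N1 t y * e y * (N2 t (z - y) * e (z - y))))"
    using i1 i2 sh(2) by simp
  also have "(LBINT z. (LBINT y. N1 t y * e y * (N2 t (z - y) * e (z - y))))
      = (LBINT z. N1 t z * e z) * (LBINT z. N2 t z * e z)" using sh(1) by simp
  finally show ?thesis by (simp add: P1.amp_def P2.amp_def e_def algebra_simps)
qed

lemma Q_diff_integrable: "integrable lborel (\<lambda>s. Q1 s - Q2 s)" using P1.Q_int P2.Q_int by simp

lemma Q_diff_exp_integrable:
  assumes "0 \<le> c" shows "integrable lborel (\<lambda>s. (Q1 s - Q2 s) * exp (- (c * s)))"
proof (rule integrable_bound_lint[OF Q_diff_integrable])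
  have "norm ((Q1 s - Q2 s) * exp (- (c * s))) \<le> norm (Q1 s - Q2 s)" for s
    using P1.Q_supp[of s] P2.Q_supp[of s] assms by (cases "s \<le> 0") (auto simp: abs_mult intro!: mult_left_le)
  then show "AE s in lborel. norm ((Q1 s - Q2 s) * exp (- (c * s))) \<le> norm (Q1 s - Q2 s)" by simp
qed measurable

text \<open>Candidate for the difference of the Born approximations in logarithmic form, built from
  the potentials alone: \<open>born_diff_laplace\<close> computes its Laplace transform and
  \<open>weighted_stability\<close> identifies it with the actual difference.\<close>

definition born_diff :: "real \<Rightarrow> real" where
  "born_diff s = (Q1 s - Q2 s) + (LBINT t. (Q1 t - Q2 t) * H t (s - t))"

lemma born_diff_measurable [measurable]: "born_diff \<in> borel_measurable borel" unfolding born_diff_def by measurable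

lemma born_diff_supp:
  assumes "s \<le> 0" shows "born_diff s = 0"
proof -
  have "(\<lambda>t. (Q1 t - Q2 t) * H t (s - t)) = (\<lambda>_. 0)"
  proof
    fix t show "(Q1 t - Q2 t) * H t (s - t) = 0" using P1.Q_supp[of t] P2.Q_supp[of t] pair_kernel_bound[of t "s - t"] assms
      by (cases "t \<le> 0") (auto simp: henv_def)
  qed
  then show ?thesis using P1.Q_supp[OF assms] P2.Q_supp[OF assms] by (simp add: born_diff_def)
qed

text \<open>As \<open>decay\<close> is multiplicative, the Volterra term transforms like a
  convolution and replaces the factor 1 by 1 plus the transform of \<open>H\<close>, which is m1 m2
  by \<open>pair_kernel_laplace\<close>; then \<open>amp_exchange\<close> applies. The condition 3R
  < 2 \<mu> makes \<open>henv\<close> integrable against \<open>decay \<mu>\<close>.\<close>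

lemma born_diff_laplace:
  assumes \<mu>: "3 * R < 2 * \<mu>" "R < \<mu>"
  shows "integrable lborel (\<lambda>s. born_diff s * decay \<mu> s)"
    and "(LBINT s. born_diff s * decay \<mu> s)
      = (LBINT s. Q1 s * P1.amp \<mu> s * decay \<mu> s) - (LBINT s. Q2 s * P2.amp \<mu> s * decay \<mu> s)"
proof -
  define e where "e = (\<lambda>z. decay \<mu> z)"
  have e_add: "e z = e y * e (z - y)" for z y by (simp add: e_def exp_add[symmetric] algebra_simps)
  have [measurable]: "e \<in> borel_measurable borel" unfolding e_def by measurable
  let ?D = "\<lambda>s. Q1 s - Q2 s"
  have D: "integrable lborel (\<lambda>s. ?D s * e s)" using Q_diff_exp_integrable[of "2 * \<mu>"] \<mu> P1.R_pos by (simp add: e_def)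
  have G: "\<bar>H t z * e z\<bar> \<le> henv z * e z" for t z
    using mult_right_mono[OF pair_kernel_bound[of t z], of "e z"] by (simp add: abs_mult e_def)
  have hi: "integrable lborel (\<lambda>z. henv z * e z)"
    using has_integral_henv[OF \<mu>(1)] by (auto simp: e_def has_bochner_integral_iff)
  have m: "borel2 (\<lambda>t z. H t z * e z)" by measurable
  note sh = Fubini_shift[OF D hi m G]
  have eq: "born_diff s * e s = ?D s * e s + (LBINT t. ?D t * e t * (H t (s - t) * e (s - t)))" for s
  proof -
    have "?D t * H t (s - t) * e s = ?D t * e t * (H t (s - t) * e (s - t))" for t using e_add[of s t] by simp
    then show ?thesis by (simp only: born_diff_def distrib_right integral_mult_left_zero[symmetric])
  qed
  show "integrable lborel (\<lambda>s. born_diff s * decay \<mu> s)"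
  proof -
    have "integrable lborel (\<lambda>s. born_diff s * e s)" unfolding eq by (rule Bochner_Integration.integrable_add[OF D sh(2)])
    then show ?thesis by (simp add: e_def)
  qed
  have "(LBINT s. born_diff s * e s) = (LBINT s. ?D s * e s) + (LBINT t. ?D t * e t * (LBINT z. H t z * e z))"
    unfolding eq using D sh(1,2) by simp
  also have "\<dots> = (LBINT t. ?D t * e t + ?D t * e t * (LBINT z. H t z * e z))"
    by (rule Bochner_Integration.integral_add[symmetric, OF D Fubini_dominated(2)[OF D hi m G]])
  also have "\<dots> = (LBINT t. ?D t * (P1.amp \<mu> t * P2.amp \<mu> t * e t))"
    unfolding pair_kernel_laplace[OF \<mu>(2), symmetric] e_def by (simp add: algebra_simps)
  also have "\<dots> = (LBINT s. Q1 s * P1.amp \<mu> s * decay \<mu> s) - (LBINT s. Q2 s * P2.amp \<mu> s * decay \<mu> s)" unfolding e_def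
    by (rule amp_exchange[OF P1.log_potential_axioms P2.log_potential_axioms \<mu>(2), symmetric])
  finally show "(LBINT s. born_diff s * decay \<mu> s)
      = (LBINT s. Q1 s * P1.amp \<mu> s * decay \<mu> s) - (LBINT s. Q2 s * P2.amp \<mu> s * decay \<mu> s)" by (simp add: e_def)
qed

text \<open>Moments identify \<open>A\<close> with \<open>born_diff\<close>, so D is
  \<open>A\<close> minus a Volterra term of weighted norm at most 4R / (w - 3R) times that of D. For
  w >= 11R this factor is at most 1/2, and absorption produces the constant 2; it is legitimate
  because the weighted norm of D is finite (\<open>Q_diff_exp_integrable\<close>).\<close>

lemma weighted_stability:
  assumes A [measurable]: "A \<in> borel_measurable borel" and A0: "\<And>s. s \<le> 0 \<Longrightarrow> A s = 0"
    and w: "11 * R \<le> w" and Aw: "integrable lborel (\<lambda>s. \<bar>A s\<bar> * exp (- (w * s)))"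
    and mom: "\<forall>\<^sub>F k in sequentially. (LBINT s. A s * exp (- (2 * (real k + \<nu>) * s)))
      = (LBINT s. Q1 s * P1.amp (real k + \<nu>) s * exp (- (2 * (real k + \<nu>) * s)))
        - (LBINT s. Q2 s * P2.amp (real k + \<nu>) s * exp (- (2 * (real k + \<nu>) * s)))"
    and \<nu>: "0 \<le> \<nu>"
  shows "(LBINT s. \<bar>Q1 s - Q2 s\<bar> * exp (- (w * s))) \<le> 2 * (LBINT s. \<bar>A s\<bar> * exp (- (w * s)))"
proof -
  obtain k1 where k1: "\<And>k. k \<ge> k1 \<Longrightarrow> (LBINT s. A s * exp (- (2 * (real k + \<nu>) * s)))
      = (LBINT s. Q1 s * P1.amp (real k + \<nu>) s * exp (- (2 * (real k + \<nu>) * s)))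
        - (LBINT s. Q2 s * P2.amp (real k + \<nu>) s * exp (- (2 * (real k + \<nu>) * s)))"
    using mom unfolding eventually_sequentially by blast
  \<comment> \<open>From k2 on, 2 \<mu> exceeds w, so \<open>A\<close> is integrable against
    \<open>decay \<mu>\<close>. Raising the index from k0 to k0 + n multiplies the weight by (e^(-2
    s))^n, the form required by \<open>moments_zero_imp_AE_zero\<close>.\<close>
  obtain k2 :: nat where k2: "w < real k2" using reals_Archimedean2 by blast
  define k0 where "k0 = max k1 k2"
  define \<mu> where "\<mu> n = real (k0 + n) + \<nu>" for n
  have \<mu>w: "w \<le> \<mu> n" for n using k2 \<nu> by (simp add: \<mu>_def k0_def)
  have \<mu>R: "3 * R < 2 * \<mu> n" "R < \<mu> n" "w \<le> 2 * \<mu> n" for n using \<mu>w[of n] w P1.R_pos by auto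
  have Ai: "integrable lborel (\<lambda>s. A s * exp (- (2 * \<mu> n * s)))" for n
  proof (rule integrable_dominated[OF Aw])
    show "norm (A s * exp (- (2 * \<mu> n * s))) \<le> norm (\<bar>A s\<bar> * exp (- (w * s)))" for s
    proof (cases "s \<le> 0")
      case False
      then have "w * s \<le> 2 * \<mu> n * s" using \<mu>R(3)[of n] by (intro mult_right_mono) auto
      then show ?thesis by (auto simp: abs_mult intro!: mult_left_mono)
    qed (simp add: A0)
  qed measurable
  define f where "f s = (born_diff s - A s) * exp (- (2 * \<mu> 0 * s))" for s
  have fn: "f s * exp (- (2 * s)) ^ n = born_diff s * exp (- (2 * \<mu> n * s)) - A s * exp (- (2 * \<mu> n * s))" for s n
  proof -
    have "exp (- (2 * \<mu> 0 * s)) * exp (- (2 * s)) ^ n = exp (- (2 * \<mu> n * s))"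
      by (simp add: \<mu>_def exp_of_nat_mult[symmetric] exp_add[symmetric] algebra_simps)
    then show ?thesis by (simp add: f_def algebra_simps)
  qed
  have "AE s in lborel. f s = 0"
  proof (rule moments_zero_imp_AE_zero)
    show "integrable lborel f"
      unfolding f_def[abs_def] left_diff_distrib using Bochner_Integration.integrable_diff[OF born_diff_laplace(1)[OF \<mu>R(1,2)] Ai, of 0 0] by simp
    show "f s = 0" if "s \<le> 0" for s using that by (simp add: f_def born_diff_supp A0)
    show "(LBINT s. f s * exp (- (2 * s)) ^ n) = 0" for n
    proof -
      have "k1 \<le> k0 + n" by (simp add: k0_def)
      from k1[OF this] show ?thesis unfolding fn using born_diff_laplace[OF \<mu>R(1,2), of n] Ai[of n] by (simp add: \<mu>_def)
    qed
  qed
  then have AE_eq: "AE s in lborel. born_diff s = A s" by eventually_elim (simp add: f_def)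
  define e where "e = (\<lambda>z. exp (- (w * z)))"
  have e_add: "e z = e y * e (z - y)" for z y by (simp add: e_def exp_add[symmetric] algebra_simps)
  have e0: "0 < e z" for z by (simp add: e_def)
  have [measurable]: "e \<in> borel_measurable borel" unfolding e_def by measurable
  let ?D = "\<lambda>s. Q1 s - Q2 s"
  have w0: "0 \<le> w" "3 * R < w" using w P1.R_pos by auto
  have D: "integrable lborel (\<lambda>s. \<bar>?D s\<bar> * e s)"
    using integrable_abs[OF Q_diff_exp_integrable[OF w0(1)]] by (simp add: abs_mult e_def)
  have hi: "integrable lborel (\<lambda>z. henv z * e z)"
    using has_integral_henv[OF w0(2)] by (auto simp: e_def has_bochner_integral_iff)
  have m: "borel2 (\<lambda>(t::real) z. henv z * e z)" by measurable
  have G: "\<bar>henv z * e z\<bar> \<le> henv z * e z" for z using henv_nonneg[of z] e0[of z] by simp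
  note sh = Fubini_shift[OF D hi m G]
  let ?J = "\<lambda>s. LBINT t. \<bar>?D t\<bar> * e t * (henv (s - t) * e (s - t))"
  \<comment> \<open>Besides the identity for \<open>A\<close>, \<open>sh(3)\<close> enters here: it
    makes the majorant inside \<open>?J s\<close> integrable in t for almost every s.\<close>
  have "AE s in lborel. \<bar>?D s\<bar> * e s \<le> \<bar>A s\<bar> * e s + ?J s" using AE_eq sh(3)
  proof eventually_elim
    case (elim s)
    have "?D s = A s - (LBINT t. ?D t * H t (s - t))" using elim(1) by (simp add: born_diff_def)
    then have "\<bar>?D s\<bar> * e s \<le> \<bar>A s\<bar> * e s + \<bar>LBINT t. ?D t * H t (s - t)\<bar> * e s"
      using e0[of s] by (simp add: distrib_right[symmetric] abs_triangle_ineq4)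
    also have "\<bar>LBINT t. ?D t * H t (s - t)\<bar> * e s = \<bar>LBINT t. ?D t * e t * (H t (s - t) * e (s - t))\<bar>"
    proof -
      have "?D t * H t (s - t) * e s = ?D t * e t * (H t (s - t) * e (s - t))" for t using e_add[of s t] by simp
      then have "(LBINT t. ?D t * e t * (H t (s - t) * e (s - t))) = (LBINT t. ?D t * H t (s - t)) * e s"
        by (simp only: integral_mult_left_zero[symmetric])
      then show ?thesis using e0[of s] by (simp add: abs_mult)
    qed
    also have "\<dots> \<le> (LBINT t. \<bar>?D t * e t * (H t (s - t) * e (s - t))\<bar>)" by (rule integral_abs_bound)
    also have "\<dots> \<le> ?J s"
    proof (rule integral_mono_AE')
      show "integrable lborel (\<lambda>t. \<bar>?D t\<bar> * e t * (henv (s - t) * e (s - t)))" using elim(2) by simp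
      show "AE t in lborel. \<bar>?D t * e t * (H t (s - t) * e (s - t))\<bar> \<le> \<bar>?D t\<bar> * e t * (henv (s - t) * e (s - t))"
      proof (rule AE_I2)
        fix t
        show "\<bar>?D t * e t * (H t (s - t) * e (s - t))\<bar> \<le> \<bar>?D t\<bar> * e t * (henv (s - t) * e (s - t))"
          using pair_kernel_bound[of t "s - t"] e0[of t] e0[of "s - t"]
          by (simp add: abs_mult mult_left_mono mult_right_mono)
      qed
    qed (use e0 henv_nonneg in \<open>auto intro!: AE_I2 mult_nonneg_nonneg simp: less_imp_le\<close>)
    finally show ?case by simp
  qed
  then have "(LBINT s. \<bar>?D s\<bar> * e s) \<le> (LBINT s. \<bar>A s\<bar> * e s + ?J s)"
    using D Aw sh(2) by (intro integral_mono_AE) (auto simp: e_def)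
  also have "\<dots> = (LBINT s. \<bar>A s\<bar> * e s) + (LBINT s. ?J s)"
    using Aw sh(2) by (intro Bochner_Integration.integral_add) (auto simp: e_def)
  also have "(LBINT s. ?J s) = (LBINT s. \<bar>?D s\<bar> * e s) * (4 * R / (w - 3 * R))"
    using sh(1) has_integral_henv[OF w0(2)] by (simp add: e_def has_bochner_integral_iff)
  also have "\<dots> \<le> (LBINT s. \<bar>?D s\<bar> * e s) * (1 / 2)"
    using w P1.R_pos e0 by (intro mult_left_mono Bochner_Integration.integral_nonneg) (auto simp: divide_le_eq less_imp_le)
  finally show ?thesis by (simp add: e_def)
qed

end

section \<open>Transfer of the hypotheses from the unit ball to the half line\<close>

lemma radial_transfer:
  fixes f :: "'a::euclidean_space \<Rightarrow> real" and h :: "real \<Rightarrow> real"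
  assumes f: "f \<in> borel_measurable ball_measure" and h [measurable]: "h \<in> borel_measurable borel"
    and ae: "AE x in ball_measure. x \<noteq> 0 \<longrightarrow> f x = h (log_radius x)"
  shows "integrable ball_measure f \<longleftrightarrow> integrable lborel (\<lambda>t. radial_weight TYPE('a) t * h t)"
    and "(LINT x|ball_measure. f x) = (LBINT t. radial_weight TYPE('a) t * h t)"
proof -
  have "AE x in lebesgue_on (ball (0::'a) 1). x \<noteq> 0"
    unfolding AE_ball_iff by (rule AE_mp[OF AE_lborel_singleton[of "0::'a"]], rule AE_I2) simp
  with ae have ae': "AE x in ball_measure. f x = h (log_radius x)" by eventually_elim simp
  have hm: "(\<lambda>x::'a. h (log_radius x)) \<in> borel_measurable ball_measure" by (rule borel_imp_lebesgue_on_ball) measurable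
  show "integrable ball_measure f \<longleftrightarrow> integrable lborel (\<lambda>t. radial_weight TYPE('a) t * h t)"
    using integrable_cong_AE[OF f hm ae'] radial_integral(1)[OF h, where 'a = 'a] by simp
  show "(LINT x|ball_measure. f x) = (LBINT t. radial_weight TYPE('a) t * h t)"
    using integral_cong_AE[OF f hm ae'] radial_integral(2)[OF h, where 'a = 'a] by simp
qed

text \<open>Young's inequality for |Q| e^(c t) = x y with x = |v| e^(-d t / p) and y = e^(-c t). The
  p-th power of x is the radial density of |V|^p, and y is integrable because p > d/2 makes c
  positive. The available decay is 2 - d/p = 2c: one half becomes the weight e^(c t), the other half
  pays for y.\<close>

lemma Lp_log_profile_bound:
  fixes V :: "'a::euclidean_space \<Rightarrow> real" and p L :: real
  assumes p: "1 < p" "real DIM('a) / 2 < p" and V: "V \<in> Lp_rad p" and L: "Lp_norm p V < L"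
  defines "c \<equiv> 1 - real DIM('a) / (2 * p)"
    and "S \<equiv> sphere_measure (sphere 0 1 :: 'a set)"
  obtains v where "v \<in> borel_measurable borel" "AE x in ball_measure. V x = v (log_radius x)"
    "integrable lborel (\<lambda>t. \<bar>log_density v t\<bar> * exp (c * t))"
    "(LBINT t. \<bar>log_density v t\<bar> * exp (c * t)) \<le> L powr p / S + 1 / c"
proof -
  let ?d = "real DIM('a)"
  have S: "0 < S" unfolding S_def by (rule sphere_measure_pos)
  have c: "0 < c" using p by (simp add: c_def field_simps)
  have Vm: "V \<in> borel_measurable ball_measure"
    and Vi: "integrable ball_measure (\<lambda>x. \<bar>V x\<bar> powr p)" and Vr: "radial V" using V by (auto simp: Lp_rad_def)
  obtain q where q: "radial_profile V q" using Vr unfolding radial_def by blast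
  obtain v where v [measurable]: "v \<in> borel_measurable borel" and Vv: "AE x in ball_measure. V x = v (log_radius x)"
    by (rule radial_profile_borel[OF Vm q])
  let ?I = "LINT x|ball_measure. \<bar>V x\<bar> powr p"
  define g where "g t = (if 0 < t then \<bar>v t\<bar> powr p * exp (- (?d * t)) else 0)" for t
  have rw: "radial_weight TYPE('a) t * \<bar>v t\<bar> powr p = S * g t" for t by (simp add: radial_weight_def S_def g_def)
  have fm: "(\<lambda>x. \<bar>V x\<bar> powr p) \<in> borel_measurable ball_measure" using Vm by measurable
  have hm: "(\<lambda>t. \<bar>v t\<bar> powr p) \<in> borel_measurable borel" by measurable
  have ae: "AE x in ball_measure. x \<noteq> 0 \<longrightarrow> \<bar>V x\<bar> powr p = \<bar>v (log_radius x)\<bar> powr p" using Vv by eventually_elim simp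
  note tr = radial_transfer[OF fm hm ae, unfolded rw]
  have gi: "integrable lborel g" using tr(1) Vi S by simp
  have gI: "(LBINT t. g t) = ?I / S" using tr(2) S by simp
  have I0: "0 \<le> ?I" by simp
  have IL: "?I \<le> L powr p"
  proof -
    have "(?I powr (1 / p)) powr p < L powr p" using L p by (intro powr_less_mono2) (auto simp: Lp_norm_def)
    then show ?thesis using p I0 by (simp add: powr_powr)
  qed
  let ?Q = "log_density v"
  let ?b = "\<lambda>t. if 0 < t then exp (- (c * t)) else 0"
  have bi: "has_bochner_integral lborel ?b (1 / c)" using has_bochner_integral_exp_tail[OF c, of 0] by simp
  have le: "\<bar>?Q t\<bar> * exp (c * t) \<le> g t + ?b t" for t
  proof (cases "0 < t")
    case True
    define r where "r = p / (p - 1)"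
    have r: "1 < r" using p by (simp add: r_def)
    have pr: "1 / p + 1 / r = 1" using p by (simp add: r_def field_simps)
    define x where "x = \<bar>v t\<bar> * exp (- (?d * t / p))"
    define y where "y = exp (- (c * t))"
    have "\<bar>?Q t\<bar> * exp (c * t) = x * y"
    proof -
      have "exp (- (2 * t)) * exp (c * t) = exp (- (?d * t / p)) * exp (- (c * t))"
        using p by (simp add: exp_add[symmetric] c_def field_simps)
      then show ?thesis using True by (simp add: x_def y_def log_density_def abs_mult mult_ac)
    qed
    also have "\<dots> \<le> x powr p / p + y powr r / r" by (rule Youngs_inequality[OF p(1) r pr]) (auto simp: x_def y_def)
    also have "\<dots> \<le> x powr p + y powr r" using p r by (intro add_mono) (auto simp: divide_le_eq mult_le_cancel_left1)
    also have "x powr p = g t" using True p by (simp add: x_def g_def powr_mult exp_powr_real)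
    also have "y powr r \<le> y"
    proof -
      have "c * t * 1 \<le> c * t * r" using c True r by (intro mult_left_mono) auto
      then show ?thesis by (simp add: y_def exp_powr_real)
    qed
    finally show ?thesis using True by (simp add: y_def)
  qed (simp add: g_def log_density_def)
  have sum: "integrable lborel (\<lambda>t. g t + ?b t)" using gi bi by (auto simp: has_bochner_integral_iff)
  have Qi: "integrable lborel (\<lambda>t. \<bar>?Q t\<bar> * exp (c * t))"
  proof (rule integrable_bound_lint[OF sum])
    show "AE t in lborel. norm (\<bar>?Q t\<bar> * exp (c * t)) \<le> norm (g t + ?b t)"
    proof (rule AE_I2)
      fix t
      have "norm (\<bar>?Q t\<bar> * exp (c * t)) = \<bar>?Q t\<bar> * exp (c * t)" by (simp add: abs_mult)
      also have "\<dots> \<le> norm (g t + ?b t)" unfolding real_norm_def by (rule order_trans[OF le abs_ge_self])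
      finally show "norm (\<bar>?Q t\<bar> * exp (c * t)) \<le> norm (g t + ?b t)" .
    qed
  qed measurable
  have "(LBINT t. \<bar>?Q t\<bar> * exp (c * t)) \<le> (LBINT t. g t + ?b t)" by (rule integral_mono[OF Qi sum le])
  also have "\<dots> = ?I / S + 1 / c" using gi bi gI by (auto simp: has_bochner_integral_iff)
  also have "\<dots> \<le> L powr p / S + 1 / c" using IL S by (simp add: divide_right_mono)
  finally show ?thesis by (rule that[OF v Vv Qi])
qed

text \<open>In the logarithmic variable |x|^(2k) dx carries e^(-(2k + d) t); the factor e^(-2 t)
  goes into \<open>log_density\<close>, which leaves the exponent 2 (k + \<nu>) used for the
  eigenvalues.\<close>

lemma born_log_profile:
  fixes V B :: "'a::euclidean_space \<Rightarrow> real"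
  assumes B: "born_approximation V B"
  defines "\<nu> \<equiv> (real DIM('a) - 2) / 2"
  obtains u where "u \<in> borel_measurable borel" "B \<in> borel_measurable ball_measure"
    "AE x in ball_measure. B x = u (log_radius x)"
    "\<forall>\<^sub>F k in sequentially.
      integrable lborel (\<lambda>t. log_density u t * exp (- (2 * (real k + \<nu>) * t))) \<and>
      (LBINT t. log_density u t * exp (- (2 * (real k + \<nu>) * t))) = dn_eigenvalue V k - real k"
proof -
  let ?d = "real DIM('a)" and ?S = "sphere_measure (sphere 0 1 :: 'a set)"
  obtain \<sigma> q where \<sigma>: "0 < \<sigma>" and Bi: "integrable ball_measure (\<lambda>x. B x * norm x powr (2 * \<sigma>))"
    and q: "radial_profile B q"
    and ev: "\<forall>\<^sub>F k in sequentially. 1 / ?S * (LINT x|ball_measure. B x * norm x ^ (2 * k)) = dn_eigenvalue V k - real k"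
    using B unfolding born_approximation_def radial_def by blast
  have nm [measurable]: "(\<lambda>x::'a. norm x powr s) \<in> borel_measurable ball_measure" for s
    by (rule borel_imp_lebesgue_on_ball) measurable
  have im: "(\<lambda>x::'a. indicator {0} x * B 0) \<in> borel_measurable ball_measure" by (rule borel_imp_lebesgue_on_ball) measurable
  have [measurable]: "(\<lambda>x. B x * norm x powr (2 * \<sigma>)) \<in> borel_measurable ball_measure" using Bi by auto
  \<comment> \<open>Measurability of \<open>B\<close> is available only through the weighted
    function. Since 0 powr s is 0, undoing the weight loses the value at the origin, which the
    indicator term restores.\<close>
  have "(\<lambda>x. B x * norm x powr (2 * \<sigma>) * norm x powr (- (2 * \<sigma>)) + indicator {0} x * B 0) \<in> borel_measurable ball_measure"
    using im by measurable
  also have "(\<lambda>x. B x * norm x powr (2 * \<sigma>) * norm x powr (- (2 * \<sigma>)) + indicator {0} x * B 0) = B"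
  proof
    fix x show "B x * norm x powr (2 * \<sigma>) * norm x powr (- (2 * \<sigma>)) + indicator {0} x * B 0 = B x"
      by (cases "x = 0") (simp_all add: mult.assoc powr_add[symmetric])
  qed
  finally have Bm [measurable]: "B \<in> borel_measurable ball_measure" .
  obtain u where u [measurable]: "u \<in> borel_measurable borel" and Bu: "AE x in ball_measure. B x = u (log_radius x)"
    by (rule radial_profile_borel[OF Bm q])
  let ?A = "log_density u"
  have rw: "radial_weight TYPE('a) t * (u t * exp (- (s * t))) = ?S * (?A t * exp (- ((s + 2 * \<nu>) * t)))" for s t
  proof -
    have "exp (- (?d * t)) * exp (- (s * t)) = exp (- (2 * t)) * exp (- ((s + 2 * \<nu>) * t))"
      by (simp add: exp_add[symmetric] \<nu>_def field_simps)
    then show ?thesis by (simp add: radial_weight_def log_density_def)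
  qed
  have hm: "(\<lambda>t. u t * exp (- (s * t))) \<in> borel_measurable borel" for s by measurable
  have Ai: "integrable lborel (\<lambda>t. ?A t * exp (- ((2 * \<sigma> + 2 * \<nu>) * t)))"
  proof -
    have fm: "(\<lambda>x. B x * norm x powr (2 * \<sigma>)) \<in> borel_measurable ball_measure" by measurable
    have ae: "AE x in ball_measure. x \<noteq> 0 \<longrightarrow> B x * norm x powr (2 * \<sigma>) = u (log_radius x) * exp (- (2 * \<sigma> * log_radius x))"
      using Bu by eventually_elim (simp add: powr_def log_radius_def)
    show ?thesis using radial_transfer(1)[OF fm hm ae] Bi sphere_measure_pos[where 'a = 'a] unfolding rw by simp
  qed
  have Ak: "integrable lborel (\<lambda>t. ?A t * exp (- (2 * (real k + \<nu>) * t)))" if "\<sigma> \<le> real k" for k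
  proof (rule integrable_dominated[OF Ai])
    show "norm (?A t * exp (- (2 * (real k + \<nu>) * t))) \<le> norm (?A t * exp (- ((2 * \<sigma> + 2 * \<nu>) * t)))" for t
    proof (cases "0 < t")
      case True
      then have "(2 * \<sigma> + 2 * \<nu>) * t \<le> (2 * (real k + \<nu>)) * t" using that by (intro mult_right_mono) auto
      then show ?thesis unfolding norm_mult by (intro mult_left_mono) auto
    qed (simp add: log_density_zero)
  qed measurable
  have LB: "1 / ?S * (LINT x|ball_measure. B x * norm x ^ (2 * k)) = (LBINT t. ?A t * exp (- (2 * (real k + \<nu>) * t)))" for k
  proof -
    have fm: "(\<lambda>x. B x * norm x ^ (2 * k)) \<in> borel_measurable ball_measure"
      by (intro borel_measurable_times Bm borel_imp_lebesgue_on_ball) measurable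
    have pw: "norm x ^ (2 * k) = exp (- (2 * real k * log_radius x))" if "x \<noteq> 0" for x :: 'a
    proof -
      have "norm x ^ (2 * k) = exp (- log_radius x) ^ (2 * k)" using that by (simp add: exp_log_radius)
      also have "\<dots> = exp (- (2 * real k * log_radius x))" by (simp add: exp_of_nat_mult[symmetric])
      finally show ?thesis .
    qed
    have ae: "AE x in ball_measure. x \<noteq> 0 \<longrightarrow> B x * norm x ^ (2 * k) = u (log_radius x) * exp (- (2 * real k * log_radius x))"
      using Bu by eventually_elim (simp add: pw)
    have "2 * real k + 2 * \<nu> = 2 * (real k + \<nu>)" by simp
    then show ?thesis using radial_transfer(2)[OF fm hm ae] sphere_measure_pos[where 'a = 'a] unfolding rw by simp
  qed
  have "\<forall>\<^sub>F k in sequentially. \<sigma> \<le> real k" using filterlim_real_sequentially unfolding filterlim_at_top by blast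
  with ev have "\<forall>\<^sub>F k in sequentially. integrable lborel (\<lambda>t. ?A t * exp (- (2 * (real k + \<nu>) * t))) \<and>
      (LBINT t. ?A t * exp (- (2 * (real k + \<nu>) * t))) = dn_eigenvalue V k - real k" by eventually_elim (use Ak LB in simp)
  then show ?thesis by (rule that[OF u Bm Bu])
qed

text \<open>Split at a threshold T: e^(w T) times the low norm covers t <= T, and e^(-c T) times the
  high norm covers t >= T. Balancing the two powers gives the exponent c / (w + c).\<close>

lemma exponential_interpolation:
  fixes D :: "real \<Rightarrow> real"
  assumes D [measurable]: "D \<in> borel_measurable borel" and D0: "\<And>t. t \<le> 0 \<Longrightarrow> D t = 0"
    and wc: "0 < w" "0 < c" and \<delta>: "0 \<le> \<delta>"
    and low: "(LBINT t. \<bar>D t\<bar> * exp (- (w * t))) \<le> a * \<delta>"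
    and int: "integrable lborel (\<lambda>t. \<bar>D t\<bar> * exp (c * t))"
    and high: "(LBINT t. \<bar>D t\<bar> * exp (c * t)) \<le> b"
  shows "(LBINT t. \<bar>D t\<bar>) \<le> (a + b) * \<delta> powr (c / (w + c))"
proof -
  have i: "integrable lborel (\<lambda>t. \<bar>D t\<bar> * exp (s * t))" if "s \<le> c" for s
  proof (rule integrable_dominated[OF int])
    show "norm (\<bar>D t\<bar> * exp (s * t)) \<le> norm (\<bar>D t\<bar> * exp (c * t))" for t
    proof (cases "t \<le> 0")
      case False
      then show ?thesis using that by (auto intro!: mult_left_mono mult_right_mono)
    qed (simp add: D0)
  qed measurable
  have iw: "integrable lborel (\<lambda>t. \<bar>D t\<bar> * exp (- (w * t)))" using i[of "- w"] wc by simp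
  have i0: "integrable lborel (\<lambda>t. \<bar>D t\<bar>)" using i[of 0] wc by simp
  have split: "(LBINT t. \<bar>D t\<bar>) \<le> exp (w * T) * (a * \<delta>) + exp (- (c * T)) * b" for T
  proof -
    have "(LBINT t. \<bar>D t\<bar>) \<le> (LBINT t. exp (w * T) * (\<bar>D t\<bar> * exp (- (w * t))) + exp (- (c * T)) * (\<bar>D t\<bar> * exp (c * t)))"
    proof (rule integral_mono[OF i0])
      show "integrable lborel (\<lambda>t. exp (w * T) * (\<bar>D t\<bar> * exp (- (w * t))) + exp (- (c * T)) * (\<bar>D t\<bar> * exp (c * t)))"
        using iw int by simp
      fix t
      have "1 \<le> exp (w * (T - t)) + exp (c * (t - T))"
        using wc by (cases "t \<le> T") (auto intro: add_increasing add_increasing2)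
      from mult_left_mono[OF this, of "\<bar>D t\<bar>"]
      show "\<bar>D t\<bar> \<le> exp (w * T) * (\<bar>D t\<bar> * exp (- (w * t))) + exp (- (c * T)) * (\<bar>D t\<bar> * exp (c * t))"
        by (simp add: right_diff_distrib exp_diff exp_minus field_simps)
    qed
    also have "\<dots> = exp (w * T) * (LBINT t. \<bar>D t\<bar> * exp (- (w * t))) + exp (- (c * T)) * (LBINT t. \<bar>D t\<bar> * exp (c * t))"
      using iw int by simp
    also have "\<dots> \<le> exp (w * T) * (a * \<delta>) + exp (- (c * T)) * b" by (intro add_mono mult_left_mono low high) auto
    finally show ?thesis .
  qed
  show ?thesis
  \<comment> \<open>For \<delta> = 0 the balancing T would be infinite: the low term vanishes for
    every T, and T tends to infinity.\<close>
  proof (cases "\<delta> = 0")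
    case True
    have "((\<lambda>T. exp (- (c * T)) * b) \<longlongrightarrow> 0 * b) at_top"
    proof (intro tendsto_mult tendsto_const)
      have "filterlim (\<lambda>T. - (c * T)) at_bot at_top"
        using filterlim_tendsto_pos_mult_at_top[OF tendsto_const wc(2) filterlim_ident]
        by (simp add: filterlim_uminus_at_bot)
      then show "((\<lambda>T. exp (- (c * T))) \<longlongrightarrow> 0) at_top" by (rule filterlim_compose[OF exp_at_bot])
    qed
    from tendsto_lowerbound[OF this, of "LBINT t. \<bar>D t\<bar>"] split True show ?thesis by simp
  next
    case False
    \<comment> \<open>With this T, both e^(w T) \<delta> and e^(-c T) equal \<delta>^(c / (w +
      c)).\<close>
    define T where "T = - ln \<delta> / (w + c)"
    have \<delta>p: "0 < \<delta>" using False \<delta> by simp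
    have 1: "exp (w * T) * \<delta> = \<delta> powr (c / (w + c))"
    proof -
      have "w * T + ln \<delta> = c / (w + c) * ln \<delta>" using wc by (simp add: T_def field_simps)
      then have "exp (w * T) * exp (ln \<delta>) = exp (c / (w + c) * ln \<delta>)" by (simp only: exp_add[symmetric])
      then show ?thesis using \<delta>p by (simp add: powr_def)
    qed
    have 2: "exp (- (c * T)) = \<delta> powr (c / (w + c))" using \<delta>p by (simp add: T_def powr_def)
    have "exp (w * T) * (a * \<delta>) + exp (- (c * T)) * b = a * (exp (w * T) * \<delta>) + exp (- (c * T)) * b" by simp
    also have "\<dots> = (a + b) * \<delta> powr (c / (w + c))" unfolding 1 2 by (simp add: distrib_right mult.commute)
    finally show ?thesis using split[of T] by simp
  qed
qed

theorem theorem4: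
  fixes p M :: real
  assumes "DIM('a::euclidean_space) \<ge> 2"
    and "real DIM('a) / 2 < p"
    and "M > real DIM('a) - 1"
  shows "\<exists>C \<alpha>. C > 0 \<and> 0 < \<alpha> \<and> \<alpha> < 1 \<and>
    (\<forall>(V1 :: 'a \<Rightarrow> real) V2 B1 B2.
       V1 \<in> Lp_rad p \<longrightarrow> V2 \<in> Lp_rad p \<longrightarrow>
       born_approximation V1 B1 \<longrightarrow> born_approximation V2 B2 \<longrightarrow>
       max (Lp_norm p V1) (Lp_norm p V2)
         < sphere_measure (sphere 0 1 :: 'a set) powr (1 / p) / 4
             * ((p - real DIM('a) / 2) / (p - 1)) * M \<longrightarrow>
       integrable ball_measure
         (\<lambda>x. \<bar>B1 x - B2 x\<bar> * norm x powr (M - (real DIM('a) - 2))) \<longrightarrow>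
       (LINT x|ball_measure.
          \<bar>B1 x - B2 x\<bar> * norm x powr (M - (real DIM('a) - 2)))
         < sphere_measure (sphere 0 1 :: 'a set) \<longrightarrow>
       (LINT x|ball_measure. \<bar>V1 x - V2 x\<bar>)
         \<le> C * (LINT x|ball_measure.
                   \<bar>B1 x - B2 x\<bar> * norm x powr (M - (real DIM('a) - 2))) powr \<alpha>)"
proof -
  let ?d = "real DIM('a)"
  define S where "S = sphere_measure (sphere 0 1 :: 'a set)"
  define \<nu> where "\<nu> = (?d - 2) / 2"
  define L where "L = S powr (1 / p) / 4 * ((p - ?d / 2) / (p - 1)) * M"
  define c where "c = 1 - ?d / (2 * p)"
  \<comment> \<open>The bound of \<open>Lp_log_profile_bound\<close> for the threshold
    \<open>L\<close>. It depends on d, p and M only, and since c > 0 it also bounds the unweighted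
    L^1 norms.\<close>
  define R where "R = L powr p / S + 1 / c"
  \<comment> \<open>At least M, so that the given integral dominates the weighted norm of the Born
    difference, and at least 11R for \<open>weighted_stability\<close>.\<close>
  define w where "w = max M (11 * R)"
  define \<alpha> where "\<alpha> = c / (w + c)"
  \<comment> \<open>The summands 2 and 2R belong to the low and the high norm, \<open>S\<close> to
    polar coordinates; dividing by S^\<alpha> compensates that the given integral is S
    \<delta>.\<close>
  define C where "C = S * (2 + 2 * R) / S powr \<alpha>"
  have d2: "2 \<le> ?d" using assms(1) by simp
  have p1: "1 < p" using assms(2) d2 by simp
  have S: "0 < S" unfolding S_def by (rule sphere_measure_pos)
  have c: "0 < c" using assms(2) p1 by (simp add: c_def field_simps)
  have R: "0 < R" using c S by (simp add: R_def add_nonneg_pos)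
  have w: "0 < w" "M \<le> w" "11 * R \<le> w" using R by (auto simp: w_def)
  have \<nu>: "0 \<le> \<nu>" using d2 by (simp add: \<nu>_def)
  have \<alpha>: "0 < \<alpha>" "\<alpha> < 1" using c w by (auto simp: \<alpha>_def)
  have C: "0 < C" using S R by (simp add: C_def)
  have main: "(LINT x|ball_measure. \<bar>V1 x - V2 x\<bar>)
      \<le> C * (LINT x|ball_measure. \<bar>B1 x - B2 x\<bar> * norm x powr (M - (?d - 2))) powr \<alpha>"
    if V: "V1 \<in> Lp_rad p" "V2 \<in> Lp_rad p" and B: "born_approximation V1 B1" "born_approximation V2 B2"
      and nrm: "max (Lp_norm p V1) (Lp_norm p V2) < L"
      and Bint: "integrable ball_measure (\<lambda>x. \<bar>B1 x - B2 x\<bar> * norm x powr (M - (?d - 2)))"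
    for V1 V2 B1 B2 :: "'a \<Rightarrow> real"
  proof -
    let ?I = "LINT x|ball_measure. \<bar>B1 x - B2 x\<bar> * norm x powr (M - (?d - 2))"
    have nrm': "Lp_norm p V1 < L" "Lp_norm p V2 < L" using nrm by auto
    have Vm: "V1 \<in> borel_measurable ball_measure" "V2 \<in> borel_measurable ball_measure" using V by (auto simp: Lp_rad_def)
    obtain v1 where v1 [measurable]: "v1 \<in> borel_measurable borel" and Vv1: "AE x in ball_measure. V1 x = v1 (log_radius x)"
      and q1: "integrable lborel (\<lambda>t. \<bar>log_density v1 t\<bar> * exp (c * t))" "(LBINT t. \<bar>log_density v1 t\<bar> * exp (c * t)) \<le> R"
      by (rule Lp_log_profile_bound[OF p1 assms(2) V(1) nrm'(1), folded c_def S_def, folded R_def])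
    obtain v2 where v2 [measurable]: "v2 \<in> borel_measurable borel" and Vv2: "AE x in ball_measure. V2 x = v2 (log_radius x)"
      and q2: "integrable lborel (\<lambda>t. \<bar>log_density v2 t\<bar> * exp (c * t))" "(LBINT t. \<bar>log_density v2 t\<bar> * exp (c * t)) \<le> R"
      by (rule Lp_log_profile_bound[OF p1 assms(2) V(2) nrm'(2), folded c_def S_def, folded R_def])
    obtain u1 where u1 [measurable]: "u1 \<in> borel_measurable borel" and Bm1: "B1 \<in> borel_measurable ball_measure"
      and Bu1: "AE x in ball_measure. B1 x = u1 (log_radius x)"
      and ev1: "\<forall>\<^sub>F k in sequentially. integrable lborel (\<lambda>t. log_density u1 t * exp (- (2 * (real k + \<nu>) * t))) \<and>
        (LBINT t. log_density u1 t * exp (- (2 * (real k + \<nu>) * t))) = dn_eigenvalue V1 k - real k"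
      by (rule born_log_profile[OF B(1), folded \<nu>_def])
    obtain u2 where u2 [measurable]: "u2 \<in> borel_measurable borel" and Bm2: "B2 \<in> borel_measurable ball_measure"
      and Bu2: "AE x in ball_measure. B2 x = u2 (log_radius x)"
      and ev2: "\<forall>\<^sub>F k in sequentially. integrable lborel (\<lambda>t. log_density u2 t * exp (- (2 * (real k + \<nu>) * t))) \<and>
        (LBINT t. log_density u2 t * exp (- (2 * (real k + \<nu>) * t))) = dn_eigenvalue V2 k - real k"
      by (rule born_log_profile[OF B(2), folded \<nu>_def])
    have pot: "log_potential (log_density v) R"
      if [measurable]: "v \<in> borel_measurable borel" and i: "integrable lborel (\<lambda>t. \<bar>log_density v t\<bar> * exp (c * t))"
        and b: "(LBINT t. \<bar>log_density v t\<bar> * exp (c * t)) \<le> R" for v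
    proof
      have le: "\<bar>log_density v t\<bar> \<le> \<bar>log_density v t\<bar> * exp (c * t)" for t
        using c by (cases "t \<le> 0") (auto simp: log_density_zero mult_le_cancel_left1)
      show int: "integrable lborel (log_density v)" by (rule integrable_bound_lint[OF i]) (use le in auto)
      show "(LBINT s. \<bar>log_density v s\<bar>) \<le> R" using integral_mono[OF integrable_abs[OF int] i le] b by simp
    qed (use R log_density_zero in auto)
    interpret two_potentials "log_density v1" "log_density v2" R unfolding two_potentials_def using pot v1 v2 q1 q2 by blast
    let ?A = "\<lambda>t. log_density u1 t - log_density u2 t" and ?D = "\<lambda>t. log_density v1 t - log_density v2 t"
    have BM: "?I = S * (LBINT t. \<bar>?A t\<bar> * exp (- (M * t)))" "integrable lborel (\<lambda>t. \<bar>?A t\<bar> * exp (- (M * t)))"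
    proof -
      let ?h = "\<lambda>t. \<bar>u1 t - u2 t\<bar> * exp (- ((M - (?d - 2)) * t))"
      have fm: "(\<lambda>x. \<bar>B1 x - B2 x\<bar> * norm x powr (M - (?d - 2))) \<in> borel_measurable ball_measure" using Bint by auto
      have hm: "?h \<in> borel_measurable borel" by measurable
      have ae: "AE x in ball_measure. x \<noteq> 0 \<longrightarrow> \<bar>B1 x - B2 x\<bar> * norm x powr (M - (?d - 2)) = ?h (log_radius x)"
        using Bu1 Bu2 by eventually_elim (simp add: powr_def log_radius_def)
      have rw: "radial_weight TYPE('a) t * ?h t = S * (\<bar>?A t\<bar> * exp (- (M * t)))" for t
      proof (cases "0 < t")
        case True
        have "exp (- (?d * t)) * exp (- ((M - (?d - 2)) * t)) = exp (- (2 * t)) * exp (- (M * t))"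
          by (simp add: exp_add[symmetric] algebra_simps)
        moreover have "\<bar>?A t\<bar> = exp (- (2 * t)) * \<bar>u1 t - u2 t\<bar>"
          using True by (simp add: log_density_def right_diff_distrib[symmetric] abs_mult)
        ultimately show ?thesis using True by (simp add: radial_weight_def S_def)
      qed (simp add: radial_weight_def log_density_def)
      note tr = radial_transfer[OF fm hm ae, unfolded rw]
      show "?I = S * (LBINT t. \<bar>?A t\<bar> * exp (- (M * t)))" using tr(2) by simp
      show "integrable lborel (\<lambda>t. \<bar>?A t\<bar> * exp (- (M * t)))" using tr(1) Bint S by simp
    qed
    have Mw: "\<bar>?A t\<bar> * exp (- (w * t)) \<le> \<bar>?A t\<bar> * exp (- (M * t))" for t
      using w(2) by (cases "t \<le> 0") (auto simp: log_density_zero intro!: mult_left_mono mult_right_mono)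
    have Aw: "integrable lborel (\<lambda>t. \<bar>?A t\<bar> * exp (- (w * t)))" by (rule integrable_bound_lint[OF BM(2)]) (use Mw in auto)
    have dn: "dn_eigenvalue V k - real k = (LBINT s. log_density v s * log_potential.amp (log_density v) (real k + \<nu>) s * exp (- (2 * (real k + \<nu>) * s)))"
      if Vm: "V \<in> borel_measurable ball_measure" and v: "v \<in> borel_measurable borel"
        and Vv: "AE x in ball_measure. V x = v (log_radius x)" and P: "log_potential (log_density v) R"
        and k: "3 * R \<le> real k" for V :: "'a \<Rightarrow> real" and v k
      using dn_eigenvalue_eq[OF assms(1) Vm v Vv P k] by (simp add: \<nu>_def)
    have "\<forall>\<^sub>F k in sequentially. 3 * R \<le> real k" using filterlim_real_sequentially unfolding filterlim_at_top by blast
    with ev1 ev2 have mom: "\<forall>\<^sub>F k in sequentially. (LBINT s. ?A s * exp (- (2 * (real k + \<nu>) * s)))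
      = (LBINT s. log_density v1 s * P1.amp (real k + \<nu>) s * exp (- (2 * (real k + \<nu>) * s)))
        - (LBINT s. log_density v2 s * P2.amp (real k + \<nu>) s * exp (- (2 * (real k + \<nu>) * s)))"
    proof eventually_elim
      case (elim k)
      then show ?case using dn[OF Vm(1) v1 Vv1 P1.log_potential_axioms] dn[OF Vm(2) v2 Vv2 P2.log_potential_axioms]
        by (simp add: left_diff_distrib)
    qed
    define \<delta> where "\<delta> = (LBINT t. \<bar>?A t\<bar> * exp (- (M * t)))"
    have \<delta>0: "0 \<le> \<delta>" unfolding \<delta>_def by (intro Bochner_Integration.integral_nonneg) auto
    have Am: "?A \<in> borel_measurable borel" by measurable
    have A0: "?A s = 0" if "s \<le> 0" for s using that by (simp add: log_density_zero)
    have low: "(LBINT t. \<bar>?D t\<bar> * exp (- (w * t))) \<le> 2 * \<delta>"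
      using weighted_stability[OF Am A0 w(3) Aw mom \<nu>] integral_mono[OF Aw BM(2) Mw] by (simp add: \<delta>_def)
    have Dle: "\<bar>?D t\<bar> * exp (c * t) \<le> \<bar>log_density v1 t\<bar> * exp (c * t) + \<bar>log_density v2 t\<bar> * exp (c * t)" for t
      unfolding distrib_right[symmetric] by (intro mult_right_mono abs_triangle_ineq4) auto
    have sum: "integrable lborel (\<lambda>t. \<bar>log_density v1 t\<bar> * exp (c * t) + \<bar>log_density v2 t\<bar> * exp (c * t))" using q1 q2 by simp
    have Di: "integrable lborel (\<lambda>t. \<bar>?D t\<bar> * exp (c * t))"
      by (rule integrable_bound_lint[OF sum]) (use Dle in \<open>auto intro: order_trans[OF _ abs_ge_self]\<close>)
    have high: "(LBINT t. \<bar>?D t\<bar> * exp (c * t)) \<le> 2 * R" using integral_mono[OF Di sum Dle] q1 q2 by simp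
    have DL: "(LBINT t. \<bar>?D t\<bar>) \<le> (2 + 2 * R) * \<delta> powr \<alpha>"
      unfolding \<alpha>_def by (rule exponential_interpolation[OF _ _ w(1) c \<delta>0 low Di high]) (auto simp: log_density_zero)
    have "(LINT x|ball_measure. \<bar>V1 x - V2 x\<bar>) = (LBINT t. radial_weight TYPE('a) t * \<bar>v1 t - v2 t\<bar>)"
    proof (rule radial_transfer(2))
      show "(\<lambda>x. \<bar>V1 x - V2 x\<bar>) \<in> borel_measurable ball_measure" using Vm by measurable
      show "AE x in ball_measure. x \<noteq> 0 \<longrightarrow> \<bar>V1 x - V2 x\<bar> = \<bar>v1 (log_radius x) - v2 (log_radius x)\<bar>"
        using Vv1 Vv2 by eventually_elim simp
    qed measurable
    \<comment> \<open>For d >= 2 and t > 0 the ball weight e^(-d t) is at most e^(-2 t), the factor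
      contained in \<open>log_density\<close>.\<close>
    also have "\<dots> \<le> (LBINT t. S * \<bar>?D t\<bar>)"
    proof (rule integral_mono_AE')
      show "integrable lborel (\<lambda>t. S * \<bar>?D t\<bar>)" using P1.Q_int P2.Q_int by simp
      have "radial_weight TYPE('a) t * \<bar>v1 t - v2 t\<bar> \<le> S * \<bar>?D t\<bar>" for t
      proof (cases "0 < t")
        case True
        have "exp (- (?d * t)) \<le> exp (- (2 * t))" using d2 True by simp
        then have "exp (- (?d * t)) * \<bar>v1 t - v2 t\<bar> \<le> exp (- (2 * t)) * \<bar>v1 t - v2 t\<bar>" by (rule mult_right_mono) simp
        also have "\<dots> = \<bar>?D t\<bar>" using True by (simp add: log_density_def right_diff_distrib[symmetric] abs_mult)
        finally show ?thesis using True S by (simp add: radial_weight_def S_def[symmetric] mult.assoc)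
      qed (simp add: radial_weight_def log_density_def)
      then show "AE t in lborel. radial_weight TYPE('a) t * \<bar>v1 t - v2 t\<bar> \<le> S * \<bar>?D t\<bar>" by (rule AE_I2)
      show "AE t in lborel. 0 \<le> S * \<bar>?D t\<bar>" using S by simp
    qed
    also have "\<dots> = S * (LBINT t. \<bar>?D t\<bar>)" by simp
    also have "\<dots> \<le> S * ((2 + 2 * R) * \<delta> powr \<alpha>)" using DL S by (intro mult_left_mono) auto
    also have "\<dots> = C * (S * \<delta>) powr \<alpha>" using S \<delta>0 by (simp add: C_def powr_mult)
    also have "S * \<delta> = ?I" using BM(1) by (simp add: \<delta>_def)
    finally show ?thesis .
  qed
  show ?thesis using C \<alpha> main unfolding L_def S_def[symmetric] by (intro exI[of _ C] exI[of _ \<alpha>]) blast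
qed

end
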